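(* Assume the setting, notation and assumptions (A1)-(A4), (M1)-(M2) described in the context (finite discrete $\mathcal X_t$; continuous and bounded costs; Markovian kernels). Then, proceeding backward in time, for every $t\in\{0,\dots,T-1\}$ there exists a Borel measurable optimizer $(x_t,y_t)\mapsto\pi^*(dx_{t+1},dy_{t+1}\mid x_t,y_t)$ for the extended dynamic programming equation (DP). Moreover, the transport plan $\pi^*$ obtained by concatenating these kernels, $$\pi^*(dx_{t+1:T},dy_{t+1:T}\mid x_t,y_t)=\prod_{s=t}^{T-1}\pi^*(dx_{s+1},dy_{s+1}\mid x_s,y_s),$$ is an equilibrium transport. The value function $V_t(x_t,y_t)$ in (DP) is Borel measurable in $(x_t,y_t)$. Moreover, there exists a Polish topology on $\mathcal X_t\times\mathcal Y_t$, finer than $\mathcal T_{\mathcal X_t}\times\mathcal T_{\mathcal Y_t}$, under which $\pi^*(dx_{t+1},dy_{t+1}\mid x_t,y_t)$ and $V_t(x_t,y_t)$ are continuous in $(x_t,y_t)$.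
   Context: **Spaces.** $T\ge 1$ is the finite number of periods. For $t\in\{1,\dots,T\}$, $\mathcal X_t$ and $\mathcal Y_t$ are closed subsets of $\mathbb R^d$, equipped with Polish topologies $\mathcal T_{\mathcal X_t},\mathcal T_{\mathcal Y_t}$; $\mathcal X_0,\mathcal Y_0$ are singletons (the initial state is fixed). Products carry product topologies; $\mathcal X=\mathcal X_1\times\dots\times\mathcal X_T$, $\mathcal Y=\mathcal Y_1\times\dots\times\mathcal Y_T$; $x_{s:t}=(x_s,\dots,x_t)$. $\mathcal P(\mathcal S)$ is the set of Borel probability measures on a Polish space $\mathcal S$, with the usual weak topology (generated by integration against bounded continuous functions); $\mathbb R$ has its usual topology. $\Pi(\alpha,\beta)$ is the set of couplings of $\alpha$ and $\beta$. **Measures and bicausality.** $\mu\in\mathcal P(\mathcal X)$, $\nu\in\mathcal P(\mathcal Y)$, with regular conditional kernels $\mu(dx_{t+1}\mid x_{1:t})$, $\nu(dy_{t+1}\mid y_{1:t})$; for $t=0$ these are the first marginals of $\mu$ and $\nu$. A plan $\pi\in\Pi(\mu,\nu)$ with successive kernels $\pi(dx_{t+1},dy_{t+1}\mid x_{1:t},y_{1:t})$ is bicausal iff its first kernel couples the first marginals of $\mu,\nu$ and, for each $t=1,\dots,T-1$ and $\pi$-a.e. $(x_{1:t},y_{1:t})$, $\pi(dx_{t+1},dy_{t+1}\mid x_{1:t},y_{1:t})\in\Pi(\mu(dx_{t+1}\mid x_{1:t}),\nu(dy_{t+1}\mid y_{1:t}))$. **Assumptions on the measures.** For each $t\in\{1,\dots,T-1\}$: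 (M1) the kernels of $\mu,\nu$ are Markovian, denoted $\mu(dx_{t+1}\mid x_t)$, $\nu(dy_{t+1}\mid y_t)$; (M2) $y_t\mapsto\nu(dy_{t+1}\mid y_t)\in\mathcal P(\mathcal Y_{t+1})$ is Borel measurable. **Assumptions on the costs.** (A1) For each $t\in\{1,\dots,T\}$, $\mathcal X_t$ is a non-empty finite set with the discrete topology. (A2) For each $k\in\{1,\dots,T\}$, $i\in\{0,\dots,T\}$, $c_k(x_i,y_i,x_k,y_k)$ is a real-valued function on $\mathcal X_i\times\mathcal Y_i\times\mathcal X_k\times\mathcal Y_k$ that is continuous and bounded (so for $i=k$, $(x_k,y_k)\mapsto c_k(x_k,y_k,x_k,y_k)$ is continuous and bounded). (A3) $h:\mathcal X_T\times\mathcal Y_T\to\mathbb R$ is continuous and bounded. (A4) For each $t\in\{0,\dots,T\}$, $G(x_t,y_t,g):\mathcal X_t\times\mathcal Y_t\times\mathbb R\to\mathbb R$ is continuous and bounded. **Objective.** $$J(x_t,y_t;\pi)=\int\sum_{k=t+1}^T c_k(x_t,y_t,x_k,y_k)\,\pi(dx_{t+1:T},dy_{t+1:T}\mid x_t,y_t)+G\Big(x_t,y_t,\int h(x_T,y_T)\,\pi(dx_T,dy_T\mid x_t,y_t)\Big).$$ **Equilibrium transport.** A bicausal plan $\pi^*$ with successive kernels $\pi^*(dx_{s+1},dy_{s+1}\mid x_s,y_s)$ is an equilibrium transport if for every $t=0,\dots,T-1$ and $\pi^*$-a.e. path $(x_{1:t},y_{1:t})$, $$\inf_{\gamma\in\Pi(\mu(dx_{t+1}\mid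 x_t),\nu(dy_{t+1}\mid y_t))}J(x_t,y_t;\pi^{t,\gamma})=J(x_t,y_t;\pi^{t,*}),$$ where $\pi^{t,\gamma}=\gamma(dx_{t+1},dy_{t+1})\prod_{s=t+1}^{T-1}\pi^*(dx_{s+1},dy_{s+1}\mid x_s,y_s)$ and $\pi^{t,*}=\prod_{s=t}^{T-1}\pi^*(dx_{s+1},dy_{s+1}\mid x_s,y_s)$. **Extended dynamic programming equation (DP).** $V_T(x_T,y_T)=G(x_T,y_T,h(x_T,y_T))$ and, for $t=T-1,\dots,0$, $$\begin{aligned}V_t(x_t,y_t)=\inf_{\gamma\in\Pi(\mu(dx_{t+1}\mid x_t),\nu(dy_{t+1}\mid y_t))}\Big[&\int\big(c_{t+1}(x_t,y_t,x_{t+1},y_{t+1})+V_{t+1}(x_{t+1},y_{t+1})\big)d\gamma-\int G(x_{t+1},y_{t+1},g_{t+1}(x_{t+1},y_{t+1}))d\gamma\\&+G\Big(x_t,y_t,\int g_{t+1}(x_{t+1},y_{t+1})d\gamma\Big)-\int\sum_{k=t+2}^T b_k(x_{t+1},y_{t+1},x_{t+1},y_{t+1})d\gamma\\&+\int\sum_{k=t+2}^T b_k(x_t,y_t,x_{t+1},y_{t+1})d\gamma\Big],\end{aligned}$$ where $d\gamma=\gamma(dx_{t+1},dy_{t+1})$, $\pi^*(dx_{s+1},dy_{s+1}\mid x_s,y_s)$ denotes an optimizer at time $s$ (already chosen for all $s>t$), $\pi^*(dx_k,dy_k\mid x_{t+1},y_{t+1})$ is the marginal on $(x_k,y_k)$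 of the concatenation of these kernels, $g_T=h$, and $$g_{t+1}(x_{t+1},y_{t+1})=\int h(x_T,y_T)\,\pi^*(dx_T,dy_T\mid x_{t+1},y_{t+1}),\qquad b_k(w,v,x_{t+1},y_{t+1})=\int c_k(w,v,x_k,y_k)\,\pi^*(dx_k,dy_k\mid x_{t+1},y_{t+1})$$ for $t\in\{0,\dots,T-2\}$, $k\in\{t+2,\dots,T\}$, $w\in\mathcal X_i$, $v\in\mathcal Y_i$, $i\in\{0,\dots,t+1\}$. Borel measurability and continuity of $\pi^*(dx_{t+1},dy_{t+1}\mid x_t,y_t)$ refer to it as a map from $\mathcal X_t\times\mathcal Y_t$ to $\mathcal P(\mathcal X_{t+1}\times\mathcal Y_{t+1})$ with the weak topology. *)

theory Defs
  imports "HOL-Probability.Probability"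
begin

section \<open>Polish topologies, Borel probabilities, weak topology, couplings\<close>

definition polish_topology :: "'a topology \<Rightarrow> bool" where
  "polish_topology S \<longleftrightarrow> completely_metrizable_space S \<and> separable_space S"

definition borel_of :: "'a topology \<Rightarrow> 'a measure" where
  "borel_of S = sigma (topspace S) {U. openin S U}"

definition prob_measures :: "'a topology \<Rightarrow> 'a measure set" where
  "prob_measures S = {M. sets M = sets (borel_of S) \<and> prob_space M}"

definition weak_topology :: "'a topology \<Rightarrow> 'a measure topology" where
  "weak_topology S = topology_generated_by
     {{M \<in> prob_measures S. (\<integral>z. f z \<partial>M) \<in> U} | f U.
        continuous_map S euclideanreal f \<and> bounded (f ` topspace S) \<and> open (U :: real set)}"

definition couplings ::
  "'a topology \<Rightarrow> 'b topology \<Rightarrow> 'a measure \<Rightarrow> 'b measure \<Rightarrow> ('a \<times> 'b) measure set" where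
  "couplings S S' \<alpha> \<beta> =
     {\<gamma> \<in> prob_measures (prod_topology S S').
        distr \<gamma> (borel_of S) fst = \<alpha> \<and> distr \<gamma> (borel_of S') snd = \<beta>}"

text \<open>\<open>\<kappa>\<close> is a regular conditional distribution of \<open>W\<close> (valued in \<open>S'\<close>) given \<open>Z\<close> (valued in \<open>S\<close>)
  under \<open>M\<close>. Measurability into \<^const>\<open>prob_algebra\<close> says that every \<open>\<kappa> s\<close> is a probability and
  that \<open>s \<mapsto> \<kappa> s B\<close> is Borel for every Borel set \<open>B\<close>.\<close>

definition regular_cond_kernel ::
  "'w measure \<Rightarrow> 'a topology \<Rightarrow> ('w \<Rightarrow> 'a) \<Rightarrow> 'b topology \<Rightarrow> ('w \<Rightarrow> 'b) \<Rightarrow> ('a \<Rightarrow> 'b measure) \<Rightarrow> bool" where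
  "regular_cond_kernel M S Z S' W \<kappa> \<longleftrightarrow>
     \<kappa> \<in> borel_of S \<rightarrow>\<^sub>M prob_algebra (borel_of S') \<and>
     (\<forall>A \<in> sets (borel_of S). \<forall>B \<in> sets (borel_of S').
        emeasure M {\<omega> \<in> space M. Z \<omega> \<in> A \<and> W \<omega> \<in> B}
          = (\<integral>\<^sup>+ \<omega>. indicator A (Z \<omega>) * emeasure (\<kappa> (Z \<omega>)) B \<partial>M))"

section \<open>Paths and kernels\<close>

text \<open>A path \<open>x\<^bsub>s:u\<^esub>\<close> is an extensional function on \<open>{s..u}\<close>; a path of pairs
  \<open>(x\<^bsub>s:u\<^esub>, y\<^bsub>s:u\<^esub>)\<close> is a pair of such functions. For \<open>u < s\<close> the path space is a single point.\<close>

type_synonym ('a, 'b) path = "(nat \<Rightarrow> 'a) \<times> (nat \<Rightarrow> 'b)"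

text \<open>The state at time \<open>t\<close> of a path indexed by \<open>{1..T}\<close>, with fixed state \<open>x0\<close> at time \<open>0\<close>.\<close>

definition state_at :: "'a \<Rightarrow> nat \<Rightarrow> (nat \<Rightarrow> 'a) \<Rightarrow> 'a" where
  "state_at x0 t xs = (if t = 0 then x0 else xs t)"

text \<open>The successive kernels \<open>\<mu>(dx\<^bsub>t+1\<^esub> | x\<^bsub>1:t\<^esub>)\<close> of a measure on \<open>X\<^sub>1 \<times> \<dots> \<times> X\<^sub>T\<close>. For \<open>t = 0\<close> the
  conditioning space is a single point and the kernel is the first marginal.\<close>

definition successive_kernels ::
  "nat \<Rightarrow> (nat \<Rightarrow> 'a topology) \<Rightarrow> (nat \<Rightarrow> 'a) measure \<Rightarrow> (nat \<Rightarrow> (nat \<Rightarrow> 'a) \<Rightarrow> 'a measure) \<Rightarrow> bool" where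
  "successive_kernels T TX \<mu> A \<longleftrightarrow>
     (\<forall>t<T. regular_cond_kernel \<mu>
        (product_topology TX {1..t}) (\<lambda>xs. restrict xs {1..t})
        (TX (Suc t)) (\<lambda>xs. xs (Suc t)) (A t))"

definition markov_kernels ::
  "nat \<Rightarrow> (nat \<Rightarrow> 'a topology) \<Rightarrow> 'a \<Rightarrow> (nat \<Rightarrow> 'a) measure \<Rightarrow> (nat \<Rightarrow> 'a \<Rightarrow> 'a measure) \<Rightarrow> bool" where
  "markov_kernels T TX x0 \<mu> \<kappa> \<longleftrightarrow>
     successive_kernels T TX \<mu> (\<lambda>t xs. \<kappa> t (state_at x0 t xs))"

context
  fixes T :: nat
    and TX :: "nat \<Rightarrow> 'a topology" and TY :: "nat \<Rightarrow> 'b topology"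
begin

definition states :: "nat \<Rightarrow> ('a \<times> 'b) topology" where
  "states t = prod_topology (TX t) (TY t)"

definition paths :: "nat \<Rightarrow> nat \<Rightarrow> ('a, 'b) path topology" where
  "paths s u = prod_topology (product_topology TX {s..u}) (product_topology TY {s..u})"

definition successive_pair_kernels ::
  "('a, 'b) path measure \<Rightarrow> (nat \<Rightarrow> ('a, 'b) path \<Rightarrow> ('a \<times> 'b) measure) \<Rightarrow> bool" where
  "successive_pair_kernels \<pi> L \<longleftrightarrow>
     (\<forall>t<T. regular_cond_kernel \<pi>
        (paths 1 t) (\<lambda>(xs, ys). (restrict xs {1..t}, restrict ys {1..t}))
        (states (Suc t)) (\<lambda>(xs, ys). (xs (Suc t), ys (Suc t))) (L t))"

text \<open>Bicausality with respect to given successive kernels \<open>A\<close> of \<open>\<mu>\<close> and \<open>B\<close> of \<open>\<nu>\<close>. The case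
  \<open>t = 0\<close> says that the first kernel couples the first marginals.\<close>

definition bicausal ::
  "(nat \<Rightarrow> 'a) measure \<Rightarrow> (nat \<Rightarrow> 'b) measure \<Rightarrow>
   (nat \<Rightarrow> (nat \<Rightarrow> 'a) \<Rightarrow> 'a measure) \<Rightarrow> (nat \<Rightarrow> (nat \<Rightarrow> 'b) \<Rightarrow> 'b measure) \<Rightarrow>
   ('a, 'b) path measure \<Rightarrow> bool" where
  "bicausal \<mu> \<nu> A B \<pi> \<longleftrightarrow>
     \<pi> \<in> couplings (product_topology TX {1..T}) (product_topology TY {1..T}) \<mu> \<nu> \<and>
     (\<exists>L. successive_pair_kernels \<pi> L \<and>
        (\<forall>t<T. AE (xs, ys) in \<pi>.
           L t (restrict xs {1..t}, restrict ys {1..t})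
             \<in> couplings (TX (Suc t)) (TY (Suc t))
                 (A t (restrict xs {1..t})) (B t (restrict ys {1..t}))))"

text \<open>\<open>concat_kernels K n t (x\<^sub>t, y\<^sub>t)\<close> is the law of \<open>(x\<^bsub>t+1:t+n\<^esub>, y\<^bsub>t+1:t+n\<^esub>)\<close> under
  \<open>\<Prod>\<^bsub>s=t..t+n-1\<^esub> K\<^sub>s(dx\<^bsub>s+1\<^esub>, dy\<^bsub>s+1\<^esub> | x\<^sub>s, y\<^sub>s)\<close>.\<close>

primrec concat_kernels ::
  "(nat \<Rightarrow> 'a \<times> 'b \<Rightarrow> ('a \<times> 'b) measure) \<Rightarrow> nat \<Rightarrow> nat \<Rightarrow> 'a \<times> 'b \<Rightarrow> ('a, 'b) path measure" where
  "concat_kernels K 0 t z = return (borel_of (paths (Suc t) t)) (\<lambda>_. undefined, \<lambda>_. undefined)"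
| "concat_kernels K (Suc n) t z =
     K t z \<bind> (\<lambda>(x, y).
       distr (concat_kernels K n (Suc t) (x, y)) (borel_of (paths (Suc t) (t + Suc n)))
         (\<lambda>(xs, ys). (xs(Suc t := x), ys(Suc t := y))))"

text \<open>The marginal \<open>\<pi>\<^sup>*(dx\<^sub>k, dy\<^sub>k | x\<^sub>s, y\<^sub>s)\<close> of the concatenation, for \<open>s < k \<le> T\<close>.\<close>

definition marginal_at ::
  "(nat \<Rightarrow> 'a \<times> 'b \<Rightarrow> ('a \<times> 'b) measure) \<Rightarrow> nat \<Rightarrow> nat \<Rightarrow> 'a \<times> 'b \<Rightarrow> ('a \<times> 'b) measure" where
  "marginal_at K k s z =
     distr (concat_kernels K (T - s) s z) (borel_of (states k)) (\<lambda>(xs, ys). (xs k, ys k))"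

end

section \<open>Objective, equilibrium transport, extended dynamic programming\<close>

text \<open>States are pairs \<open>z\<^sub>t = (x\<^sub>t, y\<^sub>t)\<close>. The cost \<open>c\<^sub>k(x\<^sub>i, y\<^sub>i, x\<^sub>k, y\<^sub>k)\<close> is written
  \<open>c k i (z\<^sub>i, z\<^sub>k)\<close>: the time \<open>i\<close> of the first argument is explicit, because the domain depends on it.
  \<open>\<kappa>\<mu>\<close>, \<open>\<kappa>\<nu>\<close> are the Markov kernels of \<open>\<mu>\<close>, \<open>\<nu>\<close>, and \<open>K\<close> is a family of kernels
  \<open>\<pi>\<^sup>*(dx\<^bsub>t+1\<^esub>, dy\<^bsub>t+1\<^esub> | x\<^sub>t, y\<^sub>t)\<close>. All infima below are of real functions that are bounded below
  when the costs are bounded.\<close>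

context
  fixes T :: nat
    and TX :: "nat \<Rightarrow> 'a topology" and TY :: "nat \<Rightarrow> 'b topology"
    and x0 :: 'a and y0 :: 'b
    and \<mu> :: "(nat \<Rightarrow> 'a) measure" and \<nu> :: "(nat \<Rightarrow> 'b) measure"
    and \<kappa>\<mu> :: "nat \<Rightarrow> 'a \<Rightarrow> 'a measure" and \<kappa>\<nu> :: "nat \<Rightarrow> 'b \<Rightarrow> 'b measure"
    and c :: "nat \<Rightarrow> nat \<Rightarrow> ('a \<times> 'b) \<times> ('a \<times> 'b) \<Rightarrow> real"
    and h :: "'a \<times> 'b \<Rightarrow> real"
    and G :: "nat \<Rightarrow> ('a \<times> 'b) \<times> real \<Rightarrow> real"
begin

definition admissible :: "nat \<Rightarrow> 'a \<times> 'b \<Rightarrow> ('a \<times> 'b) measure set" where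
  "admissible t z = couplings (TX (Suc t)) (TY (Suc t)) (\<kappa>\<mu> t (fst z)) (\<kappa>\<nu> t (snd z))"

text \<open>The last argument is the conditional law of \<open>(x\<^bsub>t+1:T\<^esub>, y\<^bsub>t+1:T\<^esub>)\<close>.\<close>

definition objective :: "nat \<Rightarrow> 'a \<times> 'b \<Rightarrow> ('a, 'b) path measure \<Rightarrow> real" where
  "objective t z P =
     (\<integral>(xs, ys). (\<Sum>k=t+1..T. c k t (z, (xs k, ys k))) \<partial>P)
     + G t (z, \<integral>(xs, ys). h (xs T, ys T) \<partial>P)"

text \<open>The kernels are part of the data: conditional laws \<open>\<pi>\<^sup>*(\<cdot> | x\<^sub>s, y\<^sub>s)\<close> also enter at states that
  \<open>\<gamma>\<close> may reach but \<open>\<pi>\<^sup>*\<close> does not. Replacing \<open>K t\<close> by the constant \<open>\<gamma>\<close> yields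
  \<open>\<pi>\<^bsup>t,\<gamma>\<^esup>\<close>.\<close>

definition equilibrium_transport ::
  "('a, 'b) path measure \<Rightarrow> (nat \<Rightarrow> 'a \<times> 'b \<Rightarrow> ('a \<times> 'b) measure) \<Rightarrow> bool" where
  "equilibrium_transport \<pi> K \<longleftrightarrow>
     bicausal T TX TY \<mu> \<nu> (\<lambda>t xs. \<kappa>\<mu> t (state_at x0 t xs)) (\<lambda>t ys. \<kappa>\<nu> t (state_at y0 t ys)) \<pi> \<and>
     successive_pair_kernels T TX TY \<pi>
       (\<lambda>t (xs, ys). K t (state_at x0 t xs, state_at y0 t ys)) \<and>
     (\<forall>t<T. AE (xs, ys) in \<pi>.
        let z = (state_at x0 t xs, state_at y0 t ys) in
        (INF \<gamma>\<in>admissible t z.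
           objective t z (concat_kernels TX TY (K(t := \<lambda>_. \<gamma>)) (T - t) t z))
        = objective t z (concat_kernels TX TY K (T - t) t z))"

definition g_fun :: "(nat \<Rightarrow> 'a \<times> 'b \<Rightarrow> ('a \<times> 'b) measure) \<Rightarrow> nat \<Rightarrow> 'a \<times> 'b \<Rightarrow> real" where
  "g_fun K s z = (if s = T then h z else (\<integral>z'. h z' \<partial>marginal_at T TX TY K T s z))"

text \<open>\<open>b_fun K k i s w z\<close> is \<open>b\<^sub>k(w, x\<^sub>s, y\<^sub>s)\<close> with \<open>w \<in> X\<^sub>i \<times> Y\<^sub>i\<close> and \<open>z = (x\<^sub>s, y\<^sub>s)\<close>.\<close>

definition b_fun ::
  "(nat \<Rightarrow> 'a \<times> 'b \<Rightarrow> ('a \<times> 'b) measure) \<Rightarrow> nat \<Rightarrow> nat \<Rightarrow> nat \<Rightarrow> 'a \<times> 'b \<Rightarrow> 'a \<times> 'b \<Rightarrow> real" where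
  "b_fun K k i s w z = (\<integral>z'. c k i (w, z') \<partial>marginal_at T TX TY K k s z)"

text \<open>The bracket in the dynamic programming equation, with \<open>v\<close> in place of \<open>V\<^bsub>t+1\<^esub>\<close>. It depends
  on \<open>K s\<close> for \<open>s > t\<close> only.\<close>

definition dp_bracket ::
  "(nat \<Rightarrow> 'a \<times> 'b \<Rightarrow> ('a \<times> 'b) measure) \<Rightarrow> nat \<Rightarrow> 'a \<times> 'b \<Rightarrow> ('a \<times> 'b \<Rightarrow> real) \<Rightarrow>
   ('a \<times> 'b) measure \<Rightarrow> real" where
  "dp_bracket K t z v \<gamma> =
     (\<integral>z'. c (t+1) t (z, z') + v z' \<partial>\<gamma>)
     - (\<integral>z'. G (t+1) (z', g_fun K (t+1) z') \<partial>\<gamma>)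
     + G t (z, \<integral>z'. g_fun K (t+1) z' \<partial>\<gamma>)
     - (\<integral>z'. (\<Sum>k=t+2..T. b_fun K k (t+1) (t+1) z' z') \<partial>\<gamma>)
     + (\<integral>z'. (\<Sum>k=t+2..T. b_fun K k t (t+1) z z') \<partial>\<gamma>)"

function dp_value ::
  "(nat \<Rightarrow> 'a \<times> 'b \<Rightarrow> ('a \<times> 'b) measure) \<Rightarrow> nat \<Rightarrow> 'a \<times> 'b \<Rightarrow> real" where
  "dp_value K t z =
     (if t < T
      then (INF \<gamma>\<in>admissible t z. dp_bracket K t z (\<lambda>z'. dp_value K (Suc t) z') \<gamma>)
      else G T (z, h z))"
  by pat_completeness auto
termination by (relation "Wellfounded.measure (\<lambda>(K, t, z). T - t)") auto

definition borel_optimizer ::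
  "(nat \<Rightarrow> 'a \<times> 'b \<Rightarrow> ('a \<times> 'b) measure) \<Rightarrow> nat \<Rightarrow> bool" where
  "borel_optimizer K t \<longleftrightarrow>
     K t \<in> borel_of (states TX TY t) \<rightarrow>\<^sub>M borel_of (weak_topology (states TX TY (Suc t))) \<and>
     (\<forall>z \<in> topspace (states TX TY t).
        K t z \<in> admissible t z \<and>
        dp_bracket K t z (dp_value K (Suc t)) (K t z) = dp_value K t z)"

end

text \<open>Otherwise the recursive equation makes the simplifier loop.\<close>
declare dp_value.simps [simp del]

end

theory Submission
  imports Defs
begin

text \<open>
  Since the correction terms in the bracket of (DP) cancel against the continuation value, the
  problem at time \<open>t\<close> is to minimize \<open>\<integral>F(z, \<cdot>) d\<gamma> + G\<^sub>t(z, \<integral>g d\<gamma>)\<close> over couplings \<open>\<gamma>\<close> whose marginals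
  depend measurably on \<open>z\<close>, where \<open>F\<close> and \<open>g\<close> are bounded and merely Borel. As \<open>X\<^bsub>t+1\<^esub>\<close> is finite, all
  these couplings have densities bounded by \<open>card X\<^bsub>t+1\<^esub>\<close> with respect to one kernel, the product of
  the uniform distribution with \<open>\<nu>(dy\<^bsub>t+1\<^esub> | y\<^sub>t)\<close>. Bounded densities are sequentially compact for
  integration against all integrable functions and contain a countable set that is \<open>L\<^sup>1\<close>-dense for
  every value of the kernel, so that lexicographic minimization of the objective and then of the
  masses of a countable generator selects a measurable optimizer. The value function and the
  equilibrium property follow by time consistency of the two integrals in the objective, and
  continuity follows by making countably many Borel sets open in a finer Polish topology, because
  the weak topology is second countable.
\<close>

section \<open>Borel sigma-algebras of topologies\<close>

text \<open>The costs depend on the current state and \<open>G\<close> is nonlinear in an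
  expectation, so the dates do not share one criterion; hence the kernel of one date is varied while
  the later ones stay fixed. The obstacle is regularity: a later optimizer is known only to be
  Borel, and so are the functions \<open>g\<close> and \<open>b\<close> computed from it. Weak
  compactness of the couplings then gives neither attainment nor semicontinuity; integrals of all
  bounded Borel functions have to converge. Densities also replace the set of couplings, which
  varies with the state, by one fixed set of functions, in which the marginal conditions are
  equations depending measurably on the state. Minimizers are not unique, and the lexicographic
  refinement makes up for this: the masses of a countable intersection-stable generator determine a
  measure, so fixing them one after the other leaves a single law, and the successive minima are
  measurable although the minimizer is picked by choice. The topology is refined at the very end,
  date by date, because the backward recursion itself preserves only measurability.\<close>

lemma space_borel_of [simp]: "space (borel_of S) = topspace S"
  unfolding borel_of_def by (rule space_measure_of) (auto dest: openin_subset)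

lemma sets_borel_of: "sets (borel_of S) = sigma_sets (topspace S) {U. openin S U}"
  unfolding borel_of_def by (rule sets_measure_of) (auto dest: openin_subset)

lemma openin_borel_of: "openin S U \<Longrightarrow> U \<in> sets (borel_of S)"
  by (simp add: sets_borel_of sigma_sets.Basic)

lemma continuous_map_borel_of:
  assumes "continuous_map S S' f"
  shows "f \<in> borel_of S \<rightarrow>\<^sub>M borel_of S'"
proof (rule measurable_sigma_sets[OF sets_borel_of])
  show "{U. openin S' U} \<subseteq> Pow (topspace S')" by (auto dest: openin_subset)
  show "f \<in> space (borel_of S) \<rightarrow> topspace S'"
    using assms by (auto simp: continuous_map_def)
  fix U assume "U \<in> {U. openin S' U}"
  then have "openin S {x \<in> topspace S. f x \<in> U}"
    using assms by (auto simp: continuous_map_def)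
  then show "f -` U \<inter> space (borel_of S) \<in> sets (borel_of S)"
    by (auto dest!: openin_borel_of simp: vimage_def Int_def conj_commute)
qed

lemma sets_borel_of_euclidean: "sets (borel_of euclidean) = sets borel"
  by (simp add: sets_borel_of borel_def)

lemma continuous_map_borel_measurable:
  fixes f :: "'a \<Rightarrow> 'b :: topological_space"
  assumes "continuous_map S euclidean f"
  shows "f \<in> borel_measurable (borel_of S)"
  using continuous_map_borel_of[OF assms] measurable_cong_sets[OF refl sets_borel_of_euclidean]
  by blast

text \<open>Finite intersections of members of a countable base. Closure under intersections makes
  the family a pi-system, so that finite measures are determined by their values on it; the whole
  space is added to compare total masses.\<close>

lemma borel_of_countable_Int_stable_generator:
  assumes "second_countable S"
  obtains \<E> where "countable \<E>" "Int_stable \<E>" "\<And>E. E \<in> \<E> \<Longrightarrow> openin S E" "topspace S \<in> \<E>"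
    "sets (borel_of S) = sigma_sets (topspace S) \<E>"
proof -
  obtain \<B> where \<B>: "countable \<B>" "\<And>V. V \<in> \<B> \<Longrightarrow> openin S V"
    and base: "\<And>U x. openin S U \<Longrightarrow> x \<in> U \<Longrightarrow> \<exists>V \<in> \<B>. x \<in> V \<and> V \<subseteq> U"
    using assms by (auto simp: second_countable_def)
  define \<B>' where "\<B>' = insert (topspace S) \<B>"
  define \<E> where "\<E> = (\<lambda>F. \<Inter>F) ` {F. finite F \<and> F \<noteq> {} \<and> F \<subseteq> \<B>'}"
  have c: "countable \<B>'" using \<B> by (simp add: \<B>'_def)
  have "countable {F. finite F \<and> F \<subseteq> \<B>'}" by (rule countable_Collect_finite_subset[OF c])
  then have "countable {F. finite F \<and> F \<noteq> {} \<and> F \<subseteq> \<B>'}"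
    by (rule countable_subset[rotated]) auto
  then have 1: "countable \<E>" unfolding \<E>_def by simp
  have 2: "Int_stable \<E>"
    unfolding Int_stable_def
  proof (intro ballI)
    fix a b assume "a \<in> \<E>" "b \<in> \<E>"
    then obtain F G where "a = \<Inter>F" "b = \<Inter>G" "finite F" "F \<noteq> {}" "F \<subseteq> \<B>'" "finite G" "G \<noteq> {}" "G \<subseteq> \<B>'"
      unfolding \<E>_def by auto
    then show "a \<inter> b \<in> \<E>"
      unfolding \<E>_def by (intro image_eqI[of _ _ "F \<union> G"]) auto
  qed
  have ope: "openin S E" if "E \<in> \<E>" for E
    using that \<B> unfolding \<E>_def \<B>'_def by (auto intro!: openin_Inter)
  have base_E: "\<B> \<subseteq> \<E>"
  proof
    fix B assume "B \<in> \<B>" then show "B \<in> \<E>"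
      unfolding \<E>_def \<B>'_def by (intro image_eqI[of _ _ "{B}"]) auto
  qed
  have top: "topspace S \<in> \<E>"
    unfolding \<E>_def \<B>'_def by (intro image_eqI[of _ _ "{topspace S}"]) auto
  have "U \<in> sigma_sets (topspace S) \<E>" if "openin S U" for U
  proof -
    have "U = \<Union>{V \<in> \<B>. V \<subseteq> U}" using base[OF that] by blast
    moreover have "\<Union>{V \<in> \<B>. V \<subseteq> U} \<in> sigma_sets (topspace S) \<E>"
      using base_E by (intro sigma_sets_UNION) (auto intro: countable_subset[OF _ \<B>(1)] sigma_sets.Basic)
    ultimately show ?thesis by simp
  qed
  then have "sets (borel_of S) = sigma_sets (topspace S) \<E>"
    unfolding sets_borel_of using ope
    by (intro sigma_sets_eqI) (auto intro: sigma_sets.Basic)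
  with 1 2 ope top show thesis by (rule that)
qed

text \<open>Second countability turns every open set into a countable union of open rectangles; the
  other inclusion holds because the projections are continuous.\<close>

lemma sets_borel_of_prod:
  assumes "second_countable S" "second_countable S'"
  shows "sets (borel_of (prod_topology S S')) = sets (borel_of S \<Otimes>\<^sub>M borel_of S')"
proof
  obtain \<B> where \<B>: "countable \<B>" "\<And>V. V \<in> \<B> \<Longrightarrow> openin S V"
    and base: "\<And>U x. openin S U \<Longrightarrow> x \<in> U \<Longrightarrow> \<exists>V \<in> \<B>. x \<in> V \<and> V \<subseteq> U"
    using assms(1) by (auto simp: second_countable_def)
  obtain \<C> where \<C>: "countable \<C>" "\<And>V. V \<in> \<C> \<Longrightarrow> openin S' V"
    and base': "\<And>U x. openin S' U \<Longrightarrow> x \<in> U \<Longrightarrow> \<exists>V \<in> \<C>. x \<in> V \<and> V \<subseteq> U"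
    using assms(2) by (auto simp: second_countable_def)
  have "W \<in> sets (borel_of S \<Otimes>\<^sub>M borel_of S')" if W: "openin (prod_topology S S') W" for W
  proof -
    let ?I = "{(B, C). B \<in> \<B> \<and> C \<in> \<C> \<and> B \<times> C \<subseteq> W}"
    have "W = (\<Union>(B, C)\<in>?I. B \<times> C)"
    proof (intro subset_antisym subsetI)
      fix p assume p: "p \<in> W"
      then obtain U V where UV: "openin S U" "openin S' V" "fst p \<in> U" "snd p \<in> V" "U \<times> V \<subseteq> W"
        using W[unfolded openin_prod_topology_alt, rule_format, of "fst p" "snd p"] by auto
      then obtain B C where "B \<in> \<B>" "fst p \<in> B" "B \<subseteq> U" "C \<in> \<C>" "snd p \<in> C" "C \<subseteq> V"
        using base base' by meson
      with UV show "p \<in> (\<Union>(B, C)\<in>?I. B \<times> C)"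
        by (intro UN_I[of "(B, C)"]) (auto simp: mem_Times_iff)
    qed auto
    moreover have "countable ?I"
      by (rule countable_subset[OF _ countable_SIGMA[OF \<B>(1) \<C>(1)]]) auto
    then have "(\<Union>(B, C)\<in>?I. B \<times> C) \<in> sets (borel_of S \<Otimes>\<^sub>M borel_of S')"
      using \<B>(2) \<C>(2) by (intro sets.countable_UN'') (auto intro!: pair_measureI openin_borel_of)
    ultimately show ?thesis by simp
  qed
  then show "sets (borel_of (prod_topology S S')) \<subseteq> sets (borel_of S \<Otimes>\<^sub>M borel_of S')"
    unfolding sets_borel_of[of "prod_topology S S'"]
    by (intro sets.sigma_sets_subset'[of _ "borel_of S \<Otimes>\<^sub>M borel_of S'", simplified])
       (auto simp: space_pair_measure[symmetric] sets.top[of "borel_of S \<Otimes>\<^sub>M borel_of S'", simplified space_pair_measure, simplified])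
  have "fst \<in> borel_of (prod_topology S S') \<rightarrow>\<^sub>M borel_of S"
    "snd \<in> borel_of (prod_topology S S') \<rightarrow>\<^sub>M borel_of S'"
    by (auto intro!: continuous_map_borel_of continuous_map_fst continuous_map_snd)
  then have "A \<times> B \<in> sets (borel_of (prod_topology S S'))"
    if "A \<in> sets (borel_of S)" "B \<in> sets (borel_of S')" for A B
  proof -
    have "A \<times> B = (fst -` A \<inter> space (borel_of (prod_topology S S')))
        \<inter> (snd -` B \<inter> space (borel_of (prod_topology S S')))"
      using sets.sets_into_space[OF that(1)] sets.sets_into_space[OF that(2)] by auto
    then show ?thesis
      using that \<open>fst \<in> _\<close> \<open>snd \<in> _\<close> by (metis measurable_sets sets.Int)
  qed
  then show "sets (borel_of S \<Otimes>\<^sub>M borel_of S') \<subseteq> sets (borel_of (prod_topology S S'))"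
    unfolding sets_pair_measure
    by (intro sets.sigma_sets_subset'[of _ "borel_of (prod_topology S S')", simplified])
       (auto simp: sets.top[of "borel_of (prod_topology S S')", simplified])
qed

text \<open>As for two factors, with boxes in place of rectangles; a finite index set keeps the
  boxes of base sets countable in number and measurable.\<close>

lemma sets_borel_of_product:
  assumes "finite I" "\<And>i. i \<in> I \<Longrightarrow> second_countable (S i)"
  shows "sets (borel_of (product_topology S I)) = sets (PiM I (\<lambda>i. borel_of (S i)))"
proof
  let ?P = "PiM I (\<lambda>i. borel_of (S i))"
  have "\<exists>\<B>. countable \<B> \<and> (\<forall>V\<in>\<B>. openin (S i) V) \<and>
      (\<forall>U x. openin (S i) U \<and> x \<in> U \<longrightarrow> (\<exists>V \<in> \<B>. x \<in> V \<and> V \<subseteq> U))" if "i \<in> I" for i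
    using assms(2)[OF that] by (simp add: second_countable_def)
  then obtain \<B> where \<B>: "\<And>i. i \<in> I \<Longrightarrow> countable (\<B> i)" "\<And>i V. i \<in> I \<Longrightarrow> V \<in> \<B> i \<Longrightarrow> openin (S i) V"
    and base: "\<And>i U x. i \<in> I \<Longrightarrow> openin (S i) U \<Longrightarrow> x \<in> U \<Longrightarrow> \<exists>V \<in> \<B> i. x \<in> V \<and> V \<subseteq> U"
    by metis
  have sp: "space ?P = topspace (product_topology S I)"
    by (simp add: space_PiM)
  have "W \<in> sets ?P" if W: "openin (product_topology S I) W" for W
  proof -
    let ?J = "{F \<in> PiE I \<B>. PiE I F \<subseteq> W}"
    have "W = (\<Union>F\<in>?J. PiE I F)"
    proof (intro subset_antisym subsetI)
      fix p assume p: "p \<in> W"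
      have pI: "p \<in> extensional I"
        using p W openin_subset[OF W] by (auto simp: PiE_def)
      obtain U where U: "\<And>i. i \<in> I \<Longrightarrow> openin (S i) (U i)" "p \<in> PiE I U" "PiE I U \<subseteq> W"
        using W p unfolding openin_product_topology_alt by metis
      have "\<exists>V\<in>\<B> i. p i \<in> V \<and> V \<subseteq> U i" if "i \<in> I" for i
        using U that by (intro base) auto
      then obtain F where F: "\<And>i. i \<in> I \<Longrightarrow> F i \<in> \<B> i \<and> p i \<in> F i \<and> F i \<subseteq> U i" by metis
      let ?F = "restrict F I"
      have "PiE I ?F \<subseteq> PiE I U" using F by (intro PiE_mono) auto
      then have "?F \<in> ?J" using F U by auto
      moreover have "p \<in> PiE I ?F" using F pI by (auto simp: PiE_def)
      ultimately show "p \<in> (\<Union>F\<in>?J. PiE I F)" by blast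
    qed auto
    moreover have "countable ?J"
      by (rule countable_subset[OF _ countable_PiE[OF assms(1), of \<B>]]) (use \<B> in auto)
    then have "(\<Union>F\<in>?J. PiE I F) \<in> sets ?P"
      using \<B>(2) assms(1)
      by (intro sets.countable_UN'') (auto intro!: sets_PiM_I_finite openin_borel_of simp: PiE_iff)
    ultimately show ?thesis by simp
  qed
  then show "sets (borel_of (product_topology S I)) \<subseteq> sets ?P"
    unfolding sets_borel_of[of "product_topology S I"] sp[symmetric]
    by (intro sets.sigma_sets_subset) auto
  \<comment> \<open>Measurability of the identity, checked on coordinates, says that the sets of the
    product sigma-algebra are Borel.\<close>
  have "(\<lambda>f. f) \<in> borel_of (product_topology S I) \<rightarrow>\<^sub>M ?P"
  proof (rule measurable_PiM_single')
    fix i assume "i \<in> I"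
    then show "(\<lambda>f. f i) \<in> borel_of (product_topology S I) \<rightarrow>\<^sub>M borel_of (S i)"
      by (intro continuous_map_borel_of continuous_map_product_projection)
  qed (auto simp: )
  then have "A \<inter> space (borel_of (product_topology S I)) \<in> sets (borel_of (product_topology S I))"
    if "A \<in> sets ?P" for A
    using measurable_sets[OF \<open>(\<lambda>f. f) \<in> _\<close> that] by (simp del: space_borel_of)
  moreover have "A \<inter> space (borel_of (product_topology S I)) = A" if "A \<in> sets ?P" for A
    using sets.sets_into_space[OF that] unfolding sp space_borel_of by blast
  ultimately show "sets ?P \<subseteq> sets (borel_of (product_topology S I))" by auto
qed

section \<open>Second countability of products and measurability of maps into them\<close>

lemma second_countable_prod_topology:
  assumes "second_countable S" "second_countable S'"
  shows "second_countable (prod_topology S S')"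
proof -
  obtain \<B> where \<B>: "countable \<B>" "\<And>V. V \<in> \<B> \<Longrightarrow> openin S V"
    and base: "\<And>U x. openin S U \<Longrightarrow> x \<in> U \<Longrightarrow> \<exists>V \<in> \<B>. x \<in> V \<and> V \<subseteq> U"
    using assms(1) by (auto simp: second_countable_def)
  obtain \<C> where \<C>: "countable \<C>" "\<And>V. V \<in> \<C> \<Longrightarrow> openin S' V"
    and base': "\<And>U x. openin S' U \<Longrightarrow> x \<in> U \<Longrightarrow> \<exists>V \<in> \<C>. x \<in> V \<and> V \<subseteq> U"
    using assms(2) by (auto simp: second_countable_def)
  show ?thesis
    unfolding second_countable_def
  proof (intro exI[of _ "(\<lambda>(B, C). B \<times> C) ` (\<B> \<times> \<C>)"] conjI ballI allI impI)
    show "countable ((\<lambda>(B, C). B \<times> C) ` (\<B> \<times> \<C>))" using \<B> \<C> by simp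
    show "openin (prod_topology S S') V" if "V \<in> (\<lambda>(B, C). B \<times> C) ` (\<B> \<times> \<C>)" for V
      using that \<B> \<C> by (auto simp: openin_prod_Times_iff)
    fix W p assume W: "openin (prod_topology S S') W \<and> p \<in> W"
    then obtain U V where UV: "openin S U" "openin S' V" "fst p \<in> U" "snd p \<in> V" "U \<times> V \<subseteq> W"
      using openin_prod_topology_alt[THEN iffD1, rule_format, of S S' W "fst p" "snd p"] by auto
    then obtain B C where "B \<in> \<B>" "fst p \<in> B" "B \<subseteq> U" "C \<in> \<C>" "snd p \<in> C" "C \<subseteq> V"
      using base base' by meson
    with UV show "\<exists>V\<in>(\<lambda>(B, C). B \<times> C) ` (\<B> \<times> \<C>). p \<in> V \<and> V \<subseteq> W"
      by (intro bexI[of _ "B \<times> C"]) (auto simp: mem_Times_iff)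
  qed
qed

text \<open>Countable index sets are allowed because the common refinement of countably many Polish
  topologies is found in a countable product. Base sets constrain only the coordinates in a finite
  set \<open>J\<close>, and there are countably many such \<open>J\<close>.\<close>

lemma second_countable_product_topology:
  assumes "countable I" "\<And>i. i \<in> I \<Longrightarrow> second_countable (S i)"
  shows "second_countable (product_topology S I)"
proof -
  have "\<exists>\<B>. countable \<B> \<and> (\<forall>V\<in>\<B>. openin (S i) V) \<and>
      (\<forall>U x. openin (S i) U \<and> x \<in> U \<longrightarrow> (\<exists>V \<in> \<B>. x \<in> V \<and> V \<subseteq> U))" if "i \<in> I" for i
    using assms(2)[OF that] by (simp add: second_countable_def)
  then obtain \<B> where \<B>: "\<And>i. i \<in> I \<Longrightarrow> countable (\<B> i)" "\<And>i V. i \<in> I \<Longrightarrow> V \<in> \<B> i \<Longrightarrow> openin (S i) V"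
    and base: "\<And>i U x. i \<in> I \<Longrightarrow> openin (S i) U \<Longrightarrow> x \<in> U \<Longrightarrow> \<exists>V \<in> \<B> i. x \<in> V \<and> V \<subseteq> U"
    by metis
  define \<J> where "\<J> = (\<Union>J\<in>{J. finite J \<and> J \<subseteq> I}. (\<lambda>F. PiE I (\<lambda>i. if i \<in> J then F i else topspace (S i))) ` PiE J \<B>)"
  show ?thesis
    unfolding second_countable_def
  proof (intro exI[of _ \<J>] conjI ballI allI impI)
    show "countable \<J>"
      unfolding \<J>_def using \<B>(1)
      by (intro countable_UN countable_Collect_finite_subset assms countable_image countable_PiE) auto
    show "openin (product_topology S I) V" if VJ: "V \<in> \<J>" for V
    proof -
      obtain J where J': "J \<in> {J. finite J \<and> J \<subseteq> I}"
        and V': "V \<in> (\<lambda>F. PiE I (\<lambda>i. if i \<in> J then F i else topspace (S i))) ` PiE J \<B>"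
        using VJ[unfolded \<J>_def] by (rule UN_E)
      then have J: "finite J" "J \<subseteq> I" by simp_all
      from V' obtain F where V: "V = PiE I (\<lambda>i. if i \<in> J then F i else topspace (S i))"
        and F: "F \<in> PiE J \<B>"
        by (rule imageE)
      have "finite {i \<in> I. (if i \<in> J then F i else topspace (S i)) \<noteq> topspace (S i)}"
        by (rule finite_subset[OF _ J(1)]) auto
      then show ?thesis
        unfolding V using J F \<B>(2) by (auto simp: openin_PiE_gen PiE_iff subset_iff)
    qed
    fix W p assume W: "openin (product_topology S I) W \<and> p \<in> W"
    then have "\<exists>U. finite {i \<in> I. U i \<noteq> topspace (S i)} \<and> (\<forall>i\<in>I. openin (S i) (U i)) \<and>
        p \<in> PiE I U \<and> PiE I U \<subseteq> W"
      unfolding openin_product_topology_alt by simp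
    then obtain U where U: "finite {i \<in> I. U i \<noteq> topspace (S i)}"
      "\<And>i. i \<in> I \<Longrightarrow> openin (S i) (U i)" "p \<in> PiE I U" "PiE I U \<subseteq> W"
      by blast
    define J where "J = {i \<in> I. U i \<noteq> topspace (S i)}"
    have "\<exists>V\<in>\<B> i. p i \<in> V \<and> V \<subseteq> U i" if "i \<in> I" for i
      using U that by (intro base) auto
    then obtain F where F: "\<And>i. i \<in> I \<Longrightarrow> F i \<in> \<B> i \<and> p i \<in> F i \<and> F i \<subseteq> U i" by metis
    let ?V = "PiE I (\<lambda>i. if i \<in> J then restrict F J i else topspace (S i))"
    have J: "J \<in> {J. finite J \<and> J \<subseteq> I}" using U(1) by (simp add: J_def)
    have FJ: "restrict F J \<in> PiE J \<B>" using F by (simp add: J_def)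
    have 1: "?V \<in> \<J>"
      unfolding \<J>_def by (rule UN_I[OF J], rule image_eqI[OF refl FJ])
    have "?V \<subseteq> PiE I U" using F by (intro PiE_mono) (auto simp: J_def)
    then have 2: "?V \<subseteq> W" using U(4) by (rule subset_trans)
    have 3: "p \<in> ?V" using U(3) F by (auto simp: PiE_iff J_def)
    show "\<exists>V\<in>\<J>. p \<in> V \<and> V \<subseteq> W" by (rule bexI[of _ ?V], rule conjI[OF 3 2], rule 1)
  qed
qed

lemma measurable_borel_of_prod:
  assumes "second_countable S" "second_countable S'"
    "(\<lambda>x. fst (f x)) \<in> M \<rightarrow>\<^sub>M borel_of S" "(\<lambda>x. snd (f x)) \<in> M \<rightarrow>\<^sub>M borel_of S'"
  shows "f \<in> M \<rightarrow>\<^sub>M borel_of (prod_topology S S')"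
  using measurable_pair[of f M "borel_of S" "borel_of S'"] assms
    measurable_cong_sets[OF refl sets_borel_of_prod[OF assms(1,2)]]
  by (auto simp: comp_def)

lemma measurable_borel_of_product:
  assumes "finite I" "\<And>i. i \<in> I \<Longrightarrow> second_countable (S i)"
    "\<And>i. i \<in> I \<Longrightarrow> (\<lambda>x. f x i) \<in> M \<rightarrow>\<^sub>M borel_of (S i)"
    "\<And>x. x \<in> space M \<Longrightarrow> f x \<in> extensional I"
  shows "f \<in> M \<rightarrow>\<^sub>M borel_of (product_topology S I)"
proof -
  have "f \<in> M \<rightarrow>\<^sub>M PiM I (\<lambda>i. borel_of (S i))"
    using assms(3,4) measurable_space[OF assms(3)]
    by (intro measurable_PiM_single') (auto simp: PiE_def Pi_iff)
  moreover have "measurable M (borel_of (product_topology S I)) = measurable M (PiM I (\<lambda>i. borel_of (S i)))"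
    by (rule measurable_cong_sets[OF refl sets_borel_of_product]) (use assms in auto)
  ultimately show ?thesis by simp
qed

section \<open>Polish topologies\<close>

lemma separable_metrizable_imp_second_countable:
  assumes "metrizable_space S" "separable_space S"
  shows "second_countable S"
proof -
  obtain M d where "Metric_space M d" and S: "S = Metric_space.mtopology M d"
    using assms(1) by (auto simp: metrizable_space_def)
  interpret Metric_space M d by fact
  obtain C where C: "countable C" "C \<subseteq> M" "mtopology closure_of C = M"
    using assms(2) by (auto simp: separable_space_def S)
  let ?B = "(\<lambda>(c, n::nat). mball c (inverse (Suc n))) ` (C \<times> UNIV)"
  show ?thesis
    unfolding second_countable_def S
  proof (intro exI[of _ ?B] conjI ballI allI impI)
    show "countable ?B" using C by auto
    show "openin mtopology V" if "V \<in> ?B" for V using that by auto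
    fix U x assume U: "openin mtopology U \<and> x \<in> U"
    then have x: "x \<in> M" using openin_subset by fastforce
    have "\<exists>r>0. mball x r \<subseteq> U" using U unfolding openin_mtopology by blast
    then obtain r where r: "r > 0" "mball x r \<subseteq> U" by blast
    \<comment> \<open>Half of \<open>r\<close>, because a ball around a point \<open>c\<close> that
      close to \<open>x\<close> reaches at most twice its radius away from \<open>x\<close>.\<close>
    obtain n where n: "inverse (Suc n) < r / 2" using reals_Archimedean[of "r/2"] r by auto
    have "x \<in> mtopology closure_of C" using C x by simp
    then have "\<forall>r>0. \<exists>c\<in>C. c \<in> mball x r" unfolding metric_closure_of by simp
    moreover have "0 < inverse (real (Suc n))" by simp
    ultimately obtain c where c: "c \<in> C" "c \<in> mball x (inverse (Suc n))" by blast
    have "mball c (inverse (Suc n)) \<subseteq> mball x r"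
    proof
      fix y assume "y \<in> mball c (inverse (Suc n))"
      then show "y \<in> mball x r"
        using c n triangle[of x c y] by (auto simp: )
    qed
    moreover have "x \<in> mball c (inverse (Suc n))"
      using c x by (auto simp: commute)
    ultimately show "\<exists>V\<in>?B. x \<in> V \<and> V \<subseteq> U"
      using c r by (intro bexI[of _ "mball c (inverse (Suc n))"]) auto
  qed
qed

text \<open>Separability need not pass to subspaces, second countability does; for metrizable spaces
  the two agree.\<close>

lemma polish_iff_second_countable:
  "polish_topology S \<longleftrightarrow> completely_metrizable_space S \<and> second_countable S"
  unfolding polish_topology_def
  using separable_metrizable_imp_second_countable second_countable_imp_separable_space
    completely_metrizable_imp_metrizable_space by blast

lemma polish_prod_topology:
  assumes "polish_topology S" "polish_topology S'"
  shows "polish_topology (prod_topology S S')"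
  using assms unfolding polish_iff_second_countable
  by (auto simp: completely_metrizable_space_prod_topology second_countable_prod_topology)

lemma polish_product_topology:
  assumes "countable I" "\<And>i. i \<in> I \<Longrightarrow> polish_topology (S i)"
  shows "polish_topology (product_topology S I)"
  using assms unfolding polish_iff_second_countable
  by (auto simp: completely_metrizable_space_product_topology second_countable_product_topology
        intro: countable_subset[OF _ assms(1)])

lemma polish_discrete_topology: "countable A \<Longrightarrow> polish_topology (discrete_topology A)"
  by (simp add: polish_topology_def completely_metrizable_space_discrete_topology separable_space_discrete_topology)

lemma polish_gdelta_in:
  assumes "polish_topology S" "gdelta_in S A"
  shows "polish_topology (subtopology S A)"
  using assms unfolding polish_iff_second_countable
  by (simp add: completely_metrizable_space_gdelta_in second_countable_subtopology)

lemma polish_homeomorphic: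
  assumes "S homeomorphic_space S'" shows "polish_topology S \<longleftrightarrow> polish_topology S'"
  using assms unfolding polish_topology_def
  by (simp add: homeomorphic_completely_metrizable_space homeomorphic_separable_space)

text \<open>An injective \<open>\<phi>\<close> is a homeomorphism from the pulled back topology onto
  its image, and a G-delta subset of a Polish space is Polish. Both refinements of a topology below
  are pullbacks of this kind.\<close>

lemma polish_pullback_topology:
  assumes "polish_topology W" "inj_on \<phi> A" "gdelta_in W (\<phi> ` A)"
  shows "polish_topology (pullback_topology A \<phi> W)"
proof -
  have sub: "\<phi> ` A \<subseteq> topspace W" by (rule gdelta_in_subset[OF assms(3)])
  have "continuous_map (pullback_topology A \<phi> W) (subtopology W (\<phi> ` A)) \<phi>"
    unfolding continuous_map_def
  proof (intro conjI allI impI)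
    show "\<phi> \<in> topspace (pullback_topology A \<phi> W) \<rightarrow> topspace (subtopology W (\<phi> ` A))"
      by (auto simp: topspace_pullback_topology)
    fix V assume "openin (subtopology W (\<phi> ` A)) V"
    then obtain U where U: "openin W U" "V = U \<inter> \<phi> ` A" by (auto simp: openin_subtopology)
    have "{x \<in> topspace (pullback_topology A \<phi> W). \<phi> x \<in> V} = \<phi> -` U \<inter> A"
      using openin_subset[OF U(1)] by (auto simp: U topspace_pullback_topology)
    then show "openin (pullback_topology A \<phi> W) {x \<in> topspace (pullback_topology A \<phi> W). \<phi> x \<in> V}"
      using U(1) by (auto simp: openin_pullback_topology)
  qed
  moreover have "continuous_map (subtopology W (\<phi> ` A)) (pullback_topology A \<phi> W) (the_inv_into A \<phi>)"
    unfolding continuous_map_def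
  proof (intro conjI allI impI)
    show "the_inv_into A \<phi> \<in> topspace (subtopology W (\<phi> ` A)) \<rightarrow> topspace (pullback_topology A \<phi> W)"
      using assms(2) sub by (auto simp: topspace_pullback_topology the_inv_into_f_f)
    fix V assume "openin (pullback_topology A \<phi> W) V"
    then obtain U where U: "openin W U" "V = \<phi> -` U \<inter> A" by (auto simp: openin_pullback_topology)
    have "{x \<in> topspace (subtopology W (\<phi> ` A)). the_inv_into A \<phi> x \<in> V} = U \<inter> \<phi> ` A"
      using sub assms(2) by (auto simp: U the_inv_into_f_f)
    then show "openin (subtopology W (\<phi> ` A)) {x \<in> topspace (subtopology W (\<phi> ` A)). the_inv_into A \<phi> x \<in> V}"
      using U(1) by (auto simp: openin_subtopology)
  qed
  ultimately have "pullback_topology A \<phi> W homeomorphic_space subtopology W (\<phi> ` A)"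
    using assms(2) sub unfolding homeomorphic_space_def homeomorphic_maps_def
    by (intro exI[of _ \<phi>] exI[of _ "the_inv_into A \<phi>"])
       (auto simp: topspace_pullback_topology the_inv_into_f_f)
  then show ?thesis
    using polish_gdelta_in[OF assms(1,3)] polish_homeomorphic by blast
qed

section \<open>Refining Polish topologies\<close>

definition finer_polish :: "'a topology \<Rightarrow> 'a topology \<Rightarrow> bool" where
  "finer_polish S Z \<longleftrightarrow> polish_topology Z \<and> topspace Z = topspace S \<and> (\<forall>U. openin S U \<longrightarrow> openin Z U)"

lemma finer_polish_trans: "finer_polish S Z \<Longrightarrow> finer_polish Z Z' \<Longrightarrow> finer_polish S Z'"
  by (auto simp: finer_polish_def)

text \<open>The topology of \<open>S\<close> is pulled back along \<open>x \<mapsto> (x, x \<in> A)\<close>, whose graph is a \<open>G\<^sub>\<delta>\<close> set.\<close>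

lemma finer_polish_clopen:
  assumes S: "polish_topology S" and A: "openin S A"
  obtains Z where "finer_polish S Z" "openin Z A" "openin Z (topspace S - A)"
proof -
  define \<phi> where "\<phi> x = (x, x \<in> A)" for x
  define W where "W = prod_topology S (discrete_topology (UNIV :: bool set))"
  define Z where "Z = pullback_topology (topspace S) \<phi> W"
  have sub: "A \<subseteq> topspace S" using A openin_subset by blast
  have W: "polish_topology W" unfolding W_def using S by (intro polish_prod_topology polish_discrete_topology) auto
  have "\<phi> ` topspace S = A \<times> {True} \<union> (topspace S - A) \<times> {False}"
    using sub by (auto simp: \<phi>_def)
  moreover have "openin W (A \<times> {True})" "closedin W ((topspace S - A) \<times> {False})"
    using A by (auto simp: W_def openin_prod_Times_iff closedin_prod_Times_iff)
  \<comment> \<open>Metrizability makes the closed half of the graph a G-delta set; the open half is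
    one in any space.\<close>
  moreover have "metrizable_space W"
    using W by (simp add: polish_topology_def completely_metrizable_imp_metrizable_space)
  ultimately have "gdelta_in W (\<phi> ` topspace S)"
    by (simp add: gdelta_in_Un open_imp_gdelta_in closed_imp_gdelta_in)
  then have "polish_topology Z"
    unfolding Z_def using W by (intro polish_pullback_topology) (auto simp: inj_on_def \<phi>_def)
  moreover have op: "openin Z U" if "openin W V" "U = \<phi> -` V \<inter> topspace S" for U V
    using that by (auto simp: Z_def openin_pullback_topology)
  have "openin Z U" if "openin S U" for U
    by (rule op[of "U \<times> UNIV"]) (use that openin_subset[OF that] in \<open>auto simp: \<phi>_def W_def openin_prod_Times_iff\<close>)
  moreover have "openin Z A"
    by (rule op[of "topspace S \<times> {True}"]) (use sub in \<open>auto simp: \<phi>_def W_def openin_prod_Times_iff\<close>)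
  moreover have "openin Z (topspace S - A)"
    by (rule op[of "topspace S \<times> {False}"]) (use sub in \<open>auto simp: \<phi>_def W_def openin_prod_Times_iff\<close>)
  moreover have "topspace Z = topspace S"
    by (auto simp: Z_def topspace_pullback_topology \<phi>_def W_def)
  ultimately show thesis by (intro that[of Z]) (auto simp: finer_polish_def)
qed

text \<open>The join is the topology of the diagonal in the product of the \<open>Z n\<close>.\<close>

lemma finer_polish_join:
  fixes Z :: "nat \<Rightarrow> 'a topology"
  assumes S: "Hausdorff_space S" and Z: "\<And>n. finer_polish S (Z n)"
  obtains J where "finer_polish S J" "\<And>n U. openin (Z n) U \<Longrightarrow> openin J U"
proof -
  define \<phi> :: "'a \<Rightarrow> nat \<Rightarrow> 'a" where "\<phi> x = (\<lambda>n. x)" for x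
  define W where "W = product_topology Z UNIV"
  define J where "J = pullback_topology (topspace S) \<phi> W"
  have top: "topspace (Z n) = topspace S" for n using Z by (simp add: finer_polish_def)
  have W: "polish_topology W" unfolding W_def using Z by (intro polish_product_topology) (auto simp: finer_polish_def)
  \<comment> \<open>The coordinates carry different topologies, so their equality is tested in the
    coarser Hausdorff space \<open>S\<close>; this makes the diagonal closed in
    \<open>W\<close>.\<close>
  have cm: "continuous_map W S (\<lambda>f. f n)" for n
  proof -
    have "{x \<in> topspace S. x \<in> U} = U" if "openin S U" for U
      using openin_subset[OF that] by auto
    then have "continuous_map (Z n) S id"
      using Z[of n] by (simp add: continuous_map_def finer_polish_def)
    then show ?thesis
      using continuous_map_compose[of W "Z n" "\<lambda>f. f n" S id] continuous_map_product_projection[of n UNIV Z]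
      by (simp add: W_def comp_def)
  qed
  have im: "\<phi> ` topspace S = {f \<in> topspace W. \<forall>n. f n = f 0}"
  proof (intro subset_antisym subsetI)
    fix f assume "f \<in> {f \<in> topspace W. \<forall>n. f n = f 0}"
    then have "f = \<phi> (f 0)" "f 0 \<in> topspace S" by (auto simp: \<phi>_def W_def top)
    then show "f \<in> \<phi> ` topspace S" by blast
  qed (auto simp: \<phi>_def W_def top)
  have "closedin W (\<Inter>n. {f \<in> topspace W. f n = f 0})"
    using closedin_continuous_maps_eq[OF S cm cm] by (intro closedin_INT) auto
  moreover have "(\<Inter>n. {f \<in> topspace W. f n = f 0}) = \<phi> ` topspace S" unfolding im by auto
  moreover have "metrizable_space W"
    using W by (simp add: polish_topology_def completely_metrizable_imp_metrizable_space)
  ultimately have "gdelta_in W (\<phi> ` topspace S)"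
    by (simp add: closed_imp_gdelta_in)
  then have "polish_topology J"
    unfolding J_def using W by (intro polish_pullback_topology) (auto simp: inj_on_def \<phi>_def dest: fun_cong)
  moreover have *: "openin J U" if U: "openin (Z n) U" for n U
  proof -
    have "openin W {f \<in> topspace W. f n \<in> U}"
      using continuous_map_product_projection[of n UNIV Z] U unfolding W_def
      by (simp add: continuous_map_def)
    moreover have "U = \<phi> -` {f \<in> topspace W. f n \<in> U} \<inter> topspace S"
      using openin_subset[OF U] by (auto simp: \<phi>_def W_def top)
    ultimately show ?thesis unfolding J_def openin_pullback_topology by blast
  qed
  moreover have "openin J U" if "openin S U" for U
    using *[of 0 U] Z[of 0] that by (simp add: finer_polish_def)
  moreover have "topspace J = topspace S"
    by (auto simp: J_def topspace_pullback_topology \<phi>_def W_def top)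
  ultimately show thesis by (intro that[of J]) (auto simp: finer_polish_def)
qed

lemma polish_imp_Hausdorff: "polish_topology S \<Longrightarrow> Hausdorff_space S"
  by (simp add: polish_topology_def completely_metrizable_imp_metrizable_space metrizable_imp_Hausdorff_space)

text \<open>Induction on the generation of Borel sets. Asking that both \<open>A\<close> and its
  complement be open makes the complement step trivial; for a union the join opens the union only,
  and one more refinement opens its complement.\<close>

lemma finer_polish_borel:
  assumes S: "polish_topology S" and A: "A \<in> sets (borel_of S)"
  obtains Z where "finer_polish S Z" "openin Z A" "openin Z (topspace S - A)"
proof -
  have "\<exists>Z. finer_polish S Z \<and> openin Z A \<and> openin Z (topspace S - A)"
    using A unfolding sets_borel_of
  proof (induction A rule: sigma_sets.induct)
    case (Basic a)
    then show ?case using finer_polish_clopen[OF S] by (metis mem_Collect_eq)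
  next
    case Empty
    have "finer_polish S S" using S by (simp add: finer_polish_def)
    then show ?case by auto
  next
    case (Compl a)
    then obtain Z where Z: "finer_polish S Z" "openin Z a" "openin Z (topspace S - a)" by blast
    moreover have "a \<subseteq> topspace S" using openin_subset[OF Z(2)] Z(1) by (simp add: finer_polish_def)
    ultimately show ?case by (metis double_diff order_refl)
  next
    case (Union a)
    then obtain Z where Z: "\<And>i. finer_polish S (Z i)" "\<And>i. openin (Z i) (a i)" by metis
    obtain J where J: "finer_polish S J" "\<And>n U. openin (Z n) U \<Longrightarrow> openin J U"
      using finer_polish_join[where Z = Z, OF polish_imp_Hausdorff[OF S] Z(1)] by blast
    have "openin J (\<Union>i. a i)" using J Z by blast
    moreover have "polish_topology J" using J by (simp add: finer_polish_def)
    ultimately obtain K where "finer_polish J K" "openin K (\<Union>i. a i)" "openin K (topspace J - (\<Union>i. a i))"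
      using finer_polish_clopen by blast
    then show ?case using J(1) finer_polish_trans[OF J(1)] by (auto simp: finer_polish_def)
  qed
  then show thesis using that by blast
qed

lemma finer_polish_countable_borel:
  assumes S: "polish_topology S" and \<A>: "countable \<A>" "\<A> \<subseteq> sets (borel_of S)"
  obtains Z where "finer_polish S Z" "\<And>A. A \<in> \<A> \<Longrightarrow> openin Z A"
proof (cases "\<A> = {}")
  case True
  then show thesis using S by (intro that[of S]) (auto simp: finer_polish_def)
next
  case False
  have "\<exists>Z. finer_polish S Z \<and> openin Z (from_nat_into \<A> n)" for n
    using finer_polish_borel[OF S, of "from_nat_into \<A> n"] from_nat_into[OF False, of n] \<A>(2) by blast
  then obtain Z where Z: "\<And>n. finer_polish S (Z n)" "\<And>n. openin (Z n) (from_nat_into \<A> n)" by metis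
  obtain J where J: "finer_polish S J" "\<And>n U. openin (Z n) U \<Longrightarrow> openin J U"
    using finer_polish_join[where Z = Z, OF polish_imp_Hausdorff[OF S] Z(1)] by blast
  show thesis
  proof (rule that[OF J(1)])
    fix A assume "A \<in> \<A>"
    then obtain n where "A = from_nat_into \<A> n" using \<A>(1) by (metis from_nat_into_surj)
    then show "openin J A" using J(2) Z(2) by blast
  qed
qed

section \<open>The weak topology\<close>

text \<open>The base consists of the intersections of nonempty finite subfamilies. That its members
  lie in the sigma-algebra of the subbasis serves to identify the Borel sets of the weak
  topology.\<close>

lemma countable_base_of_generated:
  assumes "countable \<S>"
  obtains \<B> where "countable \<B>" "\<And>B. B \<in> \<B> \<Longrightarrow> openin (topology_generated_by \<S>) B"
    "\<And>B. B \<in> \<B> \<Longrightarrow> B \<in> sigma_sets (\<Union>\<S>) \<S>"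
    "\<And>U. openin (topology_generated_by \<S>) U \<Longrightarrow> U = \<Union>{B \<in> \<B>. B \<subseteq> U}"
proof -
  define \<B> where "\<B> = (\<lambda>F. \<Inter>F) ` {F. finite F \<and> F \<noteq> {} \<and> F \<subseteq> \<S>}"
  have 1: "countable \<B>"
    unfolding \<B>_def
    by (intro countable_image countable_subset[OF _ countable_Collect_finite_subset[OF assms]]) auto
  have 2: "openin (topology_generated_by \<S>) B" if B: "B \<in> \<B>" for B
  proof -
    obtain F where F: "finite F" "F \<noteq> {}" "F \<subseteq> \<S>" "B = \<Inter>F" using B by (auto simp: \<B>_def)
    show ?thesis unfolding F(4) using F by (intro openin_Inter topology_generated_by_Basis) auto
  qed
  have 3: "B \<in> sigma_sets (\<Union>\<S>) \<S>" if B: "B \<in> \<B>" for B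
  proof -
    obtain F where F: "finite F" "F \<noteq> {}" "F \<subseteq> \<S>" "B = \<Inter>F" using B by (auto simp: \<B>_def)
    have "\<S> \<subseteq> Pow (\<Union>\<S>)" by auto
    then have eq: "sets (sigma (\<Union>\<S>) \<S>) = sigma_sets (\<Union>\<S>) \<S>" by (rule sets_measure_of)
    have "(\<Inter>C\<in>F. C) \<in> sets (sigma (\<Union>\<S>) \<S>)"
      using F by (intro sets.finite_INT) (auto simp: eq intro: sigma_sets.Basic)
    then show ?thesis by (simp add: eq F(4))
  qed
  have 4: "U = \<Union>{B \<in> \<B>. B \<subseteq> U}" if U: "openin (topology_generated_by \<S>) U" for U
  proof -
    have "(arbitrary union_of finite' intersection_of (\<lambda>x. x \<in> \<S>)) U"
      using openin_topology_generated_by[OF U] by (simp only: generate_topology_on_eq)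
    then obtain \<U> where \<U>: "\<U> \<subseteq> Collect (finite' intersection_of (\<lambda>x. x \<in> \<S>))" "\<Union>\<U> = U"
      by (auto simp: union_of_def)
    have "\<U> \<subseteq> \<B>"
    proof
      fix V assume "V \<in> \<U>"
      then obtain F where "finite F" "F \<noteq> {}" "F \<subseteq> \<S>" "V = \<Inter>F"
        using \<U>(1) by (auto simp: intersection_of_def)
      then show "V \<in> \<B>" by (auto simp: \<B>_def)
    qed
    then show ?thesis using \<U>(2) by blast
  qed
  show thesis by (rule that[OF 1 2 3 4])
qed

lemma second_countable_generated:
  assumes "countable \<S>" shows "second_countable (topology_generated_by \<S>)"
proof -
  obtain \<B> where "countable \<B>" "\<And>B. B \<in> \<B> \<Longrightarrow> openin (topology_generated_by \<S>) B"
    "\<And>U. openin (topology_generated_by \<S>) U \<Longrightarrow> U = \<Union>{B \<in> \<B>. B \<subseteq> U}"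
    using countable_base_of_generated[OF assms] by metis
  then show ?thesis
    unfolding second_countable_def
    by (intro exI[of _ \<B>] conjI ballI allI impI) (simp_all, metis (no_types, lifting) UnionE mem_Collect_eq)
qed

text \<open>Countability is essential: an open set is then a countable union of finite intersections
  of subbasic sets.\<close>

lemma sets_borel_of_generated:
  assumes "countable \<S>"
  shows "sets (borel_of (topology_generated_by \<S>)) = sigma_sets (\<Union>\<S>) \<S>"
  unfolding sets_borel_of topology_generated_by_topspace
proof (rule sigma_sets_eqI)
  fix U assume "U \<in> {U. openin (topology_generated_by \<S>) U}"
  then have U: "openin (topology_generated_by \<S>) U" by simp
  obtain \<B> where \<B>: "countable \<B>" "\<And>B. B \<in> \<B> \<Longrightarrow> B \<in> sigma_sets (\<Union>\<S>) \<S>"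
    "\<And>U. openin (topology_generated_by \<S>) U \<Longrightarrow> U = \<Union>{B \<in> \<B>. B \<subseteq> U}"
    using countable_base_of_generated[OF assms] by metis
  have "\<Union>{B \<in> \<B>. B \<subseteq> U} \<in> sigma_sets (\<Union>\<S>) \<S>"
    by (intro sigma_sets_UNION) (use \<B> in \<open>auto intro: countable_subset[OF _ \<B>(1)]\<close>)
  then show "U \<in> sigma_sets (\<Union>\<S>) \<S>" using \<B>(3)[OF U] by simp
qed (auto intro: sigma_sets.Basic topology_generated_by_Basis)

text \<open>A countable base of the target has only countably many preimages, all of them Borel, and
  these can be opened at once. It is applied to the kernels, with the weak topology as target, and
  to the value function.\<close>

lemma finer_polish_continuous_map:
  assumes S: "polish_topology S" and W: "second_countable W" and f: "f \<in> borel_of S \<rightarrow>\<^sub>M borel_of W"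
  obtains Z where "finer_polish S Z" "continuous_map Z W f"
proof -
  obtain \<B> where \<B>: "countable \<B>" "\<And>V. V \<in> \<B> \<Longrightarrow> openin W V"
    and base: "\<And>U x. openin W U \<Longrightarrow> x \<in> U \<Longrightarrow> \<exists>V \<in> \<B>. x \<in> V \<and> V \<subseteq> U"
    using W by (auto simp: second_countable_def)
  let ?A = "(\<lambda>B. f -` B \<inter> topspace S) ` \<B>"
  have "?A \<subseteq> sets (borel_of S)"
    using measurable_sets[OF f openin_borel_of[OF \<B>(2)]] by auto
  then obtain Z where Z: "finer_polish S Z" "\<And>A. A \<in> ?A \<Longrightarrow> openin Z A"
    using finer_polish_countable_borel[OF S, of ?A] \<B>(1) by auto
  have top: "topspace Z = topspace S" using Z by (simp add: finer_polish_def)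
  have "continuous_map Z W f"
    unfolding continuous_map_def
  proof (intro conjI allI impI)
    show "f \<in> topspace Z \<rightarrow> topspace W" using measurable_space[OF f] by (simp add: top)
    fix U assume U: "openin W U"
    then have "{x \<in> topspace Z. f x \<in> U} = (\<Union>B\<in>{B \<in> \<B>. B \<subseteq> U}. f -` B \<inter> topspace S)"
    proof (intro subset_antisym subsetI)
      fix x assume "x \<in> {x \<in> topspace Z. f x \<in> U}"
      then have x: "x \<in> topspace S" "f x \<in> U" by (auto simp: top)
      from base[OF U x(2)] obtain V where "V \<in> \<B>" "f x \<in> V" "V \<subseteq> U" by blast
      then show "x \<in> (\<Union>B\<in>{B \<in> \<B>. B \<subseteq> U}. f -` B \<inter> topspace S)" using x by blast
    qed (auto simp: top)
    also have "openin Z \<dots>" using Z(2) by blast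
    finally show "openin Z {x \<in> topspace Z. f x \<in> U}" .
  qed
  with Z(1) show thesis by (rule that)
qed

lemma topspace_weak_topology: "topspace (weak_topology S) = prob_measures S"
proof -
  let ?G = "{{M \<in> prob_measures S. (\<integral>z. f z \<partial>M) \<in> U} | f U.
        continuous_map S euclideanreal f \<and> bounded (f ` topspace S) \<and> open (U :: real set)}"
  have "{M \<in> prob_measures S. (\<integral>z. (0::real) \<partial>M) \<in> UNIV} \<in> ?G"
    by (intro CollectI exI[of _ "\<lambda>z. 0"] exI[of _ UNIV]) (auto simp: bounded_def)
  then have "prob_measures S \<in> ?G" by simp
  then have "prob_measures S \<subseteq> \<Union>?G" by blast
  then show ?thesis unfolding weak_topology_def topology_generated_by_topspace by blast
qed

lemma prob_measures_eq_space_prob_algebra: "prob_measures S = space (prob_algebra (borel_of S))"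
  by (simp add: prob_measures_def space_prob_algebra)

lemma prob_measuresD:
  assumes "M \<in> prob_measures S"
  shows "prob_space M" "sets M = sets (borel_of S)" "space M = topspace S"
  using assms sets_eq_imp_space_eq[of M "borel_of S"] by (auto simp: prob_measures_def)

lemma openin_weak_topology:
  assumes "continuous_map S euclideanreal f" "bounded (f ` topspace S)" "open U"
  shows "openin (weak_topology S) {M \<in> prob_measures S. (\<integral>z. f z \<partial>M) \<in> U}"
  unfolding weak_topology_def using assms by (intro topology_generated_by_Basis) blast

text \<open>The sets \<open>{M. a < \<integral>max_step l dM}\<close> with rational data and basic open sets form a countable subbasis
  of the weak topology, since every non-negative continuous function is the limit of an increasing
  sequence of such step functions.\<close>

definition max_step :: "(real \<times> 'a set) list \<Rightarrow> 'a \<Rightarrow> real" where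
  "max_step l x = foldr (\<lambda>(q, U). max (q * indicator U x)) l 0"

lemma max_step_Nil [simp]: "max_step [] x = 0"
  and max_step_Cons [simp]: "max_step ((q, U) # l) x = max (q * indicator U x) (max_step l x)"
  by (auto simp: max_step_def)

lemma max_step_nonneg: "0 \<le> max_step l x"
  by (induction l) (auto simp: max_def)

lemma max_step_ge: "(q, U) \<in> set l \<Longrightarrow> x \<in> U \<Longrightarrow> q \<le> max_step l x"
  by (induction l) (auto simp: le_max_iff_disj)

text \<open>The reason for a maximum instead of a sum: bounds valid on each single step pass to the
  whole list, so steps below \<open>f\<close> can be collected freely. The bound
  \<open>0 \<le> c\<close> covers the points outside all steps.\<close>

lemma max_step_le:
  assumes "0 \<le> c" "\<And>q U. (q, U) \<in> set l \<Longrightarrow> x \<in> U \<Longrightarrow> q \<le> c"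
  shows "max_step l x \<le> c"
  using assms(2)
proof (induction l)
  case (Cons p l)
  obtain q U where p: "p = (q, U)" by fastforce
  have "max_step l x \<le> c" using Cons by (meson list.set_intros(2))
  moreover have "q * indicator U x \<le> c"
    using Cons.prems[of q U] assms(1) by (auto simp: p indicator_def)
  ultimately show ?case by (simp add: p)
qed (simp add: assms(1))

lemma max_step_bounded: "\<exists>C. \<forall>x. \<bar>max_step l x\<bar> \<le> C"
proof (intro exI allI)
  fix x
  have "max_step l x \<le> sum_list (map (\<lambda>(q, U). \<bar>q\<bar>) l)"
  proof (rule max_step_le)
    show "0 \<le> sum_list (map (\<lambda>(q, U). \<bar>q\<bar>) l)" by (intro sum_list_nonneg) auto
    fix q U assume "(q, U) \<in> set l"
    then have "\<bar>q\<bar> \<le> sum_list (map (\<lambda>(q, U). \<bar>q\<bar>) l)"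
      by (intro member_le_sum_list) (force intro: image_eqI)+
    then show "q \<le> sum_list (map (\<lambda>(q, U). \<bar>q\<bar>) l)" by simp
  qed
  then show "\<bar>max_step l x\<bar> \<le> sum_list (map (\<lambda>(q, U). \<bar>q\<bar>) l)"
    using max_step_nonneg[of l x] by simp
qed

lemma max_step_measurable:
  assumes "\<And>q U. (q, U) \<in> set l \<Longrightarrow> U \<in> sets M"
  shows "max_step l \<in> borel_measurable M"
  using assms
proof (induction l)
  case (Cons p l)
  obtain q U where p: "p = (q, U)" by fastforce
  have [measurable]: "max_step l \<in> borel_measurable M" "U \<in> sets M"
    using Cons by (auto simp: p)
  show ?case unfolding p max_step_Cons by measurable
qed (simp add: max_step_def[abs_def])

text \<open>In a metrizable space \<open>U\<close> is an increasing union of closed sets; Urysohn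
  functions that are one on these sets and zero outside \<open>U\<close> converge to the indicator
  from below.\<close>

lemma continuous_approx_indicator:
  assumes S: "metrizable_space S" and U: "openin S U"
  obtains f :: "nat \<Rightarrow> 'a \<Rightarrow> real" where "\<And>n. continuous_map S euclideanreal (f n)"
    "\<And>n x. x \<in> topspace S \<Longrightarrow> 0 \<le> f n x \<and> f n x \<le> indicator U x"
    "\<And>x. x \<in> topspace S \<Longrightarrow> (\<lambda>n. f n x) \<longlonglongrightarrow> indicator U x"
proof -
  obtain C where C: "\<And>n. closedin S (C n)" "\<And>n. C n \<subseteq> C (Suc n)" "\<Union>(range C) = U"
    using open_imp_fsigma_in[OF S U] unfolding fsigma_in_ascending by metis
  have "\<exists>f. continuous_map S (top_of_set {0..1::real}) f \<and> f ` (topspace S - U) \<subseteq> {0} \<and> f ` C n \<subseteq> {1}" for n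
    using Urysohn_lemma[OF metrizable_imp_normal_space[OF S], of "topspace S - U" "C n" 0 1] C U
    by (metis DiffD2 UnionI closedin_diff closedin_topspace disjnt_iff rangeI zero_le_one)
  then obtain f where f: "\<And>n. continuous_map S (top_of_set {0..1::real}) (f n)"
    "\<And>n. f n ` (topspace S - U) \<subseteq> {0}" "\<And>n. f n ` C n \<subseteq> {1}" by metis
  show thesis
  proof
    show "continuous_map S euclideanreal (f n)" for n
      using f(1) continuous_map_into_fulltopology by blast
    show "0 \<le> f n x \<and> f n x \<le> indicator U x" if x: "x \<in> topspace S" for n x
      using f(1)[of n] f(2)[of n] x by (auto simp: continuous_map_def Pi_iff indicator_def)
    show "(\<lambda>n. f n x) \<longlonglongrightarrow> indicator U x" if x: "x \<in> topspace S" for x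
    proof (cases "x \<in> U")
      case True
      then obtain m where "x \<in> C m" using C(3) by auto
      then have "x \<in> C n" if "n \<ge> m" for n
        using lift_Suc_mono_le[of C m n] C(2) that by auto
      then have "\<forall>n\<ge>m. f n x = 1" using f(3) by blast
      then have "eventually (\<lambda>n. f n x = indicator U x) sequentially"
        using True by (auto simp: eventually_sequentially)
      then show ?thesis by (rule tendsto_eventually)
    next
      case False
      then have "f n x = indicator U x" for n using f(2)[of n] x by auto
      then show ?thesis by simp
    qed
  qed
qed

text \<open>A maximum of steps over open sets with non-negative heights is a limit from below of
  bounded continuous functions. Hence its integral exceeds \<open>a\<close> iff the integral of one
  of them does, and the set is a union of subbasic weakly open sets.\<close>

lemma openin_weak_max_step:
  assumes S: "metrizable_space S" and l: "\<And>q U. (q, U) \<in> set l \<Longrightarrow> openin S U \<and> 0 \<le> q"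
  shows "openin (weak_topology S) {M \<in> prob_measures S. a < (\<integral>z. max_step l z \<partial>M)}"
proof -
  have "\<exists>f :: nat \<Rightarrow> _ \<Rightarrow> real. (\<forall>n. continuous_map S euclideanreal (f n)) \<and>
    (\<forall>n. \<forall>x\<in>topspace S. 0 \<le> f n x \<and> f n x \<le> max_step l x) \<and>
    (\<forall>x\<in>topspace S. (\<lambda>n. f n x) \<longlonglongrightarrow> max_step l x)"
    using l
  proof (induction l)
    case Nil
    show ?case by (intro exI[of _ "\<lambda>n x. 0"]) auto
  next
    case (Cons p l)
    obtain q U where p: "p = (q, U)" by fastforce
    then have U: "openin S U" and q: "0 \<le> q" using Cons.prems by auto
    obtain f :: "nat \<Rightarrow> _ \<Rightarrow> real" where f: "\<And>n. continuous_map S euclideanreal (f n)"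
      "\<And>n x. x \<in> topspace S \<Longrightarrow> 0 \<le> f n x \<and> f n x \<le> max_step l x"
      "\<And>x. x \<in> topspace S \<Longrightarrow> (\<lambda>n. f n x) \<longlonglongrightarrow> max_step l x"
      using Cons.IH[OF Cons.prems] by (metis list.set_intros(2))
    obtain g :: "nat \<Rightarrow> _ \<Rightarrow> real" where g: "\<And>n. continuous_map S euclideanreal (g n)"
      "\<And>n x. x \<in> topspace S \<Longrightarrow> 0 \<le> g n x \<and> g n x \<le> indicator U x"
      "\<And>x. x \<in> topspace S \<Longrightarrow> (\<lambda>n. g n x) \<longlonglongrightarrow> indicator U x"
      by (rule continuous_approx_indicator[OF S U]) blast
    show ?case
      unfolding p max_step_Cons
    proof (intro exI[of _ "\<lambda>n x. max (q * g n x) (f n x)"] conjI allI ballI)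
      show "continuous_map S euclideanreal (\<lambda>x. max (q * g n x) (f n x))" for n
        using f(1) g(1) by (intro continuous_map_real_max continuous_map_real_mult continuous_map_const[THEN iffD2]) auto
      fix x assume x: "x \<in> topspace S"
      show "0 \<le> max (q * g n x) (f n x)" for n using f(2)[OF x, of n] by auto
      show "max (q * g n x) (f n x) \<le> max (q * indicator U x) (max_step l x)" for n
        using f(2)[OF x, of n] g(2)[OF x, of n] q by (intro max.mono mult_left_mono) auto
      show "(\<lambda>n. max (q * g n x) (f n x)) \<longlonglongrightarrow> max (q * indicator U x) (max_step l x)"
        by (intro tendsto_max tendsto_mult tendsto_const f(3) g(3) x)
    qed
  qed
  then obtain f :: "nat \<Rightarrow> _ \<Rightarrow> real" where f: "\<And>n. continuous_map S euclideanreal (f n)"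
      "\<And>n x. x \<in> topspace S \<Longrightarrow> 0 \<le> f n x \<and> f n x \<le> max_step l x"
      "\<And>x. x \<in> topspace S \<Longrightarrow> (\<lambda>n. f n x) \<longlonglongrightarrow> max_step l x" by metis
  obtain C where C: "\<And>x. \<bar>max_step l x\<bar> \<le> C" using max_step_bounded by blast
  have mf: "f n \<in> borel_measurable (borel_of S)" for n
    by (intro continuous_map_borel_measurable f)
  have ml: "max_step l \<in> borel_measurable (borel_of S)"
    using l by (intro max_step_measurable openin_borel_of) auto
  have "{M \<in> prob_measures S. a < (\<integral>z. max_step l z \<partial>M)} = (\<Union>n. {M \<in> prob_measures S. (\<integral>z. f n z \<partial>M) \<in> {a<..}})"
  proof (intro subset_antisym subsetI)
    fix M assume "M \<in> {M \<in> prob_measures S. a < (\<integral>z. max_step l z \<partial>M)}"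
    then have M: "M \<in> prob_measures S" and a: "a < (\<integral>z. max_step l z \<partial>M)" by auto
    interpret prob_space M by (rule prob_measuresD[OF M])
    note [measurable_cong] = prob_measuresD(2)[OF M]
    note [measurable] = mf ml
    have "(\<lambda>n. \<integral>z. f n z \<partial>M) \<longlonglongrightarrow> (\<integral>z. max_step l z \<partial>M)"
    proof (rule integral_dominated_convergence[where w = "\<lambda>_. C"])
      show "AE x in M. (\<lambda>n. f n x) \<longlonglongrightarrow> max_step l x"
        using f(3) prob_measuresD(3)[OF M] by (intro AE_I2) simp
      show "AE x in M. norm (f n x) \<le> C" for n
        using f(2)[of _ n] C prob_measuresD(3)[OF M] by (intro AE_I2) (smt (verit) real_norm_def)
    qed auto
    then have "eventually (\<lambda>n. a < (\<integral>z. f n z \<partial>M)) sequentially" using a by (rule order_tendstoD)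
    then obtain n where "a < (\<integral>z. f n z \<partial>M)" by (auto simp: eventually_sequentially)
    then show "M \<in> (\<Union>n. {M \<in> prob_measures S. (\<integral>z. f n z \<partial>M) \<in> {a<..}})" using M by auto
  next
    fix M assume "M \<in> (\<Union>n. {M \<in> prob_measures S. (\<integral>z. f n z \<partial>M) \<in> {a<..}})"
    then obtain n where M: "M \<in> prob_measures S" and a: "a < (\<integral>z. f n z \<partial>M)" by auto
    interpret prob_space M by (rule prob_measuresD[OF M])
    note [measurable_cong] = prob_measuresD(2)[OF M]
    note [measurable] = mf ml
    have "(\<integral>z. f n z \<partial>M) \<le> (\<integral>z. max_step l z \<partial>M)"
    proof (rule integral_mono)
      show "integrable M (f n)"
        using f(2)[of _ n] C prob_measuresD(3)[OF M]
        by (intro integrable_const_bound[of _ C] AE_I2) (auto, smt (verit))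
      show "integrable M (max_step l)"
        using C by (intro integrable_const_bound[of _ C] AE_I2) auto
    qed (use f(2)[of _ n] prob_measuresD(3)[OF M] in auto)
    then show "M \<in> {M \<in> prob_measures S. a < (\<integral>z. max_step l z \<partial>M)}" using M a by auto
  qed
  also have "openin (weak_topology S) \<dots>"
  proof (intro openin_Union, safe)
    fix n
    have "f n ` topspace S \<subseteq> cball 0 C" using f(2)[of _ n] C by (auto simp: dist_real_def) (smt (verit))
    then have "bounded (f n ` topspace S)" using bounded_cball bounded_subset by blast
    then show "openin (weak_topology S) {M \<in> prob_measures S. (\<integral>z. f n z \<partial>M) \<in> {a<..}}"
      by (intro openin_weak_topology f(1)) auto
  qed
  finally show ?thesis .
qed

text \<open>By continuity, \<open>f\<close> is the supremum of the rational steps over basic open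
  sets that stay below it. The auxiliary rational \<open>b\<close> lets every real threshold
  \<open>a\<close> be expressed through countably many sets.\<close>

lemma integral_gt_iff_max_step:
  assumes \<B>: "countable \<B>" "\<And>V. V \<in> \<B> \<Longrightarrow> openin S V"
    and base: "\<And>U x. openin S U \<Longrightarrow> x \<in> U \<Longrightarrow> \<exists>V \<in> \<B>. x \<in> V \<and> V \<subseteq> U"
    and f: "continuous_map S euclideanreal f" "\<And>x. x \<in> topspace S \<Longrightarrow> 0 \<le> f x \<and> f x \<le> C"
    and M: "M \<in> prob_measures S"
  shows "a < (\<integral>z. f z \<partial>M) \<longleftrightarrow> (\<exists>l b. set l \<subseteq> {(q, U). q \<in> \<rat> \<and> 0 \<le> q \<and> U \<in> \<B> \<and> (\<forall>x\<in>U. q \<le> f x)}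
      \<and> b \<in> \<rat> \<and> a \<le> b \<and> b < (\<integral>z. max_step l z \<partial>M))"
proof -
  interpret prob_space M by (rule prob_measuresD[OF M])
  note [measurable_cong] = prob_measuresD(2)[OF M]
  note sp = prob_measuresD(3)[OF M]
  have mf[measurable]: "f \<in> borel_measurable (borel_of S)"
    by (intro continuous_map_borel_measurable f)
  let ?E = "{(q, U). q \<in> \<rat> \<and> 0 \<le> q \<and> U \<in> \<B> \<and> (\<forall>x\<in>U. q \<le> f x)}"
  obtain x0 where x0: "x0 \<in> topspace S" using not_empty sp by (metis all_not_in_conv)
  have C0: "0 \<le> C" using f(2)[OF x0] by simp
  have le: "max_step l x \<le> f x" if "set l \<subseteq> ?E" "x \<in> topspace S" for l x
    using that f(2) by (intro max_step_le) auto
  have ml: "max_step l \<in> borel_measurable (borel_of S)" if "set l \<subseteq> ?E" for l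
    using that \<B>(2) by (intro max_step_measurable openin_borel_of) auto
  have int: "integrable M f"
    using f(2) sp by (intro integrable_const_bound[of _ C] AE_I2) auto
  show ?thesis
  proof safe
    assume a: "a < (\<integral>z. f z \<partial>M)"
    have "countable (\<rat> \<times> \<B>)" using \<B>(1) countable_rat by auto
    then have cE: "countable ?E" by (rule countable_subset[rotated]) auto
    \<comment> \<open>Any basic set serves, with height zero: the point is that the family of steps
      is non-empty, as its enumeration by \<open>from_nat_into\<close> requires.\<close>
    obtain B where "B \<in> \<B>" using base[OF openin_topspace x0] by auto
    then have "(0, B) \<in> ?E" using f(2) openin_subset[OF \<B>(2), of B] by auto
    then have nE: "?E \<noteq> {}" by blast
    \<comment> \<open>Longer and longer initial pieces of one enumeration, so that every single step
      is eventually present.\<close>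
    define L where "L n = map (from_nat_into ?E) [0..<n]" for n
    have LE: "set (L n) \<subseteq> ?E" for n
      unfolding L_def set_map by (rule image_subsetI, rule from_nat_into[OF nE])
    note [measurable] = ml[OF LE]
    have lim: "(\<lambda>n. max_step (L n) x) \<longlonglongrightarrow> f x" if x: "x \<in> topspace S" for x
    proof (rule order_tendstoI)
      fix y assume "y < f x"
      show "eventually (\<lambda>n. y < max_step (L n) x) sequentially"
      \<comment> \<open>For \<open>0 \<le> y\<close> a rational \<open>q\<close> between
        \<open>y\<close> and \<open>f x\<close> may serve as a height; a negative \<open>y\<close>
        is exceeded by any \<open>max_step\<close>.\<close>
      proof (cases "0 \<le> y")
        case True
        obtain q where q: "q \<in> \<rat>" "y < q" "q < f x" using Rats_dense_in_real[OF \<open>y < f x\<close>] by blast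
        have op: "openin S {x \<in> topspace S. f x \<in> {q<..}}"
          using f(1) unfolding continuous_map_def by (metis open_greaterThan open_openin)
        then obtain V where V: "V \<in> \<B>" "x \<in> V" "V \<subseteq> {x \<in> topspace S. f x \<in> {q<..}}"
          using base[OF op, of x] x q by (metis (no_types, lifting) greaterThan_iff mem_Collect_eq)
        then have "(q, V) \<in> ?E" using q True by auto
        then obtain m where m: "from_nat_into ?E m = (q, V)"
          using from_nat_into_surj[OF cE] by blast
        have "y < max_step (L n) x" if "n \<ge> Suc m" for n
        proof -
          have "(q, V) \<in> set (L n)"
            unfolding L_def set_map m[symmetric] using that by (intro imageI) auto
          then have "q \<le> max_step (L n) x" using V(2) by (rule max_step_ge)
          then show ?thesis using q by simp
        qed
        then show ?thesis by (auto simp: eventually_sequentially)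
      next
        case False
        have "y < max_step (L n) x" for n using False max_step_nonneg[of "L n" x] by linarith
        then show ?thesis by simp
      qed
    next
      fix y assume "f x < y"
      then show "eventually (\<lambda>n. max_step (L n) x < y) sequentially"
        using le[OF LE x] by (auto intro!: always_eventually intro: le_less_trans)
    qed
    have "(\<lambda>n. \<integral>z. max_step (L n) z \<partial>M) \<longlonglongrightarrow> (\<integral>z. f z \<partial>M)"
    proof (rule integral_dominated_convergence[where w = "\<lambda>_. C"])
      show "AE x in M. (\<lambda>n. max_step (L n) x) \<longlonglongrightarrow> f x"
        using lim sp by (intro AE_I2) simp
      show "AE x in M. norm (max_step (L n) x) \<le> C" for n
        using le[OF LE[of n]] f(2) max_step_nonneg[of "L n"] sp by (intro AE_I2) (force intro: order_trans)
    qed auto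
    then have "eventually (\<lambda>n. a < (\<integral>z. max_step (L n) z \<partial>M)) sequentially" using a by (rule order_tendstoD)
    then obtain n where "a < (\<integral>z. max_step (L n) z \<partial>M)" by (auto simp: eventually_sequentially)
    then obtain b where "b \<in> \<rat>" "a < b" "b < (\<integral>z. max_step (L n) z \<partial>M)"
      using Rats_dense_in_real by blast
    then show "\<exists>l b. set l \<subseteq> ?E \<and> b \<in> \<rat> \<and> a \<le> b \<and> b < (\<integral>z. max_step l z \<partial>M)"
      using LE by (intro exI[of _ "L n"] exI[of _ b]) auto
  next
    fix l b assume l: "set l \<subseteq> ?E" and b: "a \<le> b" "b < (\<integral>z. max_step l z \<partial>M)"
    note [measurable] = ml[OF l]
    have "(\<integral>z. max_step l z \<partial>M) \<le> (\<integral>z. f z \<partial>M)"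
    proof (rule integral_mono[OF _ int])
      show "integrable M (max_step l)"
        using le[OF l] f(2) max_step_nonneg[of l] sp
        by (intro integrable_const_bound[of _ C] AE_I2) (auto, force intro: order_trans)
    qed (use le[OF l] sp in auto)
    then show "a < (\<integral>z. f z \<partial>M)" using b by simp
  qed
qed

text \<open>The defining subbasis runs over all bounded continuous functions. It is replaced by
  countably many sets at the price of discontinuous test functions \<open>max_step l\<close>: these
  sets are weakly open by lower semicontinuity and lie in \<open>prob_algebra\<close> because the
  test functions are Borel.\<close>

lemma weak_topology_countably_generated:
  assumes S: "metrizable_space S" "second_countable S"
  obtains \<S> where "countable \<S>" "weak_topology S = topology_generated_by \<S>"
    "\<And>A. A \<in> \<S> \<Longrightarrow> A \<in> sets (prob_algebra (borel_of S))"
proof -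
  obtain \<B> where \<B>: "countable \<B>" "\<And>V. V \<in> \<B> \<Longrightarrow> openin S V"
    and base: "\<And>U x. openin S U \<Longrightarrow> x \<in> U \<Longrightarrow> \<exists>V \<in> \<B>. x \<in> V \<and> V \<subseteq> U"
    using S(2) by (auto simp: second_countable_def)
  let ?H = "\<lambda>l (b :: real). {M \<in> prob_measures S. b < (\<integral>z. max_step l z \<partial>M)}"
  let ?Q = "{q \<in> \<rat>. 0 \<le> q} \<times> \<B> :: (real \<times> _) set"
  define \<S> where "\<S> = insert (prob_measures S) ((\<lambda>(l, b). ?H l b) ` (lists ?Q \<times> \<rat>))"
  have "countable {q \<in> \<rat>. 0 \<le> (q::real)}" by (rule countable_subset[OF _ countable_rat]) auto
  then have 1: "countable \<S>"
    unfolding \<S>_def using \<B>(1) countable_rat by (intro countable_insert countable_image countable_SIGMA countable_lists) auto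
  have 3: "A \<in> sets (prob_algebra (borel_of S))" if "A \<in> \<S>" for A
    using that unfolding \<S>_def
  proof
    assume "A = prob_measures S"
    then show ?thesis by (simp add: prob_measures_eq_space_prob_algebra)
  next
    assume "A \<in> (\<lambda>(l, b). ?H l b) ` (lists ?Q \<times> \<rat>)"
    then obtain l b where A: "A = ?H l b" and l: "set l \<subseteq> ?Q" by auto
    have [measurable]: "max_step l \<in> borel_measurable (borel_of S)"
      using l \<B>(2) by (intro max_step_measurable openin_borel_of) auto
    have [measurable]: "(\<lambda>M. \<integral>z. max_step l z \<partial>M) \<in> borel_measurable (prob_algebra (borel_of S))"
      unfolding prob_algebra_def by (intro measurable_restrict_space1 integral_measurable_subprob_algebra) measurable
    have "A = {M \<in> space (prob_algebra (borel_of S)). b < (\<integral>z. max_step l z \<partial>M)}"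
      unfolding A by (simp add: prob_measures_eq_space_prob_algebra)
    also have "\<dots> \<in> sets (prob_algebra (borel_of S))" by measurable
    finally show ?thesis .
  qed
  let ?W = "topology_generated_by \<S>"
  have topW: "\<Union>\<S> = prob_measures S" unfolding \<S>_def by auto
  \<comment> \<open>Half-lines and non-negative \<open>f\<close> suffice: below,
    \<open>C + f\<close> and \<open>C - f\<close> are non-negative and control the integral of a
    bounded \<open>f\<close> from either side.\<close>
  have half: "openin ?W {M \<in> prob_measures S. a < (\<integral>z. f z \<partial>M)}"
    if f: "continuous_map S euclideanreal f" "\<And>x. x \<in> topspace S \<Longrightarrow> 0 \<le> f x \<and> f x \<le> C" for f C a
  proof -
    let ?E = "{(q, U). q \<in> \<rat> \<and> 0 \<le> q \<and> U \<in> \<B> \<and> (\<forall>x\<in>U. q \<le> f x)}"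
    have "{M \<in> prob_measures S. a < (\<integral>z. f z \<partial>M)}
      = (\<Union>(l, b)\<in>{(l, b). set l \<subseteq> ?E \<and> b \<in> \<rat> \<and> a \<le> b}. ?H l b)"
      using integral_gt_iff_max_step[OF \<B> base f] by auto
    also have "openin ?W \<dots>"
    proof (rule openin_Union, clarsimp)
      fix l and b :: real assume "set l \<subseteq> ?E" "b \<in> \<rat>"
      then have "?H l b \<in> \<S>" unfolding \<S>_def by (intro insertI2 image_eqI[of _ _ "(l, b)"]) auto
      then show "openin ?W (?H l b)" by (rule topology_generated_by_Basis)
    qed
    finally show ?thesis .
  qed
  have "weak_topology S = ?W"
  proof (rule topology_eq[THEN iffD2], intro allI iffI)
    fix T assume "openin (weak_topology S) T"
    then have "generate_topology_on {{M \<in> prob_measures S. (\<integral>z. f z \<partial>M) \<in> U} | f U.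
        continuous_map S euclideanreal f \<and> bounded (f ` topspace S) \<and> open (U :: real set)} T"
      unfolding weak_topology_def by (rule openin_topology_generated_by)
    then show "openin ?W T"
    proof (rule generate_topology_on_coarsest[OF istopology_openin, rotated])
      fix A assume "A \<in> {{M \<in> prob_measures S. (\<integral>z. f z \<partial>M) \<in> U} | f U.
        continuous_map S euclideanreal f \<and> bounded (f ` topspace S) \<and> open (U :: real set)}"
      then obtain f and U :: "real set" where A: "A = {M \<in> prob_measures S. (\<integral>z. f z \<partial>M) \<in> U}"
        and f: "continuous_map S euclideanreal f" "bounded (f ` topspace S)" and U: "open U" by auto
      obtain C where C: "\<And>x. x \<in> topspace S \<Longrightarrow> \<bar>f x\<bar> \<le> C" using f(2) by (auto simp: bounded_iff)
      show "openin ?W A"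
      proof (subst openin_subopen, intro ballI)
        fix M assume MA: "M \<in> A"
        then have "(\<integral>z. f z \<partial>M) \<in> U" by (simp add: A)
        then obtain e where e: "e > 0" "\<And>y. \<bar>y - (\<integral>z. f z \<partial>M)\<bar> < e \<Longrightarrow> y \<in> U"
          using U by (metis open_real)
        define r where "r = (\<integral>z. f z \<partial>M)"
        let ?T1 = "{M \<in> prob_measures S. C + (r - e) < (\<integral>z. C + f z \<partial>M)}"
        let ?T2 = "{M \<in> prob_measures S. C - (r + e) < (\<integral>z. C - f z \<partial>M)}"
        have eq: "(\<integral>z. C + f z \<partial>M) = C + (\<integral>z. f z \<partial>M)" "(\<integral>z. C - f z \<partial>M) = C - (\<integral>z. f z \<partial>M)"
          if M: "M \<in> prob_measures S" for M
        proof -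
          interpret prob_space M by (rule prob_measuresD[OF M])
          note [measurable_cong] = prob_measuresD(2)[OF M]
          have [measurable]: "f \<in> borel_measurable (borel_of S)"
            by (intro continuous_map_borel_measurable f)
          have int: "integrable M f"
            using C prob_measuresD(3)[OF M] by (intro integrable_const_bound[of _ C] AE_I2) auto
          show "(\<integral>z. C + f z \<partial>M) = C + (\<integral>z. f z \<partial>M)" "(\<integral>z. C - f z \<partial>M) = C - (\<integral>z. f z \<partial>M)"
            using int by (simp_all add: prob_space)
        qed
        have b: "0 \<le> C + f x \<and> C + f x \<le> 2 * C" "0 \<le> C - f x \<and> C - f x \<le> 2 * C" if "x \<in> topspace S" for x
          using C[OF that] by auto
        have "openin ?W ?T1" "openin ?W ?T2"
          by (rule half[OF _ b(1)] half[OF _ b(2)], intro continuous_map_add continuous_map_diff f continuous_map_const[THEN iffD2], auto)+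
        then have "openin ?W (?T1 \<inter> ?T2)" by (rule openin_Int)
        moreover have "M \<in> ?T1 \<inter> ?T2" using MA eq[of M] e by (auto simp: A r_def)
        moreover have "?T1 \<inter> ?T2 \<subseteq> A"
        proof
          fix N assume "N \<in> ?T1 \<inter> ?T2"
          then have "N \<in> prob_measures S" "\<bar>(\<integral>z. f z \<partial>N) - (\<integral>z. f z \<partial>M)\<bar> < e"
            using eq[of N] by (auto simp: r_def)
          then show "N \<in> A" using e(2) by (simp add: A)
        qed
        ultimately show "\<exists>T. openin ?W T \<and> M \<in> T \<and> T \<subseteq> A" by blast
      qed
    qed
  next
    fix T assume "openin ?W T"
    then have "generate_topology_on \<S> T" by (rule openin_topology_generated_by)
    then show "openin (weak_topology S) T"
    proof (rule generate_topology_on_coarsest[OF istopology_openin, rotated])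
      fix A assume "A \<in> \<S>"
      then show "openin (weak_topology S) A"
        unfolding \<S>_def
      proof
        assume "A = prob_measures S"
        then show ?thesis by (metis openin_topspace topspace_weak_topology)
      next
        assume "A \<in> (\<lambda>(l, b). ?H l b) ` (lists ?Q \<times> \<rat>)"
        then show ?thesis using \<B>(2) by (auto intro!: openin_weak_max_step[OF S(1)])
      qed
    qed
  qed
  with 1 3 show thesis by (intro that)
qed

lemma polish_metrizable_second_countable:
  assumes "polish_topology S" shows "metrizable_space S" "second_countable S"
  using assms by (auto simp: polish_iff_second_countable completely_metrizable_imp_metrizable_space)

lemma second_countable_weak_topology:
  assumes "polish_topology S" shows "second_countable (weak_topology S)"
  using weak_topology_countably_generated[OF polish_metrizable_second_countable[OF assms]]
  by (metis second_countable_generated)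

text \<open>The bridge between Borel maps into the weak topology and kernels in the sense of
  \<open>prob_algebra\<close>, for which binds, products and integrals are available. One direction
  tests the countable subbasis. The other writes the mass of an open set as a limit of integrals of
  continuous functions, and open sets form a generating pi-system.\<close>

lemma measurable_weak_topology_iff:
  assumes S: "polish_topology S"
  shows "K \<in> N \<rightarrow>\<^sub>M borel_of (weak_topology S) \<longleftrightarrow> K \<in> N \<rightarrow>\<^sub>M prob_algebra (borel_of S)"
proof
  assume K: "K \<in> N \<rightarrow>\<^sub>M prob_algebra (borel_of S)"
  obtain \<S> where \<S>: "countable \<S>" "weak_topology S = topology_generated_by \<S>"
    "\<And>A. A \<in> \<S> \<Longrightarrow> A \<in> sets (prob_algebra (borel_of S))"
    using weak_topology_countably_generated[OF polish_metrizable_second_countable[OF S]] by metis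
  have top: "\<Union>\<S> = prob_measures S"
    using topspace_weak_topology[of S] by (simp add: \<S>(2))
  show "K \<in> N \<rightarrow>\<^sub>M borel_of (weak_topology S)"
  proof (rule measurable_sigma_sets)
    show "sets (borel_of (weak_topology S)) = sigma_sets (\<Union>\<S>) \<S>"
      unfolding \<S>(2) by (rule sets_borel_of_generated[OF \<S>(1)])
    show "\<S> \<subseteq> Pow (\<Union>\<S>)" by auto
    show "K \<in> space N \<rightarrow> \<Union>\<S>"
      using measurable_space[OF K] by (simp add: top prob_measures_eq_space_prob_algebra)
    show "K -` A \<inter> space N \<in> sets N" if "A \<in> \<S>" for A
      using measurable_sets[OF K \<S>(3)[OF that]] .
  qed
next
  assume K: "K \<in> N \<rightarrow>\<^sub>M borel_of (weak_topology S)"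
  then have KP: "K a \<in> prob_measures S" if "a \<in> space N" for a
    using measurable_space[OF K that] by (simp add: topspace_weak_topology)
  show "K \<in> N \<rightarrow>\<^sub>M prob_algebra (borel_of S)"
  proof (rule measurable_prob_algebra_generated[where N = "borel_of S" and G = "{U. openin S U}" and \<Omega> = "topspace S"])
    show "sets (borel_of S) = sigma_sets (topspace S) {U. openin S U}" by (rule sets_borel_of)
    show "Int_stable {U. openin S U}" by (auto simp: Int_stable_def)
    show "{U. openin S U} \<subseteq> Pow (topspace S)" by (auto dest: openin_subset)
    show "prob_space (K a)" "sets (K a) = sets (borel_of S)" if "a \<in> space N" for a
      using KP[OF that] by (auto simp: prob_measures_def)
    fix U assume "U \<in> {U. openin S U}"
    then have U: "openin S U" by simp
    obtain f :: "nat \<Rightarrow> _ \<Rightarrow> real" where f: "\<And>n. continuous_map S euclideanreal (f n)"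
      "\<And>n x. x \<in> topspace S \<Longrightarrow> 0 \<le> f n x \<and> f n x \<le> indicator U x"
      "\<And>x. x \<in> topspace S \<Longrightarrow> (\<lambda>n. f n x) \<longlonglongrightarrow> indicator U x"
      using continuous_approx_indicator[OF polish_metrizable_second_countable(1)[OF S] U] by metis
    have ind: "indicator U x \<le> (1::real)" for x by (simp add: indicator_def)
    have f1: "0 \<le> f n x \<and> f n x \<le> 1" if "x \<in> topspace S" for n x
      using f(2)[OF that, of n] ind[of x] by linarith
    have "(\<lambda>a. measure (K a) U) \<in> borel_measurable N"
    proof (rule borel_measurable_LIMSEQ_real)
      show "(\<lambda>a. \<integral>z. f n z \<partial>K a) \<in> borel_measurable N" for n
      proof -
        have "bounded (f n ` topspace S)"
          using f1[of _ n] by (intro boundedI[of _ 1]) auto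
        then have "continuous_map (weak_topology S) euclideanreal (\<lambda>M. \<integral>z. f n z \<partial>M)"
          using openin_weak_topology[OF f(1)[of n]]
          by (auto simp: continuous_map_def topspace_weak_topology)
        then show ?thesis
          by (rule measurable_compose[OF K continuous_map_borel_measurable])
      qed
      fix a assume a: "a \<in> space N"
      interpret prob_space "K a" by (rule prob_measuresD[OF KP[OF a]])
      note sp = prob_measuresD(2,3)[OF KP[OF a]]
      note [measurable_cong] = sp(1)
      have [measurable]: "f n \<in> borel_measurable (borel_of S)" for n
        by (intro continuous_map_borel_measurable f)
      have [measurable]: "U \<in> sets (borel_of S)" by (rule openin_borel_of[OF U])
      have "(\<lambda>n. \<integral>z. f n z \<partial>K a) \<longlonglongrightarrow> (\<integral>z. indicator U z \<partial>K a)"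
      proof (rule integral_dominated_convergence[where w = "\<lambda>_. 1"])
        show "AE x in K a. (\<lambda>n. f n x) \<longlonglongrightarrow> indicator U x" using f(3) sp(2) by (intro AE_I2) simp
        show "AE x in K a. norm (f n x) \<le> 1" for n using f1 sp(2) by (intro AE_I2) simp
      qed auto
      then show "(\<lambda>n. \<integral>z. f n z \<partial>K a) \<longlonglongrightarrow> measure (K a) U"
        using openin_borel_of[OF U] sp by (simp add: Int_absorb1 openin_subset[OF U] Int_absorb2)
    qed
    then have "(\<lambda>a. ennreal (measure (K a) U)) \<in> borel_measurable N" by measurable
    moreover have "emeasure (K a) U = ennreal (measure (K a) U)" if "a \<in> space N" for a
    proof -
      interpret prob_space "K a" by (rule prob_measuresD[OF KP[OF that]])
      show ?thesis by (rule emeasure_eq_measure)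
    qed
    ultimately show "(\<lambda>a. emeasure (K a) U) \<in> borel_measurable N"
      by (simp cong: measurable_cong)
  qed
qed

section \<open>Bounded densities\<close>

text \<open>The bounds hold at every point and \<open>M\<close> enters only through its
  sigma-algebra, so that all measures with the same measurable sets share one set of
  densities.\<close>

definition bounded_densities :: "'a measure \<Rightarrow> real \<Rightarrow> ('a \<Rightarrow> real) set" where
  "bounded_densities M C = {p \<in> borel_measurable M. \<forall>x. 0 \<le> p x \<and> p x \<le> C}"

text \<open>The domination, applied to the set where a Radon-Nikodym density exceeds
  \<open>C\<close>, shows that this set is null.\<close>

lemma bounded_density_exists:
  assumes U: "finite_measure U" and sets: "sets \<gamma> = sets U" and C: "0 \<le> C"
    and le: "\<And>A. A \<in> sets U \<Longrightarrow> emeasure \<gamma> A \<le> ennreal C * emeasure U A"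
  obtains p where "p \<in> bounded_densities U C" "density U (\<lambda>x. ennreal (p x)) = \<gamma>"
proof -
  interpret finite_measure U by fact
  have "absolutely_continuous U \<gamma>"
    unfolding absolutely_continuous_def
  proof
    fix A assume "A \<in> null_sets U"
    then show "A \<in> null_sets \<gamma>" using le[of A] sets by (auto simp: null_sets_def)
  qed
  then obtain f where f[measurable]: "f \<in> borel_measurable U" and \<gamma>: "density U f = \<gamma>"
    using Radon_Nikodym[OF _ sets] by blast
  have fin: "ennreal C * emeasure U A \<noteq> \<infinity>" for A
    by (simp add: ennreal_mult_eq_top_iff emeasure_eq_ennreal_measure)
  let ?A = "{x \<in> space U. ennreal C < f x}"
  have A: "?A \<in> sets U" by measurable
  have *: "(\<integral>\<^sup>+x. ennreal C * indicator ?A x \<partial>U) = ennreal C * emeasure U ?A"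
    using A by (simp add: nn_integral_cmult)
  have "(\<integral>\<^sup>+x. f x * indicator ?A x - ennreal C * indicator ?A x \<partial>U) =
      (\<integral>\<^sup>+x. f x * indicator ?A x \<partial>U) - (\<integral>\<^sup>+x. ennreal C * indicator ?A x \<partial>U)"
    by (rule nn_integral_diff) (use A in \<open>auto simp: * fin[simplified] split: split_indicator\<close>)
  also have "\<dots> = emeasure \<gamma> ?A - ennreal C * emeasure U ?A"
    using A by (simp add: * emeasure_density \<gamma>[symmetric])
  also have "\<dots> = 0"
    using le[OF A] fin[of ?A] by (intro diff_eq_0_ennreal) (auto simp: top.not_eq_extremum intro: le_less_trans)
  finally have "AE x in U. f x * indicator ?A x - ennreal C * indicator ?A x = 0"
    using A by (subst (asm) nn_integral_0_iff_AE) auto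
  with AE_space have ae: "AE x in U. f x \<le> ennreal C"
  proof eventually_elim
    case (elim x)
    show ?case
    proof (rule ccontr)
      assume "\<not> f x \<le> ennreal C"
      then have lt: "ennreal C < f x" by simp
      then have "0 < f x - ennreal C" by (simp add: diff_gt_0_iff_gt_ennreal)
      with elim lt show False by simp
    qed
  qed
  \<comment> \<open>Truncation changes the density on a null set only and makes the bounds hold
    everywhere; the minimum is finite, so \<open>enn2real\<close> loses nothing.\<close>
  define p where "p x = enn2real (min (f x) (ennreal C))" for x
  have "ennreal (p x) = min (f x) (ennreal C)" for x
    unfolding p_def by (rule ennreal_enn2real) (simp add: min_less_iff_disj)
  then have "density U (\<lambda>x. ennreal (p x)) = density U f"
    using ae by (intro density_cong) (auto simp: p_def min_def)
  moreover have "p \<in> borel_measurable U" unfolding p_def by measurable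
  moreover have "p x \<le> C" for x
    unfolding p_def using enn2real_mono[of "min (f x) (ennreal C)" "ennreal C"] C by simp
  moreover have "0 \<le> p x" for x by (simp add: p_def)
  ultimately show thesis using \<gamma> by (intro that[of p]) (auto simp: bounded_densities_def)
qed

text \<open>Instead of a diagonal sequence: the cube \<open>[-B, B]\<close> to the power of the
  naturals is compact by Tychonoff and metrizable, hence sequentially compact.\<close>

lemma pointwise_convergent_subsequence:
  fixes u :: "nat \<Rightarrow> nat \<Rightarrow> real"
  assumes "\<And>n j. \<bar>u n j\<bar> \<le> B"
  obtains r where "strict_mono (r :: nat \<Rightarrow> nat)" "\<And>j. convergent (\<lambda>n. u (r n) j)"
proof -
  let ?K = "PiE UNIV (\<lambda>_::nat. {-B..B})"
  have "compactin (product_topology (\<lambda>_::nat. euclideanreal) UNIV) ?K"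
    by (simp add: compactin_PiE)
  then have "compact ?K" by (simp add: euclidean_product_topology)
  then have "seq_compact ?K" using compact_eq_seq_compact_metric by blast
  moreover have "\<forall>n. u n \<in> ?K" using assms by (auto simp: PiE_iff abs_le_iff) (smt (verit))
  ultimately obtain l and r :: "nat \<Rightarrow> nat" where r: "strict_mono r" "(u \<circ> r) \<longlonglongrightarrow> l"
    by (rule seq_compactE)
  have "(\<lambda>n. u (r n) j) \<longlonglongrightarrow> l j" for j
  proof -
    have "continuous_on UNIV (\<lambda>f :: nat \<Rightarrow> real. f j)" by simp
    then have "((\<lambda>f :: nat \<Rightarrow> real. f j) \<longlongrightarrow> l j) (at l)" by (simp add: continuous_on_def)
    then show ?thesis
      using tendsto_compose[of "\<lambda>f. f j" l "u \<circ> r" sequentially] r(2) by (simp add: comp_def)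
  qed
  with r(1) show thesis by (intro that) (auto simp: convergent_def)
qed

text \<open>The bound does not depend on \<open>p\<close>, so an \<open>L^1\<close> approximation of
  \<open>f\<close> works for a whole sequence of densities at once.\<close>

lemma integrable_mult_bounded_density:
  assumes f: "integrable U (f :: _ \<Rightarrow> real)" and p: "p \<in> bounded_densities U C"
  shows "integrable U (\<lambda>x. f x * p x)" "\<bar>\<integral>x. f x * p x \<partial>U\<bar> \<le> C * (\<integral>x. \<bar>f x\<bar> \<partial>U)"
proof -
  have [measurable]: "p \<in> borel_measurable U" "f \<in> borel_measurable U"
    using p f by (auto simp: bounded_densities_def)
  have p': "0 \<le> p x" "p x \<le> C" for x using p by (auto simp: bounded_densities_def)
  have C: "0 \<le> C" using p'[of undefined] by simp
  have le: "\<bar>f x * p x\<bar> \<le> C * \<bar>f x\<bar>" for x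
    using p'[of x] mult_right_mono[of "p x" C "\<bar>f x\<bar>"] by (simp add: abs_mult mult.commute)
  show int: "integrable U (\<lambda>x. f x * p x)"
    by (rule Bochner_Integration.integrable_bound[of _ "\<lambda>x. C * f x"])
       (use f le C in \<open>auto simp: abs_mult\<close>)
  have "\<bar>\<integral>x. f x * p x \<partial>U\<bar> \<le> (\<integral>x. \<bar>f x * p x\<bar> \<partial>U)" by (rule integral_abs_bound)
  also have "\<dots> \<le> (\<integral>x. C * \<bar>f x\<bar> \<partial>U)"
    by (rule integral_mono) (use int f le in auto)
  finally show "\<bar>\<integral>x. f x * p x \<partial>U\<bar> \<le> C * (\<integral>x. \<bar>f x\<bar> \<partial>U)" by simp
qed

text \<open>Domination by \<open>C * U\<close> makes setwise limits countably additive, so that the limit along a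
  subsequence chosen on a countable generator is again a density.\<close>

lemma bounded_densities_weakly_compact:
  assumes U: "finite_measure U" and \<E>: "countable \<E>" "Int_stable \<E>" "\<E> \<subseteq> Pow (space U)"
    "space U \<in> \<E>" "sets U = sigma_sets (space U) \<E>"
    and p: "\<And>n::nat. p n \<in> bounded_densities U C"
  obtains r q where "strict_mono (r :: nat \<Rightarrow> nat)" "q \<in> bounded_densities U C"
    "\<And>f :: _ \<Rightarrow> real. integrable U f \<Longrightarrow> (\<lambda>n. \<integral>x. f x * p (r n) x \<partial>U) \<longlonglongrightarrow> (\<integral>x. f x * q x \<partial>U)"
proof -
  interpret finite_measure U by fact
  have C: "0 \<le> C" using p[of 0] by (auto simp: bounded_densities_def intro: order_trans)
  define v where "v n A = (\<integral>x. indicator A x * p n x \<partial>U)" for n A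
  have ind[simp]: "integrable U (indicator A :: _ \<Rightarrow> real)" if "A \<in> sets U" for A
    using that by (intro integrable_real_indicator) (auto simp: emeasure_eq_measure)
  have p0: "0 \<le> p n x" for n x using p[of n] by (auto simp: bounded_densities_def)
  have v0: "0 \<le> v n A" for n A unfolding v_def by (intro integral_nonneg_AE AE_I2) (simp add: p0)
  have vC: "v n A \<le> C * measure U A" if "A \<in> sets U" for n A
    using integrable_mult_bounded_density(2)[OF ind[OF that] p, of n] that v0[of n A]
    by (simp add: v_def sets.Int_space_eq2)
  let ?e = "from_nat_into \<E>"
  have ne: "\<E> \<noteq> {}" using \<E>(4) by auto
  have eE: "?e j \<in> sets U" for j
    using from_nat_into[OF ne, of j] by (simp add: \<E>(5) sigma_sets.Basic)
  have "\<bar>v n (?e j)\<bar> \<le> C * measure U (space U)" for n j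
    using vC[OF eE[of j], of n] v0[of n "?e j"] mult_left_mono[OF bounded_measure[of "?e j"] C] by simp
  from pointwise_convergent_subsequence[of "\<lambda>n j. v n (?e j)", OF this]
  obtain r :: "nat \<Rightarrow> nat" where r: "strict_mono r" "\<And>j. convergent (\<lambda>n. v (r n) (?e j))"
    by blast
  have base: "convergent (\<lambda>n. v (r n) A)" if "A \<in> \<E>" for A
    using r(2) that \<E>(1) by (metis from_nat_into_surj)
  \<comment> \<open>Limits and countable sums are exchanged by Tannery's theorem; the summable
    majorant \<open>C * measure U (A i)\<close> comes from the common bound on the
    densities.\<close>
  have union_lim: "(\<lambda>n. v (r n) (\<Union>i. A i)) \<longlonglongrightarrow> (\<Sum>i. l i)" "summable l"
    if A: "disjoint_family A" "\<And>i::nat. A i \<in> sets U" and l: "\<And>i. (\<lambda>n. v (r n) (A i)) \<longlonglongrightarrow> l i" for A l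
  proof -
    have sm: "summable (\<lambda>i. C * measure U (A i))"
      using finite_measure_UNION[of A] A by (intro summable_mult) (auto simp: sums_iff)
    have "eventually (\<lambda>n. summable (\<lambda>i. norm (v (r n) (A i)))) sequentially \<and> summable (\<lambda>i. norm (l i)) \<and>
        (\<lambda>n. \<Sum>i. v (r n) (A i)) \<longlonglongrightarrow> (\<Sum>i. l i)"
      by (rule tannerys_theorem[OF l _ sm]) (use vC A v0 in \<open>auto intro!: always_eventually\<close>)
    moreover have "v n (\<Union>i. A i) = (\<Sum>i. v n (A i))" for n
    proof -
      have "(\<Union>i. A i) \<in> sets U" using A by blast
      then have "set_integrable U (\<Union>i. A i) (p n)"
        using integrable_mult_bounded_density(1)[OF ind p, of "\<Union>i. A i" n] by (simp add: set_integrable_def)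
      then show ?thesis
        using lebesgue_integral_countable_add[of A U "p n"] A
        by (simp add: v_def set_lebesgue_integral_def disjoint_family_on_def)
    qed
    ultimately show "(\<lambda>n. v (r n) (\<Union>i. A i)) \<longlonglongrightarrow> (\<Sum>i. l i)" "summable l"
      by (auto intro: summable_norm_cancel)
  qed
  have compl_eq: "v n (space U - A) = v n (space U) - v n A" if "A \<in> sets U" for n A
  proof -
    have "v n (space U - A) = (\<integral>x. indicator (space U) x * p n x - indicator A x * p n x \<partial>U)"
      unfolding v_def by (intro Bochner_Integration.integral_cong) (auto split: split_indicator)
    also have "\<dots> = v n (space U) - v n A"
      unfolding v_def by (intro Bochner_Integration.integral_diff integrable_mult_bounded_density(1)[OF _ p] ind that) auto
    finally show ?thesis .
  qed
  \<comment> \<open>Dynkin's argument: convergence is known on the generator and passes to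
    complements and disjoint unions.\<close>
  have conv: "convergent (\<lambda>n. v (r n) A)" if "A \<in> sets U" for A
    using \<E>(2,3) that[unfolded \<E>(5)]
  proof (induction A rule: sigma_sets_induct_disjoint)
    case (basic A) then show ?case by (rule base)
  next
    case empty show ?case by (simp add: v_def convergent_const)
  next
    case (compl A)
    then have "A \<in> sets U" by (simp add: \<E>(5))
    then show ?case
      using compl(2) base[OF \<E>(4)] by (simp add: compl_eq convergent_diff)
  next
    case (union A)
    then obtain l where "\<And>i. (\<lambda>n. v (r n) (A i)) \<longlonglongrightarrow> l i" unfolding convergent_def by metis
    then show ?case
      using union_lim(1)[OF union(1), of l] union(2) unfolding convergent_def \<E>(5) by blast
  qed
  define L where "L A = lim (\<lambda>n. v (r n) A)" for A
  have L: "(\<lambda>n. v (r n) A) \<longlonglongrightarrow> L A" if "A \<in> sets U" for A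
    using conv[OF that] by (simp add: L_def convergent_LIMSEQ_iff)
  have L0: "0 \<le> L A" if "A \<in> sets U" for A
    using L[OF that] v0 by (intro LIMSEQ_le_const) auto
  define \<gamma> where "\<gamma> = measure_of (space U) (sets U) (\<lambda>A. ennreal (L A))"
  have em: "emeasure \<gamma> A = ennreal (L A)" if "A \<in> sets U" for A
    unfolding \<gamma>_def
  proof (rule emeasure_measure_of_sigma[OF sets.sigma_algebra_axioms _ _ that])
    have "L {} = 0" by (simp add: L_def v_def)
    then show "positive (sets U) (\<lambda>A. ennreal (L A))" by (simp add: positive_def)
    show "countably_additive (sets U) (\<lambda>A. ennreal (L A))"
    proof (rule countably_additiveI)
      fix A :: "nat \<Rightarrow> _" assume A: "range A \<subseteq> sets U" "disjoint_family A" "(\<Union>i. A i) \<in> sets U"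
      have lim: "(\<lambda>n. v (r n) (A i)) \<longlonglongrightarrow> L (A i)" for i using A by (intro L) auto
      have "L (\<Union>i. A i) = (\<Sum>i. L (A i))"
        using union_lim(1)[OF A(2) _ lim] A L[OF A(3)] LIMSEQ_unique by blast
      moreover have "summable (\<lambda>i. L (A i))" using union_lim(2)[OF A(2) _ lim] A by blast
      ultimately show "(\<Sum>i. ennreal (L (A i))) = ennreal (L (\<Union>i. A i))"
        using A L0 by (subst suminf_ennreal2) auto
    qed
  qed
  have sets\<gamma>: "sets \<gamma> = sets U" by (simp add: \<gamma>_def)
  \<comment> \<open>The domination survives the limit and so yields a density with the same
    bound.\<close>
  have "emeasure \<gamma> A \<le> ennreal C * emeasure U A" if A: "A \<in> sets U" for A
  proof -
    have "L A \<le> C * measure U A" using L[OF A] vC[OF A] by (intro LIMSEQ_le_const2) auto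
    then show ?thesis
      using C by (simp add: em[OF A] emeasure_eq_measure ennreal_mult[symmetric] ennreal_leI)
  qed
  then obtain q where q: "q \<in> bounded_densities U C" and dq: "density U (\<lambda>x. ennreal (q x)) = \<gamma>"
    using bounded_density_exists[OF U sets\<gamma> C] by blast
  have [measurable]: "q \<in> borel_measurable U" using q by (simp add: bounded_densities_def)
  have q0: "0 \<le> q x" for x using q by (simp add: bounded_densities_def)
  have Lq: "(\<integral>x. indicator A x * q x \<partial>U) = L A" if A: "A \<in> sets U" for A
  proof -
    have "ennreal (L A) = (\<integral>\<^sup>+x. ennreal (q x) * indicator A x \<partial>U)"
      using A by (simp add: em[OF A, symmetric] dq[symmetric] emeasure_density)
    also have "\<dots> = (\<integral>\<^sup>+x. ennreal (indicator A x * q x) \<partial>U)"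
      by (intro nn_integral_cong) (auto split: split_indicator)
    also have "\<dots> = ennreal (\<integral>x. indicator A x * q x \<partial>U)"
      using q0 by (intro nn_integral_eq_integral integrable_mult_bounded_density(1)[OF ind[OF A] q] AE_I2) auto
    finally show ?thesis
      using L0[OF A] q0 by (simp add: integral_nonneg_AE)
  qed
  \<comment> \<open>From sets to integrable functions: replacing \<open>f\<close> by an
    approximation \<open>s i\<close> costs at most \<open>C\<close> times their \<open>L^1\<close>
    distance, for all densities alike.\<close>
  have "(\<lambda>n. \<integral>x. f x * p (r n) x \<partial>U) \<longlonglongrightarrow> (\<integral>x. f x * q x \<partial>U)" if "integrable U f" for f :: "_ \<Rightarrow> real"
    using that
  proof (induction rule: integrable_induct)
    case (base A c)
    have "(\<lambda>n. c * v (r n) A) \<longlonglongrightarrow> c * (\<integral>x. indicator A x * q x \<partial>U)"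
      unfolding Lq[OF base(1)] by (intro tendsto_mult tendsto_const L base)
    then show ?case by (simp add: v_def mult.assoc mult.left_commute[of _ c] flip: integral_mult_right_zero)
  next
    case (add f g)
    have "(\<lambda>n. (\<integral>x. f x * p (r n) x \<partial>U) + (\<integral>x. g x * p (r n) x \<partial>U)) \<longlonglongrightarrow>
        (\<integral>x. f x * q x \<partial>U) + (\<integral>x. g x * q x \<partial>U)"
      by (intro tendsto_add add)
    moreover have "(\<integral>x. (f x + g x) * p' x \<partial>U) = (\<integral>x. f x * p' x \<partial>U) + (\<integral>x. g x * p' x \<partial>U)"
      if "p' \<in> bounded_densities U C" for p'
      using integrable_mult_bounded_density(1)[OF add(1) that] integrable_mult_bounded_density(1)[OF add(2) that]
      by (simp add: distrib_right)
    ultimately show ?case using p q by simp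
  next
    case (lim f s)
    have "(\<lambda>i. \<integral>x. \<bar>f x - s i x\<bar> \<partial>U) \<longlonglongrightarrow> (\<integral>x. 0 \<partial>U)"
    \<comment> \<open>\<open>integrable_induct\<close> supplies
      \<open>\<bar>s i x\<bar> \<le> 2 * \<bar>f x\<bar>\<close>, whence the factor three.\<close>
    proof (rule integral_dominated_convergence[where w = "\<lambda>x. 3 * \<bar>f x\<bar>"])
      have "(\<lambda>i. \<bar>f x - s i x\<bar>) \<longlonglongrightarrow> 0" if "x \<in> space U" for x
        using lim(2)[OF that] tendsto_diff[OF tendsto_const[of "f x"] lim(2)[OF that]]
        by (intro tendsto_rabs_zero) simp
      then show "AE x in U. (\<lambda>i. \<bar>f x - s i x\<bar>) \<longlonglongrightarrow> 0" by (intro AE_I2)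
      show "AE x in U. norm \<bar>f x - s i x\<bar> \<le> 3 * \<bar>f x\<bar>" for i
        using lim(3)[of _ i] by (intro AE_I2) (smt (verit) real_norm_def)
    qed (use lim in auto)
    then have s0: "(\<lambda>i. C * (\<integral>x. \<bar>f x - s i x\<bar> \<partial>U)) \<longlonglongrightarrow> 0"
      using tendsto_mult_right_zero by fastforce
    have diff: "\<bar>(\<integral>x. f x * p' x \<partial>U) - (\<integral>x. s i x * p' x \<partial>U)\<bar> \<le> C * (\<integral>x. \<bar>f x - s i x\<bar> \<partial>U)"
      if "p' \<in> bounded_densities U C" for i p'
    proof -
      have "(\<integral>x. f x * p' x \<partial>U) - (\<integral>x. s i x * p' x \<partial>U) = (\<integral>x. (f x - s i x) * p' x \<partial>U)"
        using lim that
        by (simp add: left_diff_distrib integrable_mult_bounded_density(1) Bochner_Integration.integral_diff)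
      also have "\<bar>\<dots>\<bar> \<le> C * (\<integral>x. \<bar>f x - s i x\<bar> \<partial>U)"
        using lim that by (intro integrable_mult_bounded_density(2)) auto
      finally show ?thesis .
    qed
    show ?case
    proof (rule LIMSEQ_I)
      fix e :: real assume e: "0 < e"
      then obtain i where i: "C * (\<integral>x. \<bar>f x - s i x\<bar> \<partial>U) < e / 3"
        using order_tendstoD(2)[OF s0, of "e / 3"] by (auto simp: eventually_sequentially)
      obtain N where N: "\<And>n. n \<ge> N \<Longrightarrow> \<bar>(\<integral>x. s i x * p (r n) x \<partial>U) - (\<integral>x. s i x * q x \<partial>U)\<bar> < e / 3"
        using LIMSEQ_D[OF lim(5)[of i], of "e / 3"] e by auto
      show "\<exists>N. \<forall>n\<ge>N. norm ((\<integral>x. f x * p (r n) x \<partial>U) - (\<integral>x. f x * q x \<partial>U)) < e"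
      proof (intro exI[of _ N] allI impI)
        fix n assume "n \<ge> N"
        then show "norm ((\<integral>x. f x * p (r n) x \<partial>U) - (\<integral>x. f x * q x \<partial>U)) < e"
          using N[of n] diff[OF p, of "r n" i] diff[OF q, of i] i unfolding real_norm_def by linarith
      qed
    qed
  qed
  then show thesis by (intro that[OF r(1) q])
qed

section \<open>A countable family of densities that is dense for every finite measure\<close>

definition indicator_sum :: "(real \<times> 'a set) list \<Rightarrow> 'a \<Rightarrow> real" where
  "indicator_sum l x = (\<Sum>(q, E)\<leftarrow>l. q * indicator E x)"

lemma indicator_sum_Cons: "indicator_sum ((q, E) # l) x = q * indicator E x + indicator_sum l x"
  and indicator_sum_append: "indicator_sum (l @ l') x = indicator_sum l x + indicator_sum l' x"
  by (simp_all add: indicator_sum_def)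

lemma indicator_sum_scale:
  "indicator_sum (map (\<lambda>(q, E). (c * q, E)) l) x = c * indicator_sum l x"
  by (induction l) (auto simp: indicator_sum_def algebra_simps)

lemma indicator_sum_measurable:
  assumes "\<And>q E. (q, E) \<in> set l \<Longrightarrow> E \<in> sets M"
  shows "indicator_sum l \<in> borel_measurable M"
  using assms
proof (induction l)
  case (Cons p l)
  obtain q E where p: "p = (q, E)" by fastforce
  have [measurable]: "indicator_sum l \<in> borel_measurable M" "E \<in> sets M"
    using Cons by (auto simp: p)
  have "indicator_sum (p # l) = (\<lambda>x. q * indicator E x + indicator_sum l x)"
    unfolding p by (rule ext) (rule indicator_sum_Cons)
  then show ?case by simp
qed (simp add: indicator_sum_def[abs_def])

lemma indicator_sum_integrable:
  assumes "finite_measure U" "\<And>q E. (q, E) \<in> set l \<Longrightarrow> E \<in> sets U"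
  shows "integrable U (indicator_sum l)"
  using assms(2)
proof (induction l)
  case (Cons p l)
  interpret finite_measure U by fact
  obtain q E where p: "p = (q, E)" by fastforce
  have "integrable U (indicator_sum l)" "E \<in> sets U"
    using Cons by (auto simp: p)
  moreover have "indicator_sum (p # l) = (\<lambda>x. q * indicator E x + indicator_sum l x)"
    unfolding p by (rule ext) (rule indicator_sum_Cons)
  ultimately show ?case by (auto simp: emeasure_eq_measure intro!: integrable_real_indicator)
qed (simp add: indicator_sum_def[abs_def])

lemma integral_abs_triangle:
  assumes "integrable M f" "integrable M g" "integrable M (h :: _ \<Rightarrow> real)"
  shows "(\<integral>x. \<bar>f x - h x\<bar> \<partial>M) \<le> (\<integral>x. \<bar>f x - g x\<bar> \<partial>M) + (\<integral>x. \<bar>g x - h x\<bar> \<partial>M)"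
proof -
  have "(\<integral>x. \<bar>f x - h x\<bar> \<partial>M) \<le> (\<integral>x. \<bar>f x - g x\<bar> + \<bar>g x - h x\<bar> \<partial>M)"
    by (rule integral_mono) (use assms in auto)
  also have "\<dots> = (\<integral>x. \<bar>f x - g x\<bar> \<partial>M) + (\<integral>x. \<bar>g x - h x\<bar> \<partial>M)"
    by (rule Bochner_Integration.integral_add) (use assms in auto)
  finally show ?thesis .
qed

text \<open>The approximable functions are closed under sums, rational and then real multiples, and
  \<open>L^1\<close> limits. They contain the indicators of the generator, hence by Dynkin's
  argument all indicators, and then all integrable functions. The set of lists depends on the
  generator but not on \<open>U\<close>.\<close>

lemma indicator_sums_dense:
  assumes U: "finite_measure U" and \<E>: "Int_stable \<E>" "\<E> \<subseteq> Pow (space U)"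
    "space U \<in> \<E>" "sets U = sigma_sets (space U) \<E>"
    and f: "integrable U (f :: _ \<Rightarrow> real)" and e: "0 < e"
  shows "\<exists>l\<in>lists (\<rat> \<times> \<E>). (\<integral>x. \<bar>indicator_sum l x - f x\<bar> \<partial>U) < e"
proof -
  interpret finite_measure U by fact
  define P where "P f \<longleftrightarrow> (\<forall>e>0. \<exists>l\<in>lists (\<rat> \<times> \<E>). (\<integral>x. \<bar>indicator_sum l x - f x\<bar> \<partial>U) < e)"
    for f :: "_ \<Rightarrow> real"
  have int: "integrable U (indicator_sum l)" if "l \<in> lists (\<rat> \<times> \<E>)" for l
    using that by (intro indicator_sum_integrable U) (auto simp: \<E>(4) intro!: sigma_sets.Basic)
  have approx: "P f" if f: "integrable U f"
    and a: "\<And>e. e > 0 \<Longrightarrow> \<exists>g. integrable U g \<and> P g \<and> (\<integral>x. \<bar>g x - f x\<bar> \<partial>U) < e" for f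
    unfolding P_def
  proof (intro allI impI)
    fix e :: real assume e: "e > 0"
    obtain g where g: "integrable U g" "P g" "(\<integral>x. \<bar>g x - f x\<bar> \<partial>U) < e / 2"
      using a[of "e/2"] e by auto
    obtain l where l: "l \<in> lists (\<rat> \<times> \<E>)" "(\<integral>x. \<bar>indicator_sum l x - g x\<bar> \<partial>U) < e / 2"
      using g(2) e unfolding P_def by (metis half_gt_zero)
    have "(\<integral>x. \<bar>indicator_sum l x - f x\<bar> \<partial>U) < e"
      using integral_abs_triangle[OF int[OF l(1)] g(1) f] l(2) g(3) by simp
    with l(1) show "\<exists>l\<in>lists (\<rat> \<times> \<E>). (\<integral>x. \<bar>indicator_sum l x - f x\<bar> \<partial>U) < e" by blast
  qed
  have add: "P (\<lambda>x. f x + g x)" if fg: "integrable U f" "integrable U g" "P f" "P g" for f g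
    unfolding P_def
  proof (intro allI impI)
    fix e :: real assume e: "e > 0"
    obtain l where l: "l \<in> lists (\<rat> \<times> \<E>)" "(\<integral>x. \<bar>indicator_sum l x - f x\<bar> \<partial>U) < e / 2"
      using fg(3) e unfolding P_def by (metis half_gt_zero)
    obtain l' where l': "l' \<in> lists (\<rat> \<times> \<E>)" "(\<integral>x. \<bar>indicator_sum l' x - g x\<bar> \<partial>U) < e / 2"
      using fg(4) e unfolding P_def by (metis half_gt_zero)
    have "(\<integral>x. \<bar>indicator_sum (l @ l') x - (f x + g x)\<bar> \<partial>U) \<le>
       (\<integral>x. \<bar>indicator_sum l x - f x\<bar> + \<bar>indicator_sum l' x - g x\<bar> \<partial>U)"
      unfolding indicator_sum_append
      by (rule integral_mono) (use int[OF l(1)] int[OF l'(1)] fg in auto)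
    also have "\<dots> < e"
      using int[OF l(1)] int[OF l'(1)] fg l l' by (subst Bochner_Integration.integral_add) auto
    finally show "\<exists>l\<in>lists (\<rat> \<times> \<E>). (\<integral>x. \<bar>indicator_sum l x - (f x + g x)\<bar> \<partial>U) < e"
      using l(1) l'(1) by (intro bexI[of _ "l @ l'"]) auto
  qed
  have rat: "P (\<lambda>x. q * f x)" if f: "integrable U f" "P f" and q: "q \<in> \<rat>" for f and q :: real
    unfolding P_def
  proof (intro allI impI)
    fix e :: real assume e: "e > 0"
    \<comment> \<open>One is added to \<open>\<bar>q\<bar>\<close> to include \<open>q = 0\<close>;
      the same device is used for the integral \<open>?I\<close> in the next step.\<close>
    then have "e / (\<bar>q\<bar> + 1) > 0" by (intro divide_pos_pos) auto
    then obtain l where l: "l \<in> lists (\<rat> \<times> \<E>)" "(\<integral>x. \<bar>indicator_sum l x - f x\<bar> \<partial>U) < e / (\<bar>q\<bar> + 1)"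
      using f(2) unfolding P_def by blast
    let ?l = "map (\<lambda>(c, E). (q * c, E)) l"
    have "(\<integral>x. \<bar>indicator_sum ?l x - q * f x\<bar> \<partial>U) = (\<integral>x. \<bar>q\<bar> * \<bar>indicator_sum l x - f x\<bar> \<partial>U)"
      unfolding indicator_sum_scale by (simp add: right_diff_distrib[symmetric] abs_mult)
    also have "\<dots> = \<bar>q\<bar> * (\<integral>x. \<bar>indicator_sum l x - f x\<bar> \<partial>U)" by simp
    also have "\<dots> \<le> (\<bar>q\<bar> + 1) * (\<integral>x. \<bar>indicator_sum l x - f x\<bar> \<partial>U)"
      by (intro mult_right_mono integral_nonneg_AE) auto
    also have "\<dots> < e" using l(2) by (simp add: pos_less_divide_eq mult.commute)
    finally show "\<exists>l\<in>lists (\<rat> \<times> \<E>). (\<integral>x. \<bar>indicator_sum l x - q * f x\<bar> \<partial>U) < e"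
    proof (intro bexI[of _ ?l])
      show "?l \<in> lists (\<rat> \<times> \<E>)" using l(1) q by (induction l) (auto intro: Rats_mult)
    qed
  qed
  have scale: "P (\<lambda>x. c * f x)" if f: "integrable U f" "P f" for f c
  proof (rule approx)
    fix e :: real assume e: "e > 0"
    let ?I = "\<integral>x. \<bar>f x\<bar> \<partial>U"
    have I: "?I \<ge> 0" by (intro integral_nonneg_AE) auto
    obtain q where q: "q \<in> \<rat>" "c < q" "q < c + e / (?I + 1)"
      using Rats_dense_in_real[of c "c + e / (?I + 1)"] e I by auto
    have "(\<integral>x. \<bar>q * f x - c * f x\<bar> \<partial>U) = (q - c) * ?I"
      using q(2) by (simp add: left_diff_distrib[symmetric] abs_mult)
    also have "\<dots> \<le> (q - c) * (?I + 1)" using q by (intro mult_left_mono) auto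
    also have "\<dots> < e"
    proof -
      have "q - c < e / (?I + 1)" using q(3) by simp
      moreover have "0 < ?I + 1" using I by linarith
      ultimately show ?thesis by (simp only: pos_less_divide_eq)
    qed
    finally show "\<exists>g. integrable U g \<and> P g \<and> (\<integral>x. \<bar>g x - c * f x\<bar> \<partial>U) < e"
      using rat[OF f q(1)] f by (intro exI[of _ "\<lambda>x. q * f x"]) auto
  qed (use f in auto)
  have basic: "P (indicator E)" if "E \<in> \<E>" for E
    unfolding P_def
    by (intro allI impI bexI[of _ "[(1, E)]"]) (use that in \<open>auto simp: indicator_sum_def\<close>)
  have ind_int[simp]: "integrable U (indicator A :: _ \<Rightarrow> real)" if "A \<in> sets U" for A
    using that by (intro integrable_real_indicator) (auto simp: emeasure_eq_measure)
  have zero: "P (\<lambda>x. 0)" using scale[OF ind_int basic[OF \<E>(3)], of 0] by simp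
  have ind: "P (indicator A)" if "A \<in> sets U" for A
    using \<E>(1,2) that[unfolded \<E>(4)]
  proof (induction A rule: sigma_sets_induct_disjoint)
    case (basic A) then show ?case by (rule \<open>\<And>E. E \<in> \<E> \<Longrightarrow> P (indicator E)\<close>)
  next
    case empty show ?case using zero by (simp add: indicator_def[abs_def])
  next
    case (compl A)
    then have A: "A \<in> sets U" by (simp add: \<E>(4))
    have "P (\<lambda>x. indicator (space U) x + (-1) * indicator A x)"
      using add[OF _ _ basic[OF \<E>(3)] scale[OF _ compl(2), of "-1"]] A by simp
    moreover have "indicator (space U - A) = (\<lambda>x. indicator (space U) x + (-1) * (indicator A x :: real))"
      using sets.sets_into_space[OF A] by (auto simp: fun_eq_iff split: split_indicator)
    ultimately show ?case by simp
  next
    case (union A)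
    have A: "A i \<in> sets U" for i using union by (auto simp: \<E>(4))
    show ?case
    proof (rule approx)
      let ?g = "\<lambda>n x. \<Sum>i<n. indicator (A i) x :: real"
      have gP: "P (?g n)" for n
        by (induction n) (use zero A union in \<open>auto intro!: add\<close>)
      have geq: "?g n x = indicator (\<Union>i<n. A i) x" for n x
        using union(1) by (subst indicator_UN_disjoint) (auto simp: disjoint_family_on_def)
      have "(\<lambda>n. \<integral>x. \<bar>?g n x - indicator (\<Union>i. A i) x\<bar> \<partial>U) \<longlonglongrightarrow> (\<integral>x. 0 \<partial>U)"
      proof (rule integral_dominated_convergence[where w = "\<lambda>_. 1"])
        have "(\<lambda>n. \<bar>?g n x - indicator (\<Union>i. A i) x\<bar>) \<longlonglongrightarrow> 0" for x
          unfolding geq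
          using tendsto_diff[OF LIMSEQ_indicator_UN[of A x] tendsto_const[of "indicator (\<Union>i. A i) x"]]
          by (intro tendsto_rabs_zero) simp
        then show "AE x in U. (\<lambda>n. \<bar>?g n x - indicator (\<Union>i. A i) x\<bar>) \<longlonglongrightarrow> 0" by simp
        show "AE x in U. norm \<bar>?g n x - indicator (\<Union>i. A i) x\<bar> \<le> 1" for n
          unfolding geq by (intro AE_I2) (auto split: split_indicator)
      qed (use A in auto)
      then have lim0: "(\<lambda>n. \<integral>x. \<bar>?g n x - indicator (\<Union>i. A i) x\<bar> \<partial>U) \<longlonglongrightarrow> 0" by simp
      fix e :: real assume "0 < e"
      then obtain n where "(\<integral>x. \<bar>?g n x - indicator (\<Union>i. A i) x\<bar> \<partial>U) < e"
        using order_tendstoD(2)[OF lim0, of e] by (auto simp: eventually_sequentially)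
      moreover have "integrable U (?g n)" using A by simp
      ultimately show "\<exists>g. integrable U g \<and> P g \<and> (\<integral>x. \<bar>g x - indicator (\<Union>i. A i) x\<bar> \<partial>U) < e"
        using gP by (intro exI[of _ "?g n"] conjI)
    qed (use A in auto)
  qed
  have "P f" using f
  proof (induction rule: integrable_induct)
    case (base A c)
    then show ?case using scale[OF _ ind[OF base(1)], of c] by (simp add: mult.commute)
  next
    case (add f g) then show ?case by (intro \<open>\<And>f g. _ \<Longrightarrow> _ \<Longrightarrow> _ \<Longrightarrow> _ \<Longrightarrow> P (\<lambda>x. f x + g x)\<close>)
  next
    case (lim f s)
    show ?case
    proof (rule approx[OF lim(4)])
      have "(\<lambda>i. \<integral>x. \<bar>s i x - f x\<bar> \<partial>U) \<longlonglongrightarrow> (\<integral>x. 0 \<partial>U)"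
      proof (rule integral_dominated_convergence[where w = "\<lambda>x. 3 * \<bar>f x\<bar>"])
        have "(\<lambda>i. \<bar>s i x - f x\<bar>) \<longlonglongrightarrow> 0" if "x \<in> space U" for x
          using tendsto_diff[OF lim(2)[OF that] tendsto_const[of "f x"]]
          by (intro tendsto_rabs_zero) simp
        then show "AE x in U. (\<lambda>i. \<bar>s i x - f x\<bar>) \<longlonglongrightarrow> 0" by (intro AE_I2)
        show "AE x in U. norm \<bar>s i x - f x\<bar> \<le> 3 * \<bar>f x\<bar>" for i
          using lim(3)[of _ i] by (intro AE_I2) (smt (verit) real_norm_def)
      qed (use lim in auto)
      then have lim0: "(\<lambda>i. \<integral>x. \<bar>s i x - f x\<bar> \<partial>U) \<longlonglongrightarrow> 0" by simp
      fix e :: real assume "0 < e"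
      then obtain i where "(\<integral>x. \<bar>s i x - f x\<bar> \<partial>U) < e"
        using order_tendstoD(2)[OF lim0, of e] by (auto simp: eventually_sequentially)
      then show "\<exists>g. integrable U g \<and> P g \<and> (\<integral>x. \<bar>g x - f x\<bar> \<partial>U) < e"
        using lim(1) lim(5) by (intro exI[of _ "s i"] conjI)
    qed
  qed
  then show ?thesis using e by (simp add: P_def)
qed

text \<open>Clipping to \<open>[0, C]\<close> never increases the distance to a function with values
  there, so it costs nothing. The set \<open>D\<close> is fixed before \<open>U\<close>: one
  countable set serves the reference measures of all states.\<close>

lemma countable_dense_bounded_densities:
  assumes C: "0 \<le> C" and \<E>: "countable \<E>" "Int_stable \<E>" "\<E> \<subseteq> Pow (space M)"
    "space M \<in> \<E>" "sets M = sigma_sets (space M) \<E>"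
  obtains D where "countable D" "D \<subseteq> bounded_densities M C"
    "\<And>U p. finite_measure U \<Longrightarrow> sets U = sets M \<Longrightarrow> p \<in> bounded_densities M C \<Longrightarrow>
      \<exists>d. (\<forall>n. d n \<in> D) \<and> (\<lambda>n::nat. \<integral>x. \<bar>d n x - p x\<bar> \<partial>U) \<longlonglongrightarrow> 0"
proof -
  define clip where "clip l x = max 0 (min C (indicator_sum l x))" for l and x :: 'a
  define D where "D = clip ` lists (\<rat> \<times> \<E>)"
  have 1: "countable D" unfolding D_def using \<E>(1) countable_rat by (intro countable_image countable_lists) auto
  have 2: "D \<subseteq> bounded_densities M C"
  proof
    fix d assume "d \<in> D"
    then obtain l where l: "l \<in> lists (\<rat> \<times> \<E>)" "d = clip l" by (auto simp: D_def)
    then have [measurable]: "indicator_sum l \<in> borel_measurable M"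
      by (intro indicator_sum_measurable) (auto simp: \<E>(5) intro!: sigma_sets.Basic)
    have "d \<in> borel_measurable M" unfolding l(2) clip_def[abs_def] by measurable
    then show "d \<in> bounded_densities M C"
      using C by (auto simp: bounded_densities_def l(2) clip_def)
  qed
  have 3: "\<exists>d. (\<forall>n. d n \<in> D) \<and> (\<lambda>n::nat. \<integral>x. \<bar>d n x - p x\<bar> \<partial>U) \<longlonglongrightarrow> 0"
    if U: "finite_measure U" "sets U = sets M" and p: "p \<in> bounded_densities M C" for U p
  proof -
    interpret finite_measure U by fact
    have sp: "space U = space M" using U(2) by (rule sets_eq_imp_space_eq)
    have [measurable]: "p \<in> borel_measurable U"
      using p U(2) by (simp add: bounded_densities_def cong: measurable_cong_sets)
    have p': "0 \<le> p x" "p x \<le> C" for x using p by (auto simp: bounded_densities_def)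
    have ip: "integrable U p" using p' by (intro integrable_const_bound[of _ C] AE_I2) auto
    have "\<exists>l\<in>lists (\<rat> \<times> \<E>). (\<integral>x. \<bar>indicator_sum l x - p x\<bar> \<partial>U) < inverse (Suc n)" for n
      by (rule indicator_sums_dense[OF U(1)]) (use \<E> ip in \<open>auto simp: sp U(2)\<close>)
    then obtain l where l: "\<And>n. l n \<in> lists (\<rat> \<times> \<E>)"
      "\<And>n. (\<integral>x. \<bar>indicator_sum (l n) x - p x\<bar> \<partial>U) < inverse (Suc n)" by metis
    have il: "integrable U (indicator_sum (l n))" for n
      using l(1)[of n] by (intro indicator_sum_integrable U) (auto simp: U(2) \<E>(5) intro!: sigma_sets.Basic)
    then have [measurable]: "indicator_sum (l n) \<in> borel_measurable U" for n by auto
    have cm: "clip (l n) \<in> borel_measurable U" for n unfolding clip_def[abs_def] by measurable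
    have ic: "integrable U (clip (l n))" for n
      using C by (intro integrable_const_bound[of _ C] AE_I2 cm) (auto simp: clip_def)
    have le: "(\<integral>x. \<bar>clip (l n) x - p x\<bar> \<partial>U) \<le> inverse (Suc n)" for n
    proof -
      have "(\<integral>x. \<bar>clip (l n) x - p x\<bar> \<partial>U) \<le> (\<integral>x. \<bar>indicator_sum (l n) x - p x\<bar> \<partial>U)"
      proof (rule integral_mono)
        show "\<bar>clip (l n) x - p x\<bar> \<le> \<bar>indicator_sum (l n) x - p x\<bar>" for x
          using p'[of x] unfolding clip_def by (auto simp: max_def min_def)
      qed (use il ip ic in auto)
      then show ?thesis using l(2)[of n] by simp
    qed
    have "(\<lambda>n. \<integral>x. \<bar>clip (l n) x - p x\<bar> \<partial>U) \<longlonglongrightarrow> 0"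
      by (rule tendsto_sandwich[OF _ _ tendsto_const LIMSEQ_inverse_real_of_nat])
         (use le in \<open>auto intro!: always_eventually integral_nonneg_AE\<close>)
    then show ?thesis using l(1) by (intro exI[of _ "\<lambda>n. clip (l n)"]) (auto simp: D_def)
  qed
  from 1 2 3 show thesis by (rule that)
qed

section \<open>Measurable selection of optimal couplings\<close>

text \<open>Among the minimizers of \<open>\<phi> 0\<close> the functionals \<open>\<phi> 1\<close>, \<open>\<phi> 2\<close>, \dots{} are minimized successively. The
  minimal value \<open>m j\<close> of stage \<open>j\<close> is measurable because, by compactness, \<open>m j z \<le> a\<close> says that the
  countable family \<open>D\<close> contains, for every tolerance, an approximate solution of the constraints
  \<open>\<psi> i = 0\<close>, \<open>\<phi> i = m i\<close> for \<open>i < j\<close> and \<open>\<phi> j \<le> a\<close>.\<close>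

lemma measurable_lexicographic_selection:
  fixes \<phi> \<psi> :: "nat \<Rightarrow> 'z \<Rightarrow> 'p \<Rightarrow> real"
  assumes D: "countable D" "D \<subseteq> S"
    and compact: "\<And>z u. z \<in> space N \<Longrightarrow> (\<And>n. u n \<in> S) \<Longrightarrow> \<exists>r p. strict_mono (r :: nat \<Rightarrow> nat) \<and> p \<in> S \<and>
      (\<forall>j. (\<lambda>n. \<phi> j z (u (r n))) \<longlonglongrightarrow> \<phi> j z p) \<and> (\<forall>j. (\<lambda>n. \<psi> j z (u (r n))) \<longlonglongrightarrow> \<psi> j z p)"
    and dense: "\<And>z p. z \<in> space N \<Longrightarrow> p \<in> S \<Longrightarrow> \<exists>d. (\<forall>n. d n \<in> D) \<and>
      (\<forall>j. (\<lambda>n::nat. \<phi> j z (d n)) \<longlonglongrightarrow> \<phi> j z p) \<and> (\<forall>j. (\<lambda>n. \<psi> j z (d n)) \<longlonglongrightarrow> \<psi> j z p)"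
    and meas: "\<And>j d. d \<in> D \<Longrightarrow> (\<lambda>z. \<phi> j z d) \<in> borel_measurable N"
      "\<And>j d. d \<in> D \<Longrightarrow> (\<lambda>z. \<psi> j z d) \<in> borel_measurable N"
    and feasible: "\<And>z. z \<in> space N \<Longrightarrow> \<exists>p\<in>S. \<forall>j. \<psi> j z p = 0"
  shows "\<exists>s. (\<forall>z\<in>space N. s z \<in> S \<and> (\<forall>j. \<psi> j z (s z) = 0) \<and>
      (\<forall>p\<in>S. (\<forall>j. \<psi> j z p = 0) \<longrightarrow> \<phi> 0 z (s z) \<le> \<phi> 0 z p)) \<and>
    (\<forall>j. (\<lambda>z. \<phi> j z (s z)) \<in> borel_measurable N)"
proof -
  define A where "A z = rec_nat {p \<in> S. \<forall>j. \<psi> j z p = 0}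
      (\<lambda>j B. {p \<in> B. \<forall>q\<in>B. \<phi> j z p \<le> \<phi> j z q})" for z
  have A0: "A z 0 = {p \<in> S. \<forall>j. \<psi> j z p = 0}"
    and AS: "A z (Suc j) = {p \<in> A z j. \<forall>q\<in>A z j. \<phi> j z p \<le> \<phi> j z q}" for z j
    by (simp_all add: A_def)
  \<comment> \<open>\<open>S\<close> carries no topology; convergence of all the functionals at
    \<open>z\<close> stands in for it.\<close>
  define conv where "conv z u p \<longleftrightarrow> (\<forall>j. (\<lambda>n::nat. \<phi> j z (u n)) \<longlonglongrightarrow> \<phi> j z p) \<and>
      (\<forall>j. (\<lambda>n. \<psi> j z (u n)) \<longlonglongrightarrow> \<psi> j z p)" for z u p
  have cpt: "\<exists>r p. strict_mono (r :: nat \<Rightarrow> nat) \<and> p \<in> S \<and> conv z (\<lambda>n. u (r n)) p"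
    if "z \<in> space N" "\<And>n. u n \<in> S" for z u
    using compact[OF that] by (simp add: conv_def)
  have AsubS: "A z j \<subseteq> S" for z j
    by (induction j) (auto simp: A0 AS)
  have closed: "p \<in> A z j" if "\<And>n. u n \<in> A z j" "p \<in> S" "conv z u p" for z j u p
    using that
  proof (induction j)
    case 0
    have "\<psi> i z p = 0" for i
      using 0 LIMSEQ_unique[of "\<lambda>n. \<psi> i z (u n)" "\<psi> i z p" 0] by (auto simp: conv_def A0)
    then show ?case using 0 by (simp add: A0)
  next
    case (Suc j)
    have "p \<in> A z j" using Suc by (auto simp: AS)
    moreover have "\<phi> j z p \<le> \<phi> j z q" if "q \<in> A z j" for q
    proof (rule LIMSEQ_le_const2)
      show "(\<lambda>n. \<phi> j z (u n)) \<longlonglongrightarrow> \<phi> j z p" using Suc by (simp add: conv_def)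
      show "\<exists>N. \<forall>n\<ge>N. \<phi> j z (u n) \<le> \<phi> j z q" using Suc.prems(1) that by (auto simp: AS)
    qed
    ultimately show ?case by (simp add: AS)
  qed
  have nonempty: "A z j \<noteq> {}" if z: "z \<in> space N" for z j
  proof (induction j)
    case 0
    then show ?case using feasible[OF z] by (auto simp: A0)
  next
    case (Suc j)
    \<comment> \<open>Boundedness below comes from compactness: values tending to minus infinity
      would contradict their convergence along a subsequence.\<close>
    have bdd: "bdd_below (\<phi> j z ` A z j)"
    proof (rule ccontr)
      assume "\<not> bdd_below (\<phi> j z ` A z j)"
      then have "\<forall>n::nat. \<exists>p\<in>A z j. \<phi> j z p < - real n"
        unfolding bdd_below_def by (metis imageE linorder_not_le)
      then obtain u where u: "\<And>n. u n \<in> A z j" "\<And>n. \<phi> j z (u n) < - real n" by metis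
      then obtain r p where r: "strict_mono r" "conv z (\<lambda>n. u (r n)) p"
        using cpt[OF z, of u] AsubS by blast
      have "\<phi> j z (u (r n)) \<le> - real n" for n
        using u(2)[of "r n"] seq_suble[OF r(1), of n] by (smt (verit) of_nat_le_iff)
      moreover have "(\<lambda>n. \<phi> j z (u (r n))) \<longlonglongrightarrow> \<phi> j z p" using r(2) by (simp add: conv_def)
      then have "eventually (\<lambda>n. \<phi> j z p - 1 < \<phi> j z (u (r n))) sequentially"
        by (rule order_tendstoD) simp
      then obtain M where M: "\<And>n. n \<ge> M \<Longrightarrow> \<phi> j z p - 1 < \<phi> j z (u (r n))"
        by (auto simp: eventually_sequentially)
      obtain n where n: "real n > \<bar>\<phi> j z p - 1\<bar>" using reals_Archimedean2 by blast
      then have "real (max M n) > \<bar>\<phi> j z p - 1\<bar>" by simp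
      ultimately show False
        using M[of "max M n"] by (smt (verit) max.cobounded1)
    qed
    let ?m = "INF p\<in>A z j. \<phi> j z p"
    have "\<exists>p\<in>A z j. \<phi> j z p < ?m + inverse (Suc n)" for n
      using cINF_less_iff[OF Suc bdd, of "?m + inverse (Suc n)"] by simp
    then obtain u where u: "\<And>n. u n \<in> A z j" "\<And>n. \<phi> j z (u n) < ?m + inverse (Suc n)" by metis
    then obtain r p where r: "strict_mono r" "p \<in> S" "conv z (\<lambda>n. u (r n)) p"
      using cpt[OF z, of u] AsubS by blast
    have p: "p \<in> A z j" using closed[of "\<lambda>n. u (r n)"] u r by blast
    have "\<phi> j z p \<le> ?m + 0"
    proof (rule LIMSEQ_le)
      show "(\<lambda>n. \<phi> j z (u (r n))) \<longlonglongrightarrow> \<phi> j z p" using r(3) by (simp add: conv_def)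
      show "(\<lambda>n. ?m + inverse (Suc (r n))) \<longlonglongrightarrow> ?m + 0"
        using LIMSEQ_subseq_LIMSEQ[OF LIMSEQ_inverse_real_of_nat r(1)]
        by (intro tendsto_add tendsto_const) (simp add: comp_def)
      show "\<exists>N. \<forall>n\<ge>N. \<phi> j z (u (r n)) \<le> ?m + inverse (Suc (r n))"
        using u(2) by (meson less_imp_le)
    qed
    then have "\<phi> j z p \<le> \<phi> j z q" if "q \<in> A z j" for q
      using cINF_lower[OF bdd that] by simp
    then show ?case using p by (auto simp: AS)
  qed
  \<comment> \<open>All survivors of stage \<open>Suc j\<close> share this value, so the choice is
    immaterial.\<close>
  define m where "m j z = \<phi> j z (SOME p. p \<in> A z (Suc j))" for j z
  have m: "\<phi> j z p = m j z" if "p \<in> A z (Suc j)" for p j z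
  proof -
    have "(SOME p. p \<in> A z (Suc j)) \<in> A z (Suc j)" using that by (rule someI)
    then show ?thesis using that unfolding m_def AS by (intro antisym) auto
  qed
  have mle: "m j z \<le> \<phi> j z p" if p: "p \<in> A z j" and z: "z \<in> space N" for j z p
  proof -
    obtain q where q: "q \<in> A z (Suc j)" using nonempty[OF z] by blast
    then show ?thesis using m[OF q] p by (auto simp: AS)
  qed
  have char: "p \<in> A z j \<longleftrightarrow> p \<in> S \<and> (\<forall>i. \<psi> i z p = 0) \<and> (\<forall>i<j. \<phi> i z p = m i z)"
    if z: "z \<in> space N" for z j p
  proof (induction j)
    case (Suc j)
    have "p \<in> A z (Suc j) \<longleftrightarrow> p \<in> A z j \<and> \<phi> j z p = m j z"
    proof
      assume p: "p \<in> A z (Suc j)"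
      then have "p \<in> A z j" by (simp add: AS)
      with m[OF p] show "p \<in> A z j \<and> \<phi> j z p = m j z" by simp
    next
      assume "p \<in> A z j \<and> \<phi> j z p = m j z"
      then show "p \<in> A z (Suc j)" using mle[OF _ z] by (simp add: AS)
    qed
    then show ?case using Suc by (auto simp: less_Suc_eq)
  qed (simp add: A0)
  \<comment> \<open>There are infinitely many constraints \<open>\<psi> i\<close>. The number
    \<open>n\<close> limits how many are tested, and the tolerance \<open>inverse (Suc n)\<close>
    shrinks as it grows, so that all of them hold in the limit.\<close>
  define err where "err j a n z d = (\<Sum>i\<le>n. \<bar>\<psi> i z d\<bar>) + (\<Sum>i<j. \<bar>\<phi> i z d - m i z\<bar>) + max 0 (\<phi> j z d - a)"
    for j a n z d
  have le_iff: "m j z \<le> a \<longleftrightarrow> (\<forall>n. \<exists>d\<in>D. err j a n z d < inverse (Suc n))" if z: "z \<in> space N" for j a z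
  proof
    assume ma: "m j z \<le> a"
    obtain p where p: "p \<in> A z (Suc j)" using nonempty[OF z] by blast
    then have p': "p \<in> S" "\<And>i. \<psi> i z p = 0" "\<And>i. i \<le> j \<Longrightarrow> \<phi> i z p = m i z"
      using char[OF z] by auto
    obtain d where d: "\<And>n. d n \<in> D" "conv z d p" using dense[OF z p'(1)] by (auto simp: conv_def)
    show "\<forall>n. \<exists>d\<in>D. err j a n z d < inverse (Suc n)"
    proof
      fix n
      have "(\<lambda>k. err j a n z (d k)) \<longlonglongrightarrow> err j a n z p"
        unfolding err_def using d(2) unfolding conv_def
        by (intro tendsto_add tendsto_sum tendsto_rabs tendsto_diff tendsto_const tendsto_max) simp_all
      moreover have "err j a n z p = 0" using p' ma by (simp add: err_def)
      ultimately have "eventually (\<lambda>k. err j a n z (d k) < inverse (Suc n)) sequentially"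
        by (intro order_tendstoD) auto
      then show "\<exists>d\<in>D. err j a n z d < inverse (Suc n)"
        using d(1) by (auto simp: eventually_sequentially)
    qed
  next
    assume "\<forall>n. \<exists>d\<in>D. err j a n z d < inverse (Suc n)"
    then obtain d where d: "\<And>n. d n \<in> D" "\<And>n. err j a n z (d n) < inverse (Suc n)" by metis
    obtain r p where r: "strict_mono r" "p \<in> S" "conv z (\<lambda>n. d (r n)) p"
      using cpt[OF z, of d] d(1) D(2) by blast
    have lim0: "(\<lambda>n. inverse (real (Suc (r n)))) \<longlonglongrightarrow> 0"
      using LIMSEQ_subseq_LIMSEQ[OF LIMSEQ_inverse_real_of_nat r(1)] by (simp add: comp_def)
    \<comment> \<open>A constraint is visible in \<open>err\<close> only from some index
      \<open>k\<close> on; from there its error stays below the tolerance, which tends to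
      zero.\<close>
    have zero: "f p = 0" if "(\<lambda>n. f (d (r n))) \<longlonglongrightarrow> f p"
      "\<And>n. n \<ge> k \<Longrightarrow> \<bar>f (d (r n))\<bar> \<le> err j a (r n) z (d (r n))" for f :: "'p \<Rightarrow> real" and k
    proof -
      have "(\<lambda>n. f (d (r n))) \<longlonglongrightarrow> 0"
      proof (rule Lim_null_comparison[OF _ lim0])
        show "\<forall>\<^sub>F n in sequentially. norm (f (d (r n))) \<le> inverse (real (Suc (r n)))"
          using that(2) d(2) unfolding eventually_sequentially real_norm_def
          by (intro exI[of _ k]) (meson le_less_trans less_imp_le)
      qed
      then show ?thesis using that(1) LIMSEQ_unique by blast
    qed
    have nn: "0 \<le> (\<Sum>i\<le>n. \<bar>\<psi> i z d\<bar>)" "0 \<le> (\<Sum>i<j. \<bar>\<phi> i z d - m i z\<bar>)" for n d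
      by (auto intro: sum_nonneg)
    have "\<psi> i z p = 0" for i
    proof (rule zero[where k = i])
      show "(\<lambda>n. \<psi> i z (d (r n))) \<longlonglongrightarrow> \<psi> i z p" using r(3) by (simp add: conv_def)
      fix n assume "n \<ge> i"
      then have "i \<le> r n" using seq_suble[OF r(1), of n] by simp
      then have "\<bar>\<psi> i z (d (r n))\<bar> \<le> (\<Sum>i\<le>r n. \<bar>\<psi> i z (d (r n))\<bar>)"
        by (intro member_le_sum) auto
      then show "\<bar>\<psi> i z (d (r n))\<bar> \<le> err j a (r n) z (d (r n))"
        using nn(2)[of "d (r n)"] unfolding err_def by linarith
    qed
    moreover have "\<phi> i z p - m i z = 0" if "i < j" for i
    proof (rule zero[where k = 0 and f = "\<lambda>p. \<phi> i z p - m i z"])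
      show "(\<lambda>n. \<phi> i z (d (r n)) - m i z) \<longlonglongrightarrow> \<phi> i z p - m i z"
        using r(3) by (intro tendsto_diff tendsto_const) (simp add: conv_def)
      fix n
      have "\<bar>\<phi> i z (d (r n)) - m i z\<bar> \<le> (\<Sum>i<j. \<bar>\<phi> i z (d (r n)) - m i z\<bar>)"
        using that by (intro member_le_sum) auto
      then show "\<bar>\<phi> i z (d (r n)) - m i z\<bar> \<le> err j a (r n) z (d (r n))"
        using nn(1)[of "d (r n)" "r n"] unfolding err_def by linarith
    qed
    ultimately have "p \<in> A z j" using char[OF z] r(2) by simp
    moreover have "max 0 (\<phi> j z p - a) = 0"
    proof (rule zero[where k = 0 and f = "\<lambda>p. max 0 (\<phi> j z p - a)"])
      show "(\<lambda>n. max 0 (\<phi> j z (d (r n)) - a)) \<longlonglongrightarrow> max 0 (\<phi> j z p - a)"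
        using r(3) by (intro tendsto_max tendsto_diff tendsto_const) (simp add: conv_def)
      fix n show "\<bar>max 0 (\<phi> j z (d (r n)) - a)\<bar> \<le> err j a (r n) z (d (r n))"
        using nn(1)[of "d (r n)" "r n"] nn(2)[of "d (r n)"] unfolding err_def by linarith
    qed
    ultimately show "m j z \<le> a" using mle[OF _ z, of p j] by (simp add: max_def split: if_splits)
  qed
  have m_meas: "m j \<in> borel_measurable N" for j
  \<comment> \<open>\<open>err j\<close> contains the earlier minima \<open>m i\<close> with
    \<open>i < j\<close>, whose measurability is the induction hypothesis.\<close>
  proof (induction j rule: less_induct)
    case (less j)
    have e: "(\<lambda>z. err j a n z d) \<in> borel_measurable N" if "d \<in> D" for a n d
      unfolding err_def using that less
      by (intro borel_measurable_add borel_measurable_sum borel_measurable_abs borel_measurable_diff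
          borel_measurable_max meas borel_measurable_const) auto
    have "Measurable.pred N (\<lambda>z. m j z \<le> a)" for a
    proof -
      have "Measurable.pred N (\<lambda>z. \<forall>n. \<exists>d\<in>D. err j a n z d < inverse (Suc n))"
        by (intro pred_intros_countable(1) measurable_pred_countable(2)[OF D(1)]
            borel_measurable_pred_less e borel_measurable_const)
      then show ?thesis by (rule measurable_cong[THEN iffD2, rotated]) (rule le_iff)
    qed
    then show ?case by (simp add: borel_measurable_iff_le pred_def)
  qed
  have "\<exists>p. \<forall>j. p \<in> A z j" if z: "z \<in> space N" for z
  proof -
    have "\<forall>j. \<exists>p. p \<in> A z j" using nonempty[OF z] by blast
    then obtain u where u: "\<And>j. u j \<in> A z j" by metis
    obtain r p where r: "strict_mono r" "p \<in> S" "conv z (\<lambda>n. u (r n)) p"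
      using cpt[OF z, of u] u AsubS by blast
    have "p \<in> A z j" for j
    \<comment> \<open>Cantor's intersection argument. The shift by \<open>j\<close> is needed
      because only members with index at least \<open>j\<close> are known to lie in
      \<open>A z j\<close>.\<close>
    proof (rule closed[where u = "\<lambda>n. u (r (n + j))", OF _ r(2)])
      have dec: "A z i \<subseteq> A z j" if "j \<le> i" for i j
        using char[OF z] that by auto
      show "u (r (n + j)) \<in> A z j" for n
        using u[of "r (n + j)"] dec[of j "r (n + j)"] seq_suble[OF r(1), of "n + j"] by auto
      show "conv z (\<lambda>n. u (r (n + j))) p"
        using r(3) unfolding conv_def
        by (auto intro: LIMSEQ_ignore_initial_segment[of "\<lambda>n. \<phi> i z (u (r n))" for i]
            LIMSEQ_ignore_initial_segment[of "\<lambda>n. \<psi> i z (u (r n))" for i])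
    qed
    then show ?thesis by blast
  qed
  \<comment> \<open>The selection is made point by point without regard to measurability. What is
    measurable are the values of the functionals at it, since they equal the minima
    \<open>m j\<close>.\<close>
  then obtain s where s: "\<And>z j. z \<in> space N \<Longrightarrow> s z \<in> A z j" by metis
  have eq: "\<phi> j z (s z) = m j z" if "z \<in> space N" for j z
    using m[OF s[OF that]] .
  have "(\<lambda>z. \<phi> j z (s z)) \<in> borel_measurable N" for j
    using m_meas[of j] measurable_cong[of N "\<lambda>z. \<phi> j z (s z)" "m j" borel] eq by simp
  moreover have "s z \<in> S \<and> (\<forall>j. \<psi> j z (s z) = 0) \<and>
      (\<forall>p\<in>S. (\<forall>j. \<psi> j z p = 0) \<longrightarrow> \<phi> 0 z (s z) \<le> \<phi> 0 z p)" if "z \<in> space N" for z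
    using s[OF that, of 0] s[OF that, of "Suc 0"] by (auto simp: A0 AS)
  ultimately show ?thesis by blast
qed

section \<open>Kernel integrals, domination of couplings and the optimal kernel\<close>

lemma prob_algebra_cong: "sets M = sets N \<Longrightarrow> prob_algebra M = prob_algebra N"
  unfolding prob_algebra_def using subprob_algebra_cong[of M N] by simp

text \<open>The integral is that of one fixed function over the image of \<open>L x\<close> under
  \<open>Pair x\<close>, so that measurability of integration as a function of the measure
  applies.\<close>

lemma integral_kernel_measurable:
  fixes f :: "'a \<Rightarrow> 'b \<Rightarrow> real"
  assumes f: "(\<lambda>(x, y). f x y) \<in> borel_measurable (M \<Otimes>\<^sub>M N)"
    and L: "L \<in> M \<rightarrow>\<^sub>M prob_algebra N"
  shows "(\<lambda>x. \<integral>y. f x y \<partial>L x) \<in> borel_measurable M"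
proof -
  have L'[measurable]: "L \<in> M \<rightarrow>\<^sub>M subprob_algebra N" by (rule measurable_prob_algebraD[OF L])
  have "(\<lambda>x. \<integral>p. case_prod f p \<partial>distr (L x) (M \<Otimes>\<^sub>M N) (Pair x)) \<in> borel_measurable M"
    by (rule measurable_compose[OF measurable_distr2[OF _ L'] integral_measurable_subprob_algebra[OF f]]) simp
  moreover have "(\<integral>p. case_prod f p \<partial>distr (L x) (M \<Otimes>\<^sub>M N) (Pair x)) = (\<integral>y. f x y \<partial>L x)"
    if x: "x \<in> space M" for x
  proof -
    have "sets (L x) = sets N" using sets_kernel[OF L' x] .
    then have "Pair x \<in> L x \<rightarrow>\<^sub>M M \<Otimes>\<^sub>M N" using x by (simp cong: measurable_cong_sets)
    then show ?thesis using f by (subst integral_distr) auto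
  qed
  ultimately show ?thesis by (simp cong: measurable_cong)
qed

lemma sets_borel_of_discrete: "sets (borel_of (discrete_topology X)) = Pow X"
proof -
  have "sigma_sets X (Pow X) = Pow X"
    using sigma_algebra.sigma_sets_eq[OF sigma_algebra_Pow] .
  moreover have "{U. U \<subseteq> X} = Pow X" by auto
  ultimately show ?thesis by (simp add: sets_borel_of)
qed

lemma couplingsD:
  assumes "\<gamma> \<in> couplings S S' \<alpha> \<beta>"
  shows "prob_space \<gamma>" "sets \<gamma> = sets (borel_of (prod_topology S S'))"
    "space \<gamma> = topspace S \<times> topspace S'"
    "distr \<gamma> (borel_of S) fst = \<alpha>" "distr \<gamma> (borel_of S') snd = \<beta>"
  using assms prob_measuresD[of \<gamma> "prod_topology S S'"] by (auto simp: couplings_def)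

lemma measurable_fst_snd_borel_of:
  "fst \<in> borel_of (prod_topology S S') \<rightarrow>\<^sub>M borel_of S" "snd \<in> borel_of (prod_topology S S') \<rightarrow>\<^sub>M borel_of S'"
  by (auto intro!: continuous_map_borel_of continuous_map_fst continuous_map_snd)

text \<open>Here the finiteness of the first space enters; the domination makes the set of couplings compact
  for setwise convergence.\<close>

lemma coupling_le_uniform_pair:
  assumes X: "finite X" "X \<noteq> {}" and S': "second_countable S'"
    and \<gamma>: "\<gamma> \<in> couplings (discrete_topology X) S' \<alpha> \<beta>" and \<beta>: "\<beta> \<in> prob_measures S'"
    and A: "A \<in> sets (uniform_count_measure X \<Otimes>\<^sub>M \<beta>)"
  shows "emeasure \<gamma> A \<le> ennreal (card X) * emeasure (uniform_count_measure X \<Otimes>\<^sub>M \<beta>) A"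
proof -
  let ?S = "discrete_topology X"
  let ?u = "uniform_count_measure X"
  interpret \<beta>: prob_space \<beta> by (rule prob_measuresD[OF \<beta>])
  note s\<beta> = prob_measuresD(2,3)[OF \<beta>]
  note c\<gamma> = couplingsD[OF \<gamma>]
  interpret \<gamma>: prob_space \<gamma> by (rule c\<gamma>)
  have scS: "second_countable ?S" using X by (simp add: second_countable_discrete_topology countable_finite)
  have setsU: "sets (?u \<Otimes>\<^sub>M \<beta>) = sets (borel_of (prod_topology ?S S'))"
    unfolding sets_borel_of_prod[OF scS S']
    by (rule sets_pair_measure_cong) (simp_all add: sets_uniform_count_measure sets_borel_of_discrete s\<beta>)
  have Ax: "Pair x -` A \<in> sets \<beta>" for x using A by (rule sets_Pair1)
  have rect: "{x} \<times> (Pair x -` A) \<in> sets \<gamma>" if "x \<in> X" for x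
    unfolding c\<gamma>(2) setsU[symmetric] using Ax that by (intro pair_measureI) (auto simp: sets_uniform_count_measure)
  have sub: "A \<subseteq> X \<times> topspace S'"
    using sets.sets_into_space[OF A] by (simp add: space_pair_measure space_uniform_count_measure s\<beta>)
  have "A = (\<Union>x\<in>X. {x} \<times> (Pair x -` A))" using sub by auto
  then have "emeasure \<gamma> A \<le> (\<Sum>x\<in>X. emeasure \<gamma> ({x} \<times> (Pair x -` A)))"
    using emeasure_subadditive_finite[OF X(1), of "\<lambda>x. {x} \<times> (Pair x -` A)" \<gamma>] rect by auto
  \<comment> \<open>Forgetting the first coordinate enlarges the fibre to a cylinder, whose mass is
    given by the second marginal.\<close>
  also have "\<dots> \<le> (\<Sum>x\<in>X. emeasure \<beta> (Pair x -` A))"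
  proof (rule sum_mono)
    fix x assume x: "x \<in> X"
    have m: "snd \<in> \<gamma> \<rightarrow>\<^sub>M borel_of S'"
      using measurable_fst_snd_borel_of(2)[of ?S S'] measurable_cong_sets[OF c\<gamma>(2) refl] by blast
    have "emeasure \<gamma> ({x} \<times> (Pair x -` A)) \<le> emeasure \<gamma> (snd -` (Pair x -` A) \<inter> space \<gamma>)"
      using x sub Ax s\<beta> by (intro emeasure_mono measurable_sets[OF m]) (auto simp: c\<gamma>(3))
    also have "\<dots> = emeasure \<beta> (Pair x -` A)"
      using Ax s\<beta> m by (subst c\<gamma>(5)[symmetric]) (simp add: emeasure_distr)
    finally show "emeasure \<gamma> ({x} \<times> (Pair x -` A)) \<le> emeasure \<beta> (Pair x -` A)" .
  qed
  \<comment> \<open>\<open>card X\<close> cancels the weight \<open>1 / card X\<close> that the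
    uniform distribution gives to each fibre.\<close>
  also have "\<dots> = ennreal (card X) * (\<Sum>x\<in>X. ennreal (1 / card X) * emeasure \<beta> (Pair x -` A))"
  proof -
    have "ennreal (card X) * ennreal (1 / card X) = 1"
      using X by (simp add: ennreal_mult[symmetric])
    then show ?thesis by (simp add: sum_distrib_left mult.assoc[symmetric])
  qed
  also have "(\<Sum>x\<in>X. ennreal (1 / card X) * emeasure \<beta> (Pair x -` A)) = emeasure (?u \<Otimes>\<^sub>M \<beta>) A"
    using A X by (subst \<beta>.emeasure_pair_measure_alt)
      (simp_all add: uniform_count_measure_def nn_integral_point_measure_finite)
  finally show ?thesis .
qed

lemma tendsto_integral_mult_density:
  assumes U: "finite_measure U" and f: "f \<in> borel_measurable U" "\<And>x. x \<in> space U \<Longrightarrow> \<bar>f x\<bar> \<le> (B::real)"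
    and d: "\<And>n. d n \<in> bounded_densities U C" "p \<in> bounded_densities U C"
    and lim: "(\<lambda>n::nat. \<integral>x. \<bar>d n x - p x\<bar> \<partial>U) \<longlonglongrightarrow> 0"
  shows "(\<lambda>n. \<integral>x. f x * d n x \<partial>U) \<longlonglongrightarrow> (\<integral>x. f x * p x \<partial>U)"
proof -
  interpret finite_measure U by fact
  have int: "integrable U f" using f by (intro integrable_const_bound[of _ B] AE_I2) auto
  have id: "integrable U q" if "q \<in> bounded_densities U C" for q
    using that by (intro integrable_const_bound[of _ C] AE_I2) (auto simp: bounded_densities_def)
  have le: "norm ((\<integral>x. f x * d n x \<partial>U) - (\<integral>x. f x * p x \<partial>U)) \<le> B * (\<integral>x. \<bar>d n x - p x\<bar> \<partial>U)" for n
  proof -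
    note i = integrable_mult_bounded_density(1)[OF int]
    have "(\<integral>x. f x * d n x \<partial>U) - (\<integral>x. f x * p x \<partial>U) = (\<integral>x. f x * d n x - f x * p x \<partial>U)"
      using i[OF d(1)] i[OF d(2)] by simp
    also have "norm \<dots> \<le> (\<integral>x. \<bar>f x * d n x - f x * p x\<bar> \<partial>U)"
      unfolding real_norm_def by (rule integral_abs_bound)
    also have "\<dots> \<le> (\<integral>x. B * \<bar>d n x - p x\<bar> \<partial>U)"
    proof (rule integral_mono)
      show "\<bar>f x * d n x - f x * p x\<bar> \<le> B * \<bar>d n x - p x\<bar>" if "x \<in> space U" for x
        using mult_right_mono[OF f(2)[OF that], of "\<bar>d n x - p x\<bar>"]
        by (simp add: right_diff_distrib[symmetric] abs_mult)
    qed (use i[OF d(1)] i[OF d(2)] id[OF d(1)] id[OF d(2)] in auto)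
    finally show ?thesis by simp
  qed
  have "(\<lambda>n. B * (\<integral>x. \<bar>d n x - p x\<bar> \<partial>U)) \<longlonglongrightarrow> 0"
    by (rule tendsto_mult_right_zero[OF lim])
  from Lim_null_comparison[OF always_eventually[OF allI[OF le]] this]
  show ?thesis by (rule LIM_zero_cancel)
qed

text \<open>The lexicographic selection with densities as points. Expressed by densities with
  respect to \<open>U z\<close>, the couplings at \<open>z\<close> become the common zeros of the
  \<open>\<psi> j\<close> in a set that is the same for all \<open>z\<close>. Integrals of the Borel
  functions \<open>F z\<close> and \<open>g\<close> converge along the compactness of densities, and
  continuity of \<open>H z\<close> then carries the nonlinear term.\<close>

theorem optimal_coupling_kernel:
  fixes F :: "'z \<Rightarrow> 'a \<times> 'b \<Rightarrow> real" and H :: "'z \<Rightarrow> real \<Rightarrow> real"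
  assumes S: "S = discrete_topology X" "finite X" "X \<noteq> {}" and S': "second_countable S'"
    and \<alpha>: "\<alpha> \<in> N \<rightarrow>\<^sub>M prob_algebra (borel_of S)" and \<beta>: "\<beta> \<in> N \<rightarrow>\<^sub>M prob_algebra (borel_of S')"
    and F: "(\<lambda>(z, w). F z w) \<in> borel_measurable (N \<Otimes>\<^sub>M borel_of (prod_topology S S'))"
      "\<And>z w. z \<in> space N \<Longrightarrow> w \<in> topspace (prod_topology S S') \<Longrightarrow> \<bar>F z w\<bar> \<le> B"
    and g: "g \<in> borel_measurable (borel_of (prod_topology S S'))"
      "\<And>w. w \<in> topspace (prod_topology S S') \<Longrightarrow> \<bar>g w\<bar> \<le> B'"
    and H: "(\<lambda>(z, r). H z r) \<in> borel_measurable (N \<Otimes>\<^sub>M borel)"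
      "\<And>z. z \<in> space N \<Longrightarrow> continuous_on UNIV (H z)"
  obtains \<kappa> where "\<kappa> \<in> N \<rightarrow>\<^sub>M prob_algebra (borel_of (prod_topology S S'))"
    "\<And>z. z \<in> space N \<Longrightarrow> \<kappa> z \<in> couplings S S' (\<alpha> z) (\<beta> z)"
    "\<And>z \<gamma>. z \<in> space N \<Longrightarrow> \<gamma> \<in> couplings S S' (\<alpha> z) (\<beta> z) \<Longrightarrow>
      (\<integral>w. F z w \<partial>\<kappa> z) + H z (\<integral>w. g w \<partial>\<kappa> z) \<le> (\<integral>w. F z w \<partial>\<gamma>) + H z (\<integral>w. g w \<partial>\<gamma>)"
proof -
  define P where "P = borel_of (prod_topology S S')"
  define C where "C = real (card X)"
  have C: "0 \<le> C" by (simp add: C_def)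
  have scS: "second_countable S" using S by (simp add: second_countable_discrete_topology countable_finite)
  have spP: "space P = topspace (prod_topology S S')" by (simp add: P_def)
  obtain \<E> where \<E>: "countable \<E>" "Int_stable \<E>" "\<And>E. E \<in> \<E> \<Longrightarrow> openin (prod_topology S S') E"
    "topspace (prod_topology S S') \<in> \<E>" "sets P = sigma_sets (topspace (prod_topology S S')) \<E>"
    unfolding P_def by (rule borel_of_countable_Int_stable_generator[OF second_countable_prod_topology[OF scS S']]) blast
  have \<E>_sub: "\<E> \<subseteq> Pow (space P)" unfolding spP using \<E>(3) openin_subset by blast
  have \<E>_top: "space P \<in> \<E>" "sets P = sigma_sets (space P) \<E>" using \<E>(4,5) by (simp_all add: spP)
  obtain \<E>1 where \<E>1: "countable \<E>1" "Int_stable \<E>1" "\<And>E. E \<in> \<E>1 \<Longrightarrow> openin S E"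
    "topspace S \<in> \<E>1" "sets (borel_of S) = sigma_sets (topspace S) \<E>1"
    by (rule borel_of_countable_Int_stable_generator[OF scS]) blast
  obtain \<E>2 where \<E>2: "countable \<E>2" "Int_stable \<E>2" "\<And>E. E \<in> \<E>2 \<Longrightarrow> openin S' E"
    "topspace S' \<in> \<E>2" "sets (borel_of S') = sigma_sets (topspace S') \<E>2"
    by (rule borel_of_countable_Int_stable_generator[OF S']) blast
  have E12_sub: "\<E>1 \<subseteq> Pow (topspace S)" "\<E>2 \<subseteq> Pow (topspace S')"
    using openin_subset[OF \<E>1(3)] openin_subset[OF \<E>2(3)] by blast+
  define e where "e = from_nat_into \<E>"
  define e1 where "e1 = from_nat_into \<E>1"
  define e2 where "e2 = from_nat_into \<E>2"
  have ne: "\<E> \<noteq> {}" "\<E>1 \<noteq> {}" "\<E>2 \<noteq> {}" using \<E>(4) \<E>1(4) \<E>2(4) by auto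
  have eP: "e j \<in> sets P" and e1S: "e1 j \<in> sets (borel_of S)" and e2S: "e2 j \<in> sets (borel_of S')" for j
    using from_nat_into[OF ne(1)] from_nat_into[OF ne(2)] from_nat_into[OF ne(3)] \<E>(3) \<E>1(3) \<E>2(3)
    by (auto simp: e_def e1_def e2_def P_def intro!: openin_borel_of)
  note [measurable] = eP e1S e2S
  have fstP[measurable]: "fst \<in> P \<rightarrow>\<^sub>M borel_of S" and sndP[measurable]: "snd \<in> P \<rightarrow>\<^sub>M borel_of S'"
    unfolding P_def by (rule measurable_fst_snd_borel_of)+
  have ind1: "(\<lambda>w. indicator (e1 j) (fst w) :: real) \<in> borel_measurable P"
    and ind2: "(\<lambda>w. indicator (e2 j) (snd w) :: real) \<in> borel_measurable P" for j
    by (rule measurable_compose[OF fstP borel_measurable_indicator[OF e1S]]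
        measurable_compose[OF sndP borel_measurable_indicator[OF e2S]])+
  define U where "U z = uniform_count_measure X \<Otimes>\<^sub>M \<beta> z" for z
  have \<beta>P: "\<beta> z \<in> prob_measures S'" and \<alpha>P: "\<alpha> z \<in> prob_measures S" if "z \<in> space N" for z
    using measurable_space[OF \<beta> that] measurable_space[OF \<alpha> that] by (auto simp: prob_measures_eq_space_prob_algebra)
  have psu: "prob_space (uniform_count_measure X)" by (rule prob_space_uniform_count_measure) (use S in auto)
  have U_meas: "U \<in> N \<rightarrow>\<^sub>M prob_algebra P"
  proof -
    have "(\<lambda>z. uniform_count_measure X) \<in> N \<rightarrow>\<^sub>M prob_algebra (borel_of S)"
      using psu by (intro measurable_const) (simp add: space_prob_algebra S(1) sets_borel_of_discrete sets_uniform_count_measure)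
    then have "U \<in> N \<rightarrow>\<^sub>M prob_algebra (borel_of S \<Otimes>\<^sub>M borel_of S')"
      unfolding U_def[abs_def] using \<beta> by (rule measurable_pair_prob)
    then show ?thesis
      by (simp add: P_def prob_algebra_cong[OF sets_borel_of_prod[OF scS S']])
  qed
  have U: "prob_space (U z)" "sets (U z) = sets P" "space (U z) = topspace (prod_topology S S')" "finite_measure (U z)"
    if "z \<in> space N" for z
    using measurable_space[OF U_meas that] spP
    by (auto simp: space_prob_algebra prob_space_def dest: sets_eq_imp_space_eq)
  have bd: "bounded_densities (U z) C = bounded_densities P C" if "z \<in> space N" for z
    unfolding bounded_densities_def using measurable_cong_sets[OF U(2)[OF that] refl] by auto
  obtain D where D: "countable D" "D \<subseteq> bounded_densities P C"
    "\<And>U p. finite_measure U \<Longrightarrow> sets U = sets P \<Longrightarrow> p \<in> bounded_densities P C \<Longrightarrow>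
      \<exists>d. (\<forall>n. d n \<in> D) \<and> (\<lambda>n::nat. \<integral>x. \<bar>d n x - p x\<bar> \<partial>U) \<longlonglongrightarrow> 0"
    by (rule countable_dense_bounded_densities[OF C \<E>(1,2) \<E>_sub \<E>_top]) blast
  define I where "I z f p = (\<integral>w. f w * p w \<partial>U z)" for z and f p :: "'a \<times> 'b \<Rightarrow> real"
  \<comment> \<open>Index \<open>0\<close> carries the objective. The masses of a countable
    generator follow so that the selected measure has measurable values there, which is enough for a
    measurable kernel.\<close>
  define \<phi> where "\<phi> j z p = (case j of 0 \<Rightarrow> I z (F z) p + H z (I z g p) | Suc j \<Rightarrow> I z (indicator (e j)) p)" for j z p
  \<comment> \<open>Both marginal conditions on the \<open>j\<close>-th generating sets are combined
    in one non-negative number that vanishes iff both hold.\<close>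
  define \<psi> where "\<psi> j z p = \<bar>I z (\<lambda>w. indicator (e1 j) (fst w)) p - measure (\<alpha> z) (e1 j)\<bar>
      + \<bar>I z (\<lambda>w. indicator (e2 j) (snd w)) p - measure (\<beta> z) (e2 j)\<bar>" for j z p
  have Fz: "F z \<in> borel_measurable P" if "z \<in> space N" for z
    using measurable_compose[OF measurable_Pair1'[OF that] F(1)] by (simp add: P_def)
  have gP: "g \<in> borel_measurable P" using g(1) by (simp add: P_def)
  have conv: "(\<forall>j. (\<lambda>n. \<phi> j z (u n)) \<longlonglongrightarrow> \<phi> j z p) \<and> (\<forall>j. (\<lambda>n. \<psi> j z (u n)) \<longlonglongrightarrow> \<psi> j z p)"
    if z: "z \<in> space N"
      and lim: "\<And>f B. f \<in> borel_measurable P \<Longrightarrow> (\<And>w. w \<in> space P \<Longrightarrow> \<bar>f w\<bar> \<le> (B::real)) \<Longrightarrow> (\<lambda>n::nat. I z f (u n)) \<longlonglongrightarrow> I z f p"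
    for z u p
  proof (intro conjI allI)
    fix j
    show "(\<lambda>n. \<phi> j z (u n)) \<longlonglongrightarrow> \<phi> j z p"
    proof (cases j)
      case 0
      have "(\<lambda>n. I z (F z) (u n)) \<longlonglongrightarrow> I z (F z) p"
        by (rule lim[OF Fz[OF z], of B]) (use F(2)[OF z] spP in auto)
      moreover have "(\<lambda>n. I z g (u n)) \<longlonglongrightarrow> I z g p"
        by (rule lim[OF gP, of B']) (use g(2) spP in auto)
      then have "(\<lambda>n. H z (I z g (u n))) \<longlonglongrightarrow> H z (I z g p)"
        using H(2)[OF z] by (intro isCont_tendsto_compose[of _ "H z"]) (auto simp: continuous_on_eq_continuous_at)
      ultimately show ?thesis by (simp add: \<phi>_def 0 tendsto_add)
    next
      case (Suc i)
      have "(\<lambda>n. I z (indicator (e i)) (u n)) \<longlonglongrightarrow> I z (indicator (e i)) p"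
        by (rule lim[of _ 1]) (auto split: split_indicator)
      then show ?thesis by (simp add: \<phi>_def Suc)
    qed
    have "(\<lambda>n. I z (\<lambda>w. indicator (e1 j) (fst w)) (u n)) \<longlonglongrightarrow> I z (\<lambda>w. indicator (e1 j) (fst w)) p"
      by (rule lim[where B = 1, OF ind1]) (auto split: split_indicator)
    moreover have "(\<lambda>n. I z (\<lambda>w. indicator (e2 j) (snd w)) (u n)) \<longlonglongrightarrow> I z (\<lambda>w. indicator (e2 j) (snd w)) p"
      by (rule lim[where B = 1, OF ind2]) (auto split: split_indicator)
    ultimately show "(\<lambda>n. \<psi> j z (u n)) \<longlonglongrightarrow> \<psi> j z p"
      unfolding \<psi>_def by (intro tendsto_add tendsto_rabs tendsto_diff tendsto_const)
  qed
  have I_meas: "(\<lambda>z. I z (f z) d) \<in> borel_measurable N"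
    if f: "(\<lambda>(z, w). f z w) \<in> borel_measurable (N \<Otimes>\<^sub>M P)" and d: "d \<in> D" for f d
  proof -
    have [measurable]: "d \<in> borel_measurable P" using D(2) d by (auto simp: bounded_densities_def)
    have "(\<lambda>(z, w). f z w * d w) \<in> borel_measurable (N \<Otimes>\<^sub>M P)" using f by measurable
    then show ?thesis unfolding I_def by (rule integral_kernel_measurable[OF _ U_meas])
  qed
  have I_meas': "(\<lambda>z. I z f d) \<in> borel_measurable N" if f: "f \<in> borel_measurable P" and d: "d \<in> D" for f d
    by (rule I_meas[OF _ d]) (use f in measurable)
  have density_emeasure: "emeasure (density (U z) (\<lambda>w. ennreal (p w))) A = ennreal (I z (indicator A) p)"
    if z: "z \<in> space N" and p: "p \<in> bounded_densities P C" and A: "A \<in> sets P" for z p A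
  proof -
    interpret prob_space "U z" by (rule U[OF z])
    have p': "p \<in> bounded_densities (U z) C" using p bd[OF z] by simp
    have [measurable]: "p \<in> borel_measurable (U z)" and p0: "\<And>x. 0 \<le> p x" using p' by (auto simp: bounded_densities_def)
    have AU[measurable]: "A \<in> sets (U z)" using A U(2)[OF z] by simp
    have i: "integrable (U z) (indicator A :: _ \<Rightarrow> real)"
      using AU by (intro integrable_real_indicator) (auto simp: emeasure_eq_measure)
    have "emeasure (density (U z) (\<lambda>w. ennreal (p w))) A = (\<integral>\<^sup>+w. ennreal (p w) * indicator A w \<partial>U z)"
      using AU by (intro emeasure_density) measurable
    also have "\<dots> = (\<integral>\<^sup>+w. ennreal (indicator A w * p w) \<partial>U z)"
      by (intro nn_integral_cong) (auto split: split_indicator)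
    also have "\<dots> = ennreal (I z (indicator A) p)"
      unfolding I_def using p0 by (intro nn_integral_eq_integral integrable_mult_bounded_density(1)[OF i p'] AE_I2) auto
    finally show ?thesis .
  qed
  have I_density: "(\<integral>w. f w \<partial>density (U z) (\<lambda>w. ennreal (p w))) = I z f p"
    if z: "z \<in> space N" and p: "p \<in> bounded_densities P C" and f: "f \<in> borel_measurable P" for z p f
  proof -
    have "p \<in> bounded_densities (U z) C" using p bd[OF z] by simp
    moreover have "f \<in> borel_measurable (U z)" using f measurable_cong_sets[OF U(2)[OF z] refl] by blast
    ultimately show ?thesis
      unfolding I_def by (subst integral_density) (auto simp: bounded_densities_def mult.commute)
  qed
  have I_fst: "I z (\<lambda>w. indicator A (fst w)) p = I z (indicator (fst -` A \<inter> space P)) p"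
    and I_snd: "I z (\<lambda>w. indicator A' (snd w)) p = I z (indicator (snd -` A' \<inter> space P)) p"
    if "z \<in> space N" for z A A' p
    unfolding I_def using U(3)[OF that] spP
    by (auto intro!: Bochner_Integration.integral_cong split: split_indicator)
  have I_nonneg: "0 \<le> I z (indicator A) p" if "p \<in> bounded_densities P C" for z A p
    unfolding I_def using that by (intro integral_nonneg_AE AE_I2) (auto simp: bounded_densities_def)
  have coupling_density: "density (U z) (\<lambda>w. ennreal (p w)) \<in> couplings S S' (\<alpha> z) (\<beta> z)"
    if z: "z \<in> space N" and p: "p \<in> bounded_densities P C" and 0: "\<And>j. \<psi> j z p = 0" for z p
  proof -
    let ?\<gamma> = "density (U z) (\<lambda>w. ennreal (p w))"
    have sets: "sets ?\<gamma> = sets P" using U(2)[OF z] by simp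
    have sp: "space (U z) = space P" using U(2)[OF z] by (rule sets_eq_imp_space_eq)
    have f1: "fst \<in> ?\<gamma> \<rightarrow>\<^sub>M borel_of S" and f2: "snd \<in> ?\<gamma> \<rightarrow>\<^sub>M borel_of S'"
      using fstP sndP measurable_cong_sets[OF sets refl] by blast+
    have pa: "prob_space (\<alpha> z)" "sets (\<alpha> z) = sets (borel_of S)" and pb: "prob_space (\<beta> z)" "sets (\<beta> z) = sets (borel_of S')"
      using prob_measuresD[OF \<alpha>P[OF z]] prob_measuresD[OF \<beta>P[OF z]] by auto
    have m1: "emeasure (distr ?\<gamma> (borel_of S) fst) A = emeasure (\<alpha> z) A" if A: "A \<in> \<E>1" for A
    proof -
      obtain j where j: "A = e1 j" using A \<E>1(1) from_nat_into_surj unfolding e1_def by metis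
      have "I z (\<lambda>w. indicator (e1 j) (fst w)) p = measure (\<alpha> z) (e1 j)"
        using 0[of j] unfolding \<psi>_def by linarith
      then show ?thesis
        using measurable_sets[OF fstP e1S[of j]] pa(1)
        by (simp add: j emeasure_distr[OF f1 e1S] sp density_emeasure[OF z p] I_fst[OF z]
            finite_measure.emeasure_eq_measure prob_space_def)
    qed
    have m2: "emeasure (distr ?\<gamma> (borel_of S') snd) A = emeasure (\<beta> z) A" if A: "A \<in> \<E>2" for A
    proof -
      obtain j where j: "A = e2 j" using A \<E>2(1) from_nat_into_surj unfolding e2_def by metis
      have "I z (\<lambda>w. indicator (e2 j) (snd w)) p = measure (\<beta> z) (e2 j)"
        using 0[of j] unfolding \<psi>_def by linarith
      then show ?thesis
        using measurable_sets[OF sndP e2S[of j]] pb(1)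
        by (simp add: j emeasure_distr[OF f2 e2S] sp density_emeasure[OF z p] I_snd[OF z]
            finite_measure.emeasure_eq_measure prob_space_def)
    qed
    have d1: "distr ?\<gamma> (borel_of S) fst = \<alpha> z"
    proof (rule measure_eqI_generator_eq[OF \<E>1(2) _ m1, where A = "\<lambda>_. topspace S"])
      show "emeasure (distr ?\<gamma> (borel_of S) fst) (topspace S) \<noteq> \<infinity>" for i :: nat
        using m1[OF \<E>1(4)] pa(1) by (simp add: finite_measure.emeasure_eq_measure prob_space_def)
    qed (use \<E>1(4,5) pa(2) E12_sub in auto)
    have d2: "distr ?\<gamma> (borel_of S') snd = \<beta> z"
    proof (rule measure_eqI_generator_eq[OF \<E>2(2) _ m2, where A = "\<lambda>_. topspace S'"])
      show "emeasure (distr ?\<gamma> (borel_of S') snd) (topspace S') \<noteq> \<infinity>" for i :: nat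
        using m2[OF \<E>2(4)] pb(1) by (simp add: finite_measure.emeasure_eq_measure prob_space_def)
    qed (use \<E>2(4,5) pb(2) E12_sub in auto)
    \<comment> \<open>Densities are not normalized; total mass one is inherited from the first
      marginal.\<close>
    have "prob_space ?\<gamma>" using d1 pa(1) f1 by (metis prob_space_distrD)
    then show ?thesis using d1 d2 sets by (simp add: couplings_def prob_measures_def P_def)
  qed
  \<comment> \<open>Conversely every coupling is reached, by the domination with the constant
    \<open>C = card X\<close>; minimizing over feasible densities is thus minimizing over
    couplings.\<close>
  have density_coupling: "\<exists>p\<in>bounded_densities P C. density (U z) (\<lambda>w. ennreal (p w)) = \<gamma> \<and> (\<forall>j. \<psi> j z p = 0)"
    if z: "z \<in> space N" and \<gamma>: "\<gamma> \<in> couplings S S' (\<alpha> z) (\<beta> z)" for z \<gamma>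
  proof -
    note c\<gamma> = couplingsD[OF \<gamma>]
    interpret \<gamma>: prob_space \<gamma> by (rule c\<gamma>)
    have "emeasure \<gamma> A \<le> ennreal C * emeasure (U z) A" if "A \<in> sets (U z)" for A
      using coupling_le_uniform_pair[OF S(2,3) S' \<gamma>[unfolded S(1)] \<beta>P[OF z]] that by (simp add: U_def C_def)
    then obtain p where p: "p \<in> bounded_densities (U z) C" and dp: "density (U z) (\<lambda>w. ennreal (p w)) = \<gamma>"
      using bounded_density_exists[OF U(4)[OF z] _ C, of \<gamma>] c\<gamma>(2) U(2)[OF z] unfolding P_def by metis
    have p: "p \<in> bounded_densities P C" using p bd[OF z] by simp
    have f1: "fst \<in> \<gamma> \<rightarrow>\<^sub>M borel_of S" and f2: "snd \<in> \<gamma> \<rightarrow>\<^sub>M borel_of S'"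
      using fstP sndP measurable_cong_sets[OF c\<gamma>(2) refl] unfolding P_def by blast+
    have em: "measure \<gamma> A = I z (indicator A) p" if "A \<in> sets P" for A
      using density_emeasure[OF z p that] I_nonneg[OF p] unfolding dp by (simp add: measure_def)
    have "\<psi> j z p = 0" for j
    proof -
      have "measure (\<alpha> z) (e1 j) = I z (\<lambda>w. indicator (e1 j) (fst w)) p"
        using measurable_sets[OF fstP e1S[of j]] c\<gamma>(3) spP
        by (simp add: c\<gamma>(4)[symmetric] measure_distr[OF f1 e1S] I_fst[OF z] em)
      moreover have "measure (\<beta> z) (e2 j) = I z (\<lambda>w. indicator (e2 j) (snd w)) p"
        using measurable_sets[OF sndP e2S[of j]] c\<gamma>(3) spP
        by (simp add: c\<gamma>(5)[symmetric] measure_distr[OF f2 e2S] I_snd[OF z] em)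
      ultimately show ?thesis by (simp add: \<psi>_def)
    qed
    with p dp show ?thesis by blast
  qed
  have "\<exists>s. (\<forall>z\<in>space N. s z \<in> bounded_densities P C \<and> (\<forall>j. \<psi> j z (s z) = 0) \<and>
      (\<forall>p\<in>bounded_densities P C. (\<forall>j. \<psi> j z p = 0) \<longrightarrow> \<phi> 0 z (s z) \<le> \<phi> 0 z p)) \<and>
    (\<forall>j. (\<lambda>z. \<phi> j z (s z)) \<in> borel_measurable N)"
  proof (rule measurable_lexicographic_selection[OF D(1,2)])
    fix z and u :: "nat \<Rightarrow> 'a \<times> 'b \<Rightarrow> real" assume z: "z \<in> space N" and u: "\<And>n. u n \<in> bounded_densities P C"
    have spU: "space (U z) = space P" by (simp add: U(3)[OF z] spP)
    have EU: "\<E> \<subseteq> Pow (space (U z))" "space (U z) \<in> \<E>" "sets (U z) = sigma_sets (space (U z)) \<E>"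
      using \<E>_sub \<E>_top by (simp_all add: U(2)[OF z] spU)
    have u': "u n \<in> bounded_densities (U z) C" for n using u bd[OF z] by simp
    obtain r q where r: "strict_mono (r :: nat \<Rightarrow> nat)" "q \<in> bounded_densities (U z) C"
      and lim: "\<And>f :: _ \<Rightarrow> real. integrable (U z) f \<Longrightarrow> (\<lambda>n. I z f (u (r n))) \<longlonglongrightarrow> I z f q"
      unfolding I_def
      using bounded_densities_weakly_compact[where p = u, OF U(4)[OF z] \<E>(1,2) EU u'] by blast
    note r = r(1) r(2)[unfolded bd[OF z]]
    interpret prob_space "U z" by (rule U[OF z])
    have "(\<lambda>n. I z f (u (r n))) \<longlonglongrightarrow> I z f q"
      if "f \<in> borel_measurable P" "\<And>w. w \<in> space P \<Longrightarrow> \<bar>f w\<bar> \<le> b" for f b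
    proof (rule lim, rule integrable_const_bound[of _ b])
      show "AE w in U z. norm (f w) \<le> b" using that U(3)[OF z] spP by (intro AE_I2) auto
      show "f \<in> borel_measurable (U z)" using that measurable_cong_sets[OF U(2)[OF z] refl] by blast
    qed
    then have "(\<forall>j. (\<lambda>n. \<phi> j z (u (r n))) \<longlonglongrightarrow> \<phi> j z q) \<and> (\<forall>j. (\<lambda>n. \<psi> j z (u (r n))) \<longlonglongrightarrow> \<psi> j z q)"
      by (rule conv[where u = "\<lambda>n. u (r n)" and p = q, OF z])
    then show "\<exists>r p. strict_mono (r :: nat \<Rightarrow> nat) \<and> p \<in> bounded_densities P C \<and>
      (\<forall>j. (\<lambda>n. \<phi> j z (u (r n))) \<longlonglongrightarrow> \<phi> j z p) \<and> (\<forall>j. (\<lambda>n. \<psi> j z (u (r n))) \<longlonglongrightarrow> \<psi> j z p)"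
      by (intro exI[of _ r] exI[of _ q] conjI[OF r(1)] conjI[OF r(2)])
  next
    fix z p assume z: "z \<in> space N" and p: "p \<in> bounded_densities P C"
    obtain d where d: "\<And>n. d n \<in> D" "(\<lambda>n::nat. \<integral>x. \<bar>d n x - p x\<bar> \<partial>U z) \<longlonglongrightarrow> 0"
      using D(3)[OF U(4)[OF z] U(2)[OF z] p] by blast
    have "(\<lambda>n. I z f (d n)) \<longlonglongrightarrow> I z f p"
      if "f \<in> borel_measurable P" "\<And>w. w \<in> space P \<Longrightarrow> \<bar>f w\<bar> \<le> b" for f b
      unfolding I_def
    proof (rule tendsto_integral_mult_density[OF U(4)[OF z] _ _ _ _ d(2)])
      show "\<And>w. w \<in> space (U z) \<Longrightarrow> \<bar>f w\<bar> \<le> b" using that U(3)[OF z] spP by auto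
      show "f \<in> borel_measurable (U z)" using that measurable_cong_sets[OF U(2)[OF z] refl] by blast
      show "\<And>n. d n \<in> bounded_densities (U z) C" "p \<in> bounded_densities (U z) C"
        using d(1) D(2) p unfolding bd[OF z] by auto
    qed
    then have "(\<forall>j. (\<lambda>n. \<phi> j z (d n)) \<longlonglongrightarrow> \<phi> j z p) \<and> (\<forall>j. (\<lambda>n. \<psi> j z (d n)) \<longlonglongrightarrow> \<psi> j z p)"
      by (rule conv[where u = d and p = p, OF z])
    then show "\<exists>d. (\<forall>n. d n \<in> D) \<and> (\<forall>j. (\<lambda>n::nat. \<phi> j z (d n)) \<longlonglongrightarrow> \<phi> j z p) \<and> (\<forall>j. (\<lambda>n. \<psi> j z (d n)) \<longlonglongrightarrow> \<psi> j z p)"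
      by (intro exI[of _ d] conjI[OF allI[OF d(1)]])
  next
    fix j d assume d: "d \<in> D"
    show "(\<lambda>z. \<phi> j z d) \<in> borel_measurable N"
    proof (cases j)
      case 0
      have "(\<lambda>z. I z g d) \<in> borel_measurable N" by (rule I_meas'[OF gP d])
      then have "(\<lambda>z. (z, I z g d)) \<in> N \<rightarrow>\<^sub>M N \<Otimes>\<^sub>M borel" by simp
      from measurable_compose[OF this H(1)] have "(\<lambda>z. H z (I z g d)) \<in> borel_measurable N" by simp
      moreover have "(\<lambda>z. I z (F z) d) \<in> borel_measurable N"
        by (rule I_meas[OF _ d]) (use F(1) in \<open>simp add: P_def\<close>)
      ultimately show ?thesis by (simp add: \<phi>_def 0)
    next
      case (Suc i)
      show ?thesis unfolding \<phi>_def Suc nat.case by (rule I_meas'[OF _ d]) measurable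
    qed
    have [measurable]: "(\<lambda>z. measure (\<alpha> z) (e1 j)) \<in> borel_measurable N" "(\<lambda>z. measure (\<beta> z) (e2 j)) \<in> borel_measurable N"
      by (rule measurable_compose[OF \<alpha> measurable_measure_prob_algebra[OF e1S]]
          measurable_compose[OF \<beta> measurable_measure_prob_algebra[OF e2S]])+
    have [measurable]: "(\<lambda>z. I z (\<lambda>w. indicator (e1 j) (fst w)) d) \<in> borel_measurable N"
        "(\<lambda>z. I z (\<lambda>w. indicator (e2 j) (snd w)) d) \<in> borel_measurable N"
      by (rule I_meas'[OF ind1 d] I_meas'[OF ind2 d])+
    show "(\<lambda>z. \<psi> j z d) \<in> borel_measurable N" unfolding \<psi>_def by measurable
  next
    fix z assume z: "z \<in> space N"
    interpret a: prob_space "\<alpha> z" by (rule prob_measuresD[OF \<alpha>P[OF z]])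
    interpret b: prob_space "\<beta> z" by (rule prob_measuresD[OF \<beta>P[OF z]])
    \<comment> \<open>The product measure is a coupling, and its density shows that the constraints
      are feasible.\<close>
    interpret ab: pair_prob_space "\<alpha> z" "\<beta> z" ..
    have "distr (\<alpha> z \<Otimes>\<^sub>M \<beta> z) (\<alpha> z) fst = \<alpha> z" by (rule b.distr_pair_fst)
    then have 1: "distr (\<alpha> z \<Otimes>\<^sub>M \<beta> z) (borel_of S) fst = \<alpha> z"
      using prob_measuresD(2)[OF \<alpha>P[OF z]] by (simp cong: distr_cong)
    have "distr (\<alpha> z \<Otimes>\<^sub>M \<beta> z) (\<beta> z) snd = \<beta> z"
    proof (rule measure_eqI)
      fix A assume "A \<in> sets (distr (\<alpha> z \<Otimes>\<^sub>M \<beta> z) (\<beta> z) snd)"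
      then have A: "A \<in> sets (\<beta> z)" by simp
      have "snd -` A \<inter> space (\<alpha> z \<Otimes>\<^sub>M \<beta> z) = space (\<alpha> z) \<times> A"
        using sets.sets_into_space[OF A] by (auto simp: space_pair_measure)
      then show "emeasure (distr (\<alpha> z \<Otimes>\<^sub>M \<beta> z) (\<beta> z) snd) A = emeasure (\<beta> z) A"
        using A by (simp add: emeasure_distr b.emeasure_pair_measure_Times a.emeasure_space_1)
    qed simp
    then have 2: "distr (\<alpha> z \<Otimes>\<^sub>M \<beta> z) (borel_of S') snd = \<beta> z"
      using prob_measuresD(2)[OF \<beta>P[OF z]] by (simp cong: distr_cong)
    have "sets (\<alpha> z \<Otimes>\<^sub>M \<beta> z) = sets (borel_of (prod_topology S S'))"
      unfolding sets_borel_of_prod[OF scS S']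
      by (rule sets_pair_measure_cong) (simp_all add: prob_measuresD(2)[OF \<alpha>P[OF z]] prob_measuresD(2)[OF \<beta>P[OF z]])
    then have "\<alpha> z \<Otimes>\<^sub>M \<beta> z \<in> couplings S S' (\<alpha> z) (\<beta> z)"
      using 1 2 ab.prob_space_axioms by (simp add: couplings_def prob_measures_def)
    then show "\<exists>p\<in>bounded_densities P C. \<forall>j. \<psi> j z p = 0"
      using density_coupling[OF z] by blast
  qed
  then obtain s where s: "\<And>z. z \<in> space N \<Longrightarrow> s z \<in> bounded_densities P C"
    "\<And>z j. z \<in> space N \<Longrightarrow> \<psi> j z (s z) = 0"
    "\<And>z p. z \<in> space N \<Longrightarrow> p \<in> bounded_densities P C \<Longrightarrow> (\<forall>j. \<psi> j z p = 0) \<Longrightarrow> \<phi> 0 z (s z) \<le> \<phi> 0 z p"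
    and sm: "\<And>j. (\<lambda>z. \<phi> j z (s z)) \<in> borel_measurable N" by metis
  define \<kappa> where "\<kappa> z = density (U z) (\<lambda>w. ennreal (s z w))" for z
  have \<kappa>c: "\<kappa> z \<in> couplings S S' (\<alpha> z) (\<beta> z)" if "z \<in> space N" for z
    unfolding \<kappa>_def using coupling_density[OF that] s that by blast
  have obj: "(\<integral>w. F z w \<partial>density (U z) (\<lambda>w. ennreal (p w))) + H z (\<integral>w. g w \<partial>density (U z) (\<lambda>w. ennreal (p w))) = \<phi> 0 z p"
    if "z \<in> space N" "p \<in> bounded_densities P C" for z p
    using that by (simp add: I_density Fz gP \<phi>_def)
  have "\<kappa> \<in> N \<rightarrow>\<^sub>M prob_algebra P"
  proof (rule measurable_prob_algebra_generated[OF \<E>(5,2)])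
    show "\<E> \<subseteq> Pow (topspace (prod_topology S S'))" using \<E>_sub by (simp add: spP)
    show "prob_space (\<kappa> z)" "sets (\<kappa> z) = sets P" if "z \<in> space N" for z
      using couplingsD[OF \<kappa>c[OF that]] by (auto simp: P_def)
    fix A assume "A \<in> \<E>"
    then obtain j where j: "A = e j" using \<E>(1) from_nat_into_surj unfolding e_def by metis
    have "emeasure (\<kappa> z) A = ennreal (\<phi> (Suc j) z (s z))" if "z \<in> space N" for z
      unfolding \<kappa>_def j using density_emeasure[OF that s(1)[OF that] eP] by (simp add: \<phi>_def)
    moreover have "(\<lambda>z. ennreal (\<phi> (Suc j) z (s z))) \<in> borel_measurable N" using sm by measurable
    ultimately show "(\<lambda>z. emeasure (\<kappa> z) A) \<in> borel_measurable N"
      by (simp cong: measurable_cong)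
  qed
  moreover have "(\<integral>w. F z w \<partial>\<kappa> z) + H z (\<integral>w. g w \<partial>\<kappa> z) \<le> (\<integral>w. F z w \<partial>\<gamma>) + H z (\<integral>w. g w \<partial>\<gamma>)"
    if z: "z \<in> space N" and \<gamma>: "\<gamma> \<in> couplings S S' (\<alpha> z) (\<beta> z)" for z \<gamma>
  proof -
    obtain p where p: "p \<in> bounded_densities P C" "density (U z) (\<lambda>w. ennreal (p w)) = \<gamma>" "\<forall>j. \<psi> j z p = 0"
      using density_coupling[OF z \<gamma>] by blast
    show ?thesis
      using s(3)[OF z p(1,3)] unfolding obj[OF z p(1), symmetric] obj[OF z s(1)[OF z], symmetric] p(2) \<kappa>_def .
  qed
  ultimately show thesis using \<kappa>c by (intro that[of \<kappa>]) (auto simp: P_def)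
qed

section \<open>Concatenation of kernels\<close>

definition path_at :: "nat \<Rightarrow> ('a, 'b) path \<Rightarrow> 'a \<times> 'b" where
  "path_at k p = (fst p k, snd p k)"

definition path_restrict :: "nat \<Rightarrow> nat \<Rightarrow> ('a, 'b) path \<Rightarrow> ('a, 'b) path" where
  "path_restrict s u p = (restrict (fst p) {s..u}, restrict (snd p) {s..u})"

text \<open>The index is the time of the kernel, so \<open>z\<close> becomes the state at time
  \<open>Suc t\<close>, in front of a path that starts at \<open>Suc (Suc t)\<close>.\<close>

definition path_cons :: "nat \<Rightarrow> 'a \<times> 'b \<Rightarrow> ('a, 'b) path \<Rightarrow> ('a, 'b) path" where
  "path_cons t z p = ((fst p)(Suc t := fst z), (snd p)(Suc t := snd z))"

lemma path_at_cons: "path_at k (path_cons t z p) = (if k = Suc t then z else path_at k p)"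
  by (auto simp: path_at_def path_cons_def)

lemma path_restrict_cons:
  "t < u \<Longrightarrow> path_restrict (Suc t) u (path_cons t z p) = path_cons t z (path_restrict (Suc (Suc t)) u p)"
  by (auto simp: path_restrict_def path_cons_def fun_eq_iff)

lemma concat_kernels_Suc_path_cons:
  "concat_kernels TX TY K (Suc n) t z =
     K t z \<bind> (\<lambda>z'. distr (concat_kernels TX TY K n (Suc t) z') (borel_of (paths TX TY (Suc t) (t + Suc n))) (path_cons t z'))"
  by (simp add: path_cons_def[abs_def] case_prod_unfold)

lemma concat_kernels_cong:
  assumes "\<And>s. t \<le> s \<Longrightarrow> s < t + n \<Longrightarrow> K s = K' s"
  shows "concat_kernels TX TY K n t z = concat_kernels TX TY K' n t z"
  using assms
proof (induction n arbitrary: t z)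
  case (Suc n)
  have "concat_kernels TX TY K n (Suc t) = concat_kernels TX TY K' n (Suc t)"
    using Suc by (intro ext) auto
  moreover have "K t = K' t" using Suc.prems by simp
  ultimately show ?case by (simp only: concat_kernels_Suc_path_cons)
qed simp

locale polish_states =
  fixes T :: nat and TX :: "nat \<Rightarrow> 'a topology" and TY :: "nat \<Rightarrow> 'b topology"
  assumes polish_X: "t \<le> T \<Longrightarrow> polish_topology (TX t)" and polish_Y: "t \<le> T \<Longrightarrow> polish_topology (TY t)"
begin

abbreviation St where "St \<equiv> states TX TY"
abbreviation Pt where "Pt \<equiv> paths TX TY"
abbreviation concat where "concat \<equiv> concat_kernels TX TY"

text \<open>Stated through \<open>prob_algebra\<close> to have binds and image measures at hand; for
  \<open>t < T\<close> it agrees with Borel measurability for the weak topology by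
  \<open>measurable_weak_topology_iff\<close>.\<close>

definition kernel :: "(nat \<Rightarrow> 'a \<times> 'b \<Rightarrow> ('a \<times> 'b) measure) \<Rightarrow> nat \<Rightarrow> bool" where
  "kernel K t \<longleftrightarrow> K t \<in> borel_of (St t) \<rightarrow>\<^sub>M prob_algebra (borel_of (St (Suc t)))"

lemma second_countable_X: "t \<le> T \<Longrightarrow> second_countable (TX t)"
  and second_countable_Y: "t \<le> T \<Longrightarrow> second_countable (TY t)"
  using polish_X polish_Y by (auto simp: polish_iff_second_countable)

lemma polish_St: "t \<le> T \<Longrightarrow> polish_topology (St t)"
  unfolding states_def by (intro polish_prod_topology polish_X polish_Y)

lemma topspace_St: "topspace (St t) = topspace (TX t) \<times> topspace (TY t)"
  by (simp add: states_def)

lemma topspace_Pt: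
  "topspace (Pt s u) = PiE {s..u} (\<lambda>i. topspace (TX i)) \<times> PiE {s..u} (\<lambda>i. topspace (TY i))"
  by (simp add: paths_def)

lemma path_at_in_St: "p \<in> topspace (Pt s u) \<Longrightarrow> k \<in> {s..u} \<Longrightarrow> path_at k p \<in> topspace (St k)"
  by (auto simp: topspace_Pt topspace_St path_at_def mem_Times_iff)

lemma measurable_path_component:
  assumes "k \<in> {s..u}"
  shows "(\<lambda>p. fst p k) \<in> borel_of (Pt s u) \<rightarrow>\<^sub>M borel_of (TX k)"
    "(\<lambda>p. snd p k) \<in> borel_of (Pt s u) \<rightarrow>\<^sub>M borel_of (TY k)"
proof -
  have c: "(\<lambda>xs. xs k) \<in> borel_of (product_topology TX {s..u}) \<rightarrow>\<^sub>M borel_of (TX k)"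
    "(\<lambda>ys. ys k) \<in> borel_of (product_topology TY {s..u}) \<rightarrow>\<^sub>M borel_of (TY k)"
    using assms by (auto intro!: continuous_map_borel_of continuous_map_product_projection)
  show "(\<lambda>p. fst p k) \<in> borel_of (Pt s u) \<rightarrow>\<^sub>M borel_of (TX k)"
    "(\<lambda>p. snd p k) \<in> borel_of (Pt s u) \<rightarrow>\<^sub>M borel_of (TY k)"
    unfolding paths_def
    by (rule measurable_compose[OF measurable_fst_snd_borel_of(1) c(1)]
        measurable_compose[OF measurable_fst_snd_borel_of(2) c(2)])+
qed

lemma measurable_St:
  assumes "t \<le> T" "(\<lambda>x. fst (f x)) \<in> M \<rightarrow>\<^sub>M borel_of (TX t)" "(\<lambda>x. snd (f x)) \<in> M \<rightarrow>\<^sub>M borel_of (TY t)"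
  shows "f \<in> M \<rightarrow>\<^sub>M borel_of (St t)"
  unfolding states_def using assms
  by (intro measurable_borel_of_prod second_countable_X second_countable_Y)

lemma measurable_path_at:
  assumes "k \<in> {s..u}" "u \<le> T"
  shows "path_at k \<in> borel_of (Pt s u) \<rightarrow>\<^sub>M borel_of (St k)"
  using assms measurable_path_component[OF assms(1)] by (intro measurable_St) (auto simp: path_at_def)

lemma measurable_Pt:
  assumes "u \<le> T"
    "\<And>i. i \<in> {s..u} \<Longrightarrow> (\<lambda>x. fst (f x) i) \<in> M \<rightarrow>\<^sub>M borel_of (TX i)"
    "\<And>i. i \<in> {s..u} \<Longrightarrow> (\<lambda>x. snd (f x) i) \<in> M \<rightarrow>\<^sub>M borel_of (TY i)"
    "\<And>x. x \<in> space M \<Longrightarrow> fst (f x) \<in> extensional {s..u}" "\<And>x. x \<in> space M \<Longrightarrow> snd (f x) \<in> extensional {s..u}"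
  shows "f \<in> M \<rightarrow>\<^sub>M borel_of (Pt s u)"
  unfolding paths_def using assms
  by (intro measurable_borel_of_prod measurable_borel_of_product second_countable_product_topology
      second_countable_X second_countable_Y) auto

lemma measurable_path_restrict:
  assumes "u \<le> v" "v \<le> T"
  shows "path_restrict s u \<in> borel_of (Pt s v) \<rightarrow>\<^sub>M borel_of (Pt s u)"
proof (rule measurable_Pt)
  fix i assume "i \<in> {s..u}"
  then show "(\<lambda>p. fst (path_restrict s u p) i) \<in> borel_of (Pt s v) \<rightarrow>\<^sub>M borel_of (TX i)"
    "(\<lambda>p. snd (path_restrict s u p) i) \<in> borel_of (Pt s v) \<rightarrow>\<^sub>M borel_of (TY i)"
    using measurable_path_component[of i s v] assms by (auto simp: path_restrict_def)
qed (use assms in \<open>auto simp: path_restrict_def\<close>)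

lemma measurable_path_cons:
  assumes "u \<le> T" "t < u"
  shows "(\<lambda>(z, p). path_cons t z p) \<in> borel_of (St (Suc t)) \<Otimes>\<^sub>M borel_of (Pt (Suc (Suc t)) u) \<rightarrow>\<^sub>M borel_of (Pt (Suc t) u)"
proof (rule measurable_Pt[OF assms(1)])
  let ?M = "borel_of (St (Suc t)) \<Otimes>\<^sub>M borel_of (Pt (Suc (Suc t)) u)"
  fix i assume i: "i \<in> {Suc t..u}"
  have z: "(\<lambda>q. fst (fst q)) \<in> ?M \<rightarrow>\<^sub>M borel_of (TX (Suc t))" "(\<lambda>q. snd (fst q)) \<in> ?M \<rightarrow>\<^sub>M borel_of (TY (Suc t))"
    unfolding states_def
    by (rule measurable_compose[OF measurable_fst measurable_fst_snd_borel_of(1)]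
        measurable_compose[OF measurable_fst measurable_fst_snd_borel_of(2)])+
  have p: "(\<lambda>q. fst (snd q) i) \<in> ?M \<rightarrow>\<^sub>M borel_of (TX i)" "(\<lambda>q. snd (snd q) i) \<in> ?M \<rightarrow>\<^sub>M borel_of (TY i)"
    if "i \<noteq> Suc t"
  proof -
    have i': "i \<in> {Suc (Suc t)..u}" using i that by simp
    show "(\<lambda>q. fst (snd q) i) \<in> ?M \<rightarrow>\<^sub>M borel_of (TX i)" "(\<lambda>q. snd (snd q) i) \<in> ?M \<rightarrow>\<^sub>M borel_of (TY i)"
      by (rule measurable_compose[OF measurable_snd measurable_path_component(1)[OF i']]
          measurable_compose[OF measurable_snd measurable_path_component(2)[OF i']])+
  qed
  show "(\<lambda>q. fst (case q of (z, p) \<Rightarrow> path_cons t z p) i) \<in> ?M \<rightarrow>\<^sub>M borel_of (TX i)"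
    "(\<lambda>q. snd (case q of (z, p) \<Rightarrow> path_cons t z p) i) \<in> ?M \<rightarrow>\<^sub>M borel_of (TY i)"
    using z p by (cases "i = Suc t"; simp add: path_cons_def case_prod_unfold)+
qed (use assms in \<open>auto simp: path_cons_def space_pair_measure topspace_Pt PiE_def extensional_def\<close>)

lemma measurable_path_cons':
  assumes "u \<le> T" "t < u" "z \<in> topspace (St (Suc t))"
  shows "path_cons t z \<in> borel_of (Pt (Suc (Suc t)) u) \<rightarrow>\<^sub>M borel_of (Pt (Suc t) u)"
  using measurable_compose[OF measurable_Pair1'[of z "borel_of (St (Suc t))"] measurable_path_cons[OF assms(1,2)]] assms(3)
  by simp

lemma measurable_concat:
  assumes "\<And>s. t \<le> s \<Longrightarrow> s < t + n \<Longrightarrow> kernel K s" "t + n \<le> T"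
  shows "concat K n t \<in> borel_of (St t) \<rightarrow>\<^sub>M prob_algebra (borel_of (Pt (Suc t) (t + n)))"
  using assms
proof (induction n arbitrary: t)
  case 0
  have "(\<lambda>_. undefined, \<lambda>_. undefined) \<in> space (borel_of (Pt (Suc t) t))"
    by (simp add: topspace_Pt)
  then have "return (borel_of (Pt (Suc t) t)) (\<lambda>_. undefined, \<lambda>_. undefined)
      \<in> space (prob_algebra (borel_of (Pt (Suc t) t)))"
    by (simp add: space_prob_algebra prob_space_return)
  then show ?case by simp
next
  case (Suc n)
  have IH: "concat K n (Suc t) \<in> borel_of (St (Suc t)) \<rightarrow>\<^sub>M prob_algebra (borel_of (Pt (Suc (Suc t)) (t + Suc n)))"
    using Suc.IH[of "Suc t"] Suc.prems by simp
  have K: "K t \<in> borel_of (St t) \<rightarrow>\<^sub>M prob_algebra (borel_of (St (Suc t)))"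
    using Suc.prems(1)[of t] by (simp add: kernel_def)
  have "(\<lambda>z'. distr (concat K n (Suc t) z') (borel_of (Pt (Suc t) (t + Suc n))) (path_cons t z'))
      \<in> borel_of (St (Suc t)) \<rightarrow>\<^sub>M prob_algebra (borel_of (Pt (Suc t) (t + Suc n)))"
    using Suc.prems by (intro measurable_distr_prob_space2[OF IH] measurable_path_cons) auto
  from measurable_bind_prob_space[OF K this] show ?case
    by (simp only: concat_kernels_Suc_path_cons)
qed

lemma concat_prob:
  assumes "\<And>s. t \<le> s \<Longrightarrow> s < t + n \<Longrightarrow> kernel K s" "t + n \<le> T" "z \<in> topspace (St t)"
  shows "prob_space (concat K n t z)" "sets (concat K n t z) = sets (borel_of (Pt (Suc t) (t + n)))"
    "space (concat K n t z) = topspace (Pt (Suc t) (t + n))"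
proof -
  have "concat K n t z \<in> prob_measures (Pt (Suc t) (t + n))"
    using measurable_space[OF measurable_concat[OF assms(1,2)]] assms(3)
    by (simp add: prob_measures_eq_space_prob_algebra)
  then show "prob_space (concat K n t z)" "sets (concat K n t z) = sets (borel_of (Pt (Suc t) (t + n)))"
    "space (concat K n t z) = topspace (Pt (Suc t) (t + n))"
    by (rule prob_measuresD)+
qed

lemma kernel_prob:
  assumes "kernel K t" "z \<in> topspace (St t)"
  shows "prob_space (K t z)" "sets (K t z) = sets (borel_of (St (Suc t)))" "space (K t z) = topspace (St (Suc t))"
proof -
  have "K t z \<in> prob_measures (St (Suc t))"
    using measurable_space[OF assms(1)[unfolded kernel_def]] assms(2)
    by (simp add: prob_measures_eq_space_prob_algebra)
  then show "prob_space (K t z)" "sets (K t z) = sets (borel_of (St (Suc t)))" "space (K t z) = topspace (St (Suc t))"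
    by (rule prob_measuresD)+
qed

text \<open>Decomposition at the first step, on which inductions over the length of a concatenation
  rest.\<close>

lemma nn_integral_concat_Suc:
  assumes K: "\<And>s. t \<le> s \<Longrightarrow> s < t + Suc n \<Longrightarrow> kernel K s" and T: "t + Suc n \<le> T" and z: "z \<in> topspace (St t)"
    and f: "f \<in> borel_measurable (borel_of (Pt (Suc t) (t + Suc n)))"
  shows "(\<integral>\<^sup>+p. f p \<partial>concat K (Suc n) t z) = (\<integral>\<^sup>+z'. \<integral>\<^sup>+p. f (path_cons t z' p) \<partial>concat K n (Suc t) z' \<partial>K t z)"
proof -
  let ?R = "borel_of (Pt (Suc t) (t + Suc n))"
  have IH: "concat K n (Suc t) \<in> borel_of (St (Suc t)) \<rightarrow>\<^sub>M prob_algebra (borel_of (Pt (Suc (Suc t)) (t + Suc n)))"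
    using measurable_concat[of "Suc t" n K] K T by simp
  have D: "(\<lambda>z'. distr (concat K n (Suc t) z') ?R (path_cons t z')) \<in> borel_of (St (Suc t)) \<rightarrow>\<^sub>M subprob_algebra ?R"
    using T by (intro measurable_prob_algebraD measurable_distr_prob_space2[OF IH] measurable_path_cons) auto
  note kp = kernel_prob[OF K[of t] z, simplified]
  have D': "(\<lambda>z'. distr (concat K n (Suc t) z') ?R (path_cons t z')) \<in> K t z \<rightarrow>\<^sub>M subprob_algebra ?R"
    using D measurable_cong_sets[OF kp(2) refl] by blast
  show ?thesis
    unfolding concat_kernels_Suc_path_cons nn_integral_bind[OF f D']
  proof (rule nn_integral_cong)
    fix z' assume "z' \<in> space (K t z)"
    then have z': "z' \<in> topspace (St (Suc t))" by (simp add: kp)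
    have sets: "sets (concat K n (Suc t) z') = sets (borel_of (Pt (Suc (Suc t)) (t + Suc n)))"
      using concat_prob(2)[of "Suc t" n K z'] K T z' by simp
    have "path_cons t z' \<in> concat K n (Suc t) z' \<rightarrow>\<^sub>M ?R"
      using measurable_path_cons'[OF T _ z'] unfolding measurable_cong_sets[OF sets refl] by simp
    then show "(\<integral>\<^sup>+p. f p \<partial>distr (concat K n (Suc t) z') ?R (path_cons t z')) =
        (\<integral>\<^sup>+p. f (path_cons t z' p) \<partial>concat K n (Suc t) z')"
      using f by (subst nn_integral_distr) auto
  qed
qed

lemma integral_concat_Suc:
  fixes f :: "('a, 'b) path \<Rightarrow> real"
  assumes K: "\<And>s. t \<le> s \<Longrightarrow> s < t + Suc n \<Longrightarrow> kernel K s" and T: "t + Suc n \<le> T" and z: "z \<in> topspace (St t)"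
    and f: "f \<in> borel_measurable (borel_of (Pt (Suc t) (t + Suc n)))"
      "\<And>p. p \<in> topspace (Pt (Suc t) (t + Suc n)) \<Longrightarrow> \<bar>f p\<bar> \<le> B"
  shows "(\<integral>p. f p \<partial>concat K (Suc n) t z) = (\<integral>z'. \<integral>p. f (path_cons t z' p) \<partial>concat K n (Suc t) z' \<partial>K t z)"
proof -
  let ?R = "borel_of (Pt (Suc t) (t + Suc n))"
  have IH: "concat K n (Suc t) \<in> borel_of (St (Suc t)) \<rightarrow>\<^sub>M prob_algebra (borel_of (Pt (Suc (Suc t)) (t + Suc n)))"
    using measurable_concat[of "Suc t" n K] K T by simp
  have D0: "(\<lambda>z'. distr (concat K n (Suc t) z') ?R (path_cons t z')) \<in> borel_of (St (Suc t)) \<rightarrow>\<^sub>M prob_algebra ?R"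
    using T by (intro measurable_distr_prob_space2[OF IH] measurable_path_cons) auto
  note D = measurable_prob_algebraD[OF D0]
  note kp = kernel_prob[OF K[of t] z, simplified]
  interpret prob_space "K t z" by (rule kp)
  have D': "(\<lambda>z'. distr (concat K n (Suc t) z') ?R (path_cons t z')) \<in> K t z \<rightarrow>\<^sub>M subprob_algebra ?R"
    using D measurable_cong_sets[OF kp(2) refl] by blast
  have "(\<integral>p. f p \<partial>(K t z \<bind> (\<lambda>z'. distr (concat K n (Suc t) z') ?R (path_cons t z')))) =
      (\<integral>z'. \<integral>p. f p \<partial>distr (concat K n (Suc t) z') ?R (path_cons t z') \<partial>K t z)"
  proof (rule integral_bind[OF f(1) _ D'])
    show "\<bar>f p\<bar> \<le> B" if "p \<in> space ?R" for p using f(2) that by simp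
    show "AE z' in K t z. emeasure (distr (concat K n (Suc t) z') ?R (path_cons t z'))
        (space (distr (concat K n (Suc t) z') ?R (path_cons t z'))) \<le> ennreal 1"
    proof (rule AE_I2)
      fix z' assume "z' \<in> space (K t z)"
      then have "prob_space (distr (concat K n (Suc t) z') ?R (path_cons t z'))"
        using measurable_space[OF D0, of z'] by (simp add: kp space_prob_algebra)
      then show "emeasure (distr (concat K n (Suc t) z') ?R (path_cons t z'))
        (space (distr (concat K n (Suc t) z') ?R (path_cons t z'))) \<le> ennreal 1"
        by (simp add: prob_space.emeasure_space_1 del: space_distr)
    qed
  qed (rule finite_measure_axioms)
  also have "\<dots> = (\<integral>z'. \<integral>p. f (path_cons t z' p) \<partial>concat K n (Suc t) z' \<partial>K t z)"
  proof (rule Bochner_Integration.integral_cong[OF refl])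
    fix z' assume "z' \<in> space (K t z)"
    then have z': "z' \<in> topspace (St (Suc t))" by (simp add: kp)
    have sets: "sets (concat K n (Suc t) z') = sets (borel_of (Pt (Suc (Suc t)) (t + Suc n)))"
      using concat_prob(2)[of "Suc t" n K z'] K T z' by simp
    have "path_cons t z' \<in> concat K n (Suc t) z' \<rightarrow>\<^sub>M ?R"
      using measurable_path_cons'[OF T _ z'] unfolding measurable_cong_sets[OF sets refl] by simp
    then show "(\<integral>p. f p \<partial>distr (concat K n (Suc t) z') ?R (path_cons t z')) =
        (\<integral>p. f (path_cons t z' p) \<partial>concat K n (Suc t) z')"
      by (rule integral_distr[OF _ f(1)])
  qed
  finally show ?thesis by (simp only: concat_kernels_Suc_path_cons)
qed

lemma measurable_emeasure_kernel:
  assumes "kernel K t" "B \<in> sets (borel_of (St (Suc t)))"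
  shows "(\<lambda>z. emeasure (K t z) B) \<in> borel_measurable (borel_of (St t))"
  using measurable_prob_algebraD[of "K t"] assms unfolding kernel_def
  by (intro measurable_compose[OF _ measurable_emeasure_subprob_algebra]) auto

text \<open>The Markov property of the concatenation, by induction through its first step. For
  \<open>u = t\<close> the first kernel itself is tested; for \<open>u > t\<close> the first state
  is absorbed into \<open>f\<close>, which must therefore be arbitrary in the induction.\<close>

lemma concat_markov:
  assumes K: "\<And>s. t \<le> s \<Longrightarrow> s < t + n \<Longrightarrow> kernel K s" and T: "t + n \<le> T" and z: "z \<in> topspace (St t)"
    and u: "t \<le> u" "u < t + n" and f: "f \<in> borel_measurable (borel_of (Pt (Suc t) u))"
    and B: "B \<in> sets (borel_of (St (Suc u)))"
  shows "(\<integral>\<^sup>+p. f (path_restrict (Suc t) u p) * indicator B (path_at (Suc u) p) \<partial>concat K n t z) =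
    (\<integral>\<^sup>+p. f (path_restrict (Suc t) u p) * emeasure (K u (if u = t then z else path_at u p)) B \<partial>concat K n t z)"
  using assms
proof (induction n arbitrary: t z f)
  case (Suc n)
  note K = Suc.prems(1) and T = Suc.prems(2) and z = Suc.prems(3) and u = Suc.prems(4,5) and f = Suc.prems(6)
  let ?R = "borel_of (Pt (Suc t) (t + Suc n))"
  have fr: "(\<lambda>p. f (path_restrict (Suc t) u p)) \<in> borel_measurable ?R"
    using u T by (intro measurable_compose[OF measurable_path_restrict f]) auto
  have "(\<lambda>p. indicator B (path_at (Suc u) p) :: ennreal) \<in> borel_measurable ?R"
    using u T by (intro measurable_compose[OF measurable_path_at borel_measurable_indicator[OF B]]) auto
  with fr have m1: "(\<lambda>p. f (path_restrict (Suc t) u p) * indicator B (path_at (Suc u) p)) \<in> borel_measurable ?R"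
    by measurable
  have "(\<lambda>p. emeasure (K u (if u = t then z else path_at u p)) B) \<in> borel_measurable ?R"
  proof (cases "u = t")
    case False
    then have "(\<lambda>p. emeasure (K u (path_at u p)) B) \<in> borel_measurable ?R"
      using u T by (intro measurable_compose[OF measurable_path_at measurable_emeasure_kernel[OF K B]]) auto
    then show ?thesis using False by simp
  qed simp
  with fr have m2: "(\<lambda>p. f (path_restrict (Suc t) u p) * emeasure (K u (if u = t then z else path_at u p)) B) \<in> borel_measurable ?R"
    by measurable
  note kp = kernel_prob[OF K[of t] z, simplified]
  have cp: "prob_space (concat K n (Suc t) z')" if "z' \<in> topspace (St (Suc t))" for z'
    using concat_prob(1)[of "Suc t" n K z'] K T that by simp
  note E1 = nn_integral_concat_Suc[where K = K, OF _ T z m1] and E2 = nn_integral_concat_Suc[where K = K, OF _ T z m2]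
  show ?case
  proof (subst E1, erule (1) K, subst E2, erule (1) K)
    show "(\<integral>\<^sup>+z'. \<integral>\<^sup>+p. f (path_restrict (Suc t) u (path_cons t z' p)) * indicator B (path_at (Suc u) (path_cons t z' p))
          \<partial>concat K n (Suc t) z' \<partial>K t z) = (\<integral>\<^sup>+z'. \<integral>\<^sup>+p. f (path_restrict (Suc t) u (path_cons t z' p)) *
        emeasure (K u (if u = t then z else path_at u (path_cons t z' p))) B \<partial>concat K n (Suc t) z' \<partial>K t z)"
    proof (cases "u = t")
      case True
      let ?e = "(\<lambda>_. undefined, \<lambda>_. undefined) :: ('a, 'b) path"
      \<comment> \<open>The past of length zero is a single path, so \<open>f\<close> contributes a
        constant.\<close>
      have e: "path_restrict (Suc t) t p = ?e" for p by (auto simp: path_restrict_def)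
      have "(\<integral>\<^sup>+z'. \<integral>\<^sup>+p. f (path_restrict (Suc t) u (path_cons t z' p)) * indicator B (path_at (Suc u) (path_cons t z' p))
            \<partial>concat K n (Suc t) z' \<partial>K t z) = (\<integral>\<^sup>+z'. f ?e * indicator B z' \<partial>K t z)"
        using cp kp(3)
        by (intro nn_integral_cong) (simp add: e path_at_cons True prob_space.emeasure_space_1)
      also have "\<dots> = f ?e * emeasure (K t z) B"
        using B True kp(2) by (subst nn_integral_cmult) auto
      also have "\<dots> = (\<integral>\<^sup>+z'. f ?e * emeasure (K t z) B \<partial>K t z)"
        using kp(1) by (simp add: prob_space.emeasure_space_1)
      also have "\<dots> = (\<integral>\<^sup>+z'. \<integral>\<^sup>+p. f (path_restrict (Suc t) u (path_cons t z' p)) *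
          emeasure (K u (if u = t then z else path_at u (path_cons t z' p))) B \<partial>concat K n (Suc t) z' \<partial>K t z)"
        using cp kp(3)
        by (intro nn_integral_cong) (simp add: e True prob_space.emeasure_space_1)
      finally show "(\<integral>\<^sup>+z'. \<integral>\<^sup>+p. f (path_restrict (Suc t) u (path_cons t z' p)) * indicator B (path_at (Suc u) (path_cons t z' p))
            \<partial>concat K n (Suc t) z' \<partial>K t z) = (\<integral>\<^sup>+z'. \<integral>\<^sup>+p. f (path_restrict (Suc t) u (path_cons t z' p)) *
          emeasure (K u (if u = t then z else path_at u (path_cons t z' p))) B \<partial>concat K n (Suc t) z' \<partial>K t z)" .
    next
      case False
      then have tu: "t < u" using u by simp
      show "(\<integral>\<^sup>+z'. \<integral>\<^sup>+p. f (path_restrict (Suc t) u (path_cons t z' p)) * indicator B (path_at (Suc u) (path_cons t z' p))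
            \<partial>concat K n (Suc t) z' \<partial>K t z) = (\<integral>\<^sup>+z'. \<integral>\<^sup>+p. f (path_restrict (Suc t) u (path_cons t z' p)) *
          emeasure (K u (if u = t then z else path_at u (path_cons t z' p))) B \<partial>concat K n (Suc t) z' \<partial>K t z)"
      proof (rule nn_integral_cong)
        fix z' assume "z' \<in> space (K t z)"
        then have z': "z' \<in> topspace (St (Suc t))" by (simp add: kp)
        have "path_cons t z' \<in> borel_of (Pt (Suc (Suc t)) u) \<rightarrow>\<^sub>M borel_of (Pt (Suc t) u)"
          using measurable_path_cons'[OF _ tu z'] u T by simp
        then have f': "(\<lambda>p. f (path_cons t z' p)) \<in> borel_measurable (borel_of (Pt (Suc (Suc t)) u))"
          by (rule measurable_compose[OF _ f])
        have "(\<integral>\<^sup>+p. f (path_cons t z' (path_restrict (Suc (Suc t)) u p)) * indicator B (path_at (Suc u) p) \<partial>concat K n (Suc t) z') =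
          (\<integral>\<^sup>+p. f (path_cons t z' (path_restrict (Suc (Suc t)) u p)) *
             emeasure (K u (if u = Suc t then z' else path_at u p)) B \<partial>concat K n (Suc t) z')"
          using K T tu u by (intro Suc.IH[OF _ _ z' _ _ f' B]) auto
        then show "(\<integral>\<^sup>+p. f (path_restrict (Suc t) u (path_cons t z' p)) * indicator B (path_at (Suc u) (path_cons t z' p))
            \<partial>concat K n (Suc t) z') = (\<integral>\<^sup>+p. f (path_restrict (Suc t) u (path_cons t z' p)) *
          emeasure (K u (if u = t then z else path_at u (path_cons t z' p))) B \<partial>concat K n (Suc t) z')"
          using tu by (simp add: path_restrict_cons path_at_cons)
      qed
    qed
  qed
qed simp

text \<open>This is \<open>concat_markov\<close> from time \<open>0\<close>, with the indicator of a
  set of pasts as \<open>f\<close>.\<close>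

lemma successive_pair_kernels_concat:
  assumes K: "\<And>s. s < T \<Longrightarrow> kernel K s" and z0: "(x0, y0) \<in> topspace (St 0)"
  shows "successive_pair_kernels T TX TY (concat K T 0 (x0, y0))
      (\<lambda>t (xs, ys). K t (state_at x0 t xs, state_at y0 t ys))"
  unfolding successive_pair_kernels_def
proof (intro allI impI)
  fix t assume t: "t < T"
  let ?\<pi> = "concat K T 0 (x0, y0)"
  let ?s = "\<lambda>p. if t = 0 then (x0, y0) else path_at t p"
  have s: "(\<lambda>(xs, ys). K t (state_at x0 t xs, state_at y0 t ys)) = (\<lambda>p. K t (?s p))"
    by (auto simp: state_at_def path_at_def)
  have Z: "(\<lambda>(xs, ys). (restrict xs {1..t}, restrict ys {1..t})) = path_restrict (Suc 0) t"
    by (auto simp: path_restrict_def)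
  have W: "(\<lambda>(xs, ys). (xs (Suc t), ys (Suc t))) = path_at (Suc t)"
    by (auto simp: path_at_def)
  have sm: "?s \<in> borel_of (Pt 1 t) \<rightarrow>\<^sub>M borel_of (St t)"
  proof (cases "t = 0")
    case True
    then show ?thesis using z0 by simp
  next
    case False
    then show ?thesis using measurable_path_at[of t 1 t] t by simp
  qed
  note pp = concat_prob[of 0 T K, OF _ _ z0, simplified, OF K]
  show "regular_cond_kernel ?\<pi> (Pt 1 t) (\<lambda>(xs, ys). (restrict xs {1..t}, restrict ys {1..t}))
      (St (Suc t)) (\<lambda>(xs, ys). (xs (Suc t), ys (Suc t))) (\<lambda>(xs, ys). K t (state_at x0 t xs, state_at y0 t ys))"
    unfolding regular_cond_kernel_def s Z W
  proof (intro conjI ballI)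
    show "(\<lambda>p. K t (?s p)) \<in> borel_of (Pt 1 t) \<rightarrow>\<^sub>M prob_algebra (borel_of (St (Suc t)))"
      using K[OF t] unfolding kernel_def by (rule measurable_compose[OF sm])
    fix A B assume A: "A \<in> sets (borel_of (Pt 1 t))" and B: "B \<in> sets (borel_of (St (Suc t)))"
    have rm: "path_restrict (Suc 0) t \<in> ?\<pi> \<rightarrow>\<^sub>M borel_of (Pt 1 t)"
      using measurable_path_restrict[of t T "Suc 0"] t measurable_cong_sets[OF pp(2) refl] by auto
    have am: "path_at (Suc t) \<in> ?\<pi> \<rightarrow>\<^sub>M borel_of (St (Suc t))"
      using measurable_path_at[of "Suc t" "Suc 0" T] t measurable_cong_sets[OF pp(2) refl] by auto
    have sets: "{p \<in> space ?\<pi>. path_restrict (Suc 0) t p \<in> A \<and> path_at (Suc t) p \<in> B} \<in> sets ?\<pi>"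
    proof -
      have "{p \<in> space ?\<pi>. path_restrict (Suc 0) t p \<in> A \<and> path_at (Suc t) p \<in> B} =
        (path_restrict (Suc 0) t -` A \<inter> space ?\<pi>) \<inter> (path_at (Suc t) -` B \<inter> space ?\<pi>)" by auto
      then show ?thesis using measurable_sets[OF rm A] measurable_sets[OF am B] by simp
    qed
    have "emeasure ?\<pi> {p \<in> space ?\<pi>. path_restrict (Suc 0) t p \<in> A \<and> path_at (Suc t) p \<in> B} =
        (\<integral>\<^sup>+p. indicator A (path_restrict (Suc 0) t p) * indicator B (path_at (Suc t) p) \<partial>?\<pi>)"
      unfolding nn_integral_indicator[OF sets, symmetric]
      by (intro nn_integral_cong) (auto split: split_indicator)
    also have "\<dots> = (\<integral>\<^sup>+p. indicator A (path_restrict (Suc 0) t p) *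
        emeasure (K t (if t = 0 then (x0, y0) else path_at t p)) B \<partial>?\<pi>)"
      using A by (intro concat_markov[where t = 0] z0 B K) (auto simp: t)
    also have "\<dots> = (\<integral>\<^sup>+p. indicator A (path_restrict (Suc 0) t p) *
        emeasure (K t (?s (path_restrict (Suc 0) t p))) B \<partial>?\<pi>)"
    proof -
      have "?s (path_restrict (Suc 0) t p) = ?s p" for p
        by (auto simp: path_at_def path_restrict_def)
      then show ?thesis by simp
    qed
    finally show "emeasure ?\<pi> {p \<in> space ?\<pi>. path_restrict (Suc 0) t p \<in> A \<and> path_at (Suc t) p \<in> B} =
        (\<integral>\<^sup>+p. indicator A (path_restrict (Suc 0) t p) *
        emeasure (K t (?s (path_restrict (Suc 0) t p))) B \<partial>?\<pi>)" .
  qed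
qed

end

section \<open>Laws are determined by their successive kernels\<close>

text \<open>Induction on the number of coordinates: on rectangles the joint law of the first
  \<open>n\<close> coordinates and the next one is the kernel integrated against the law of the
  first \<open>n\<close>, and rectangles determine it. It serves to recognize the marginals of the
  concatenated plan as \<open>\<mu>\<close> and \<open>\<nu>\<close>.\<close>

lemma law_determined_by_successive_kernels:
  assumes sc: "\<And>i. i \<in> {1..T} \<Longrightarrow> second_countable (S i)"
    and M: "M \<in> prob_measures (product_topology S {1..T})" and M': "M' \<in> prob_measures (product_topology S {1..T})"
    and k: "successive_kernels T S M A" "successive_kernels T S M' A"
  shows "M = M'"
proof -
  let ?P = "\<lambda>n. borel_of (product_topology S {1..n})"
  let ?r = "\<lambda>n xs. restrict xs {1..n::nat}"
  have rm: "?r n \<in> N \<rightarrow>\<^sub>M ?P n" if n: "n \<le> T" and N: "N \<in> prob_measures (product_topology S {1..T})" for n N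
  proof (rule measurable_borel_of_product)
    fix i assume i: "i \<in> {1..n}"
    have "(\<lambda>xs. xs i) \<in> ?P T \<rightarrow>\<^sub>M borel_of (S i)"
      using i n by (intro continuous_map_borel_of continuous_map_product_projection) auto
    then have "(\<lambda>xs. xs i) \<in> N \<rightarrow>\<^sub>M borel_of (S i)"
      using measurable_cong_sets[OF prob_measuresD(2)[OF N] refl] by blast
    then show "(\<lambda>xs. ?r n xs i) \<in> N \<rightarrow>\<^sub>M borel_of (S i)" using i by simp
  qed (use n sc in auto)
  have am: "(\<lambda>xs. xs (Suc n)) \<in> N \<rightarrow>\<^sub>M borel_of (S (Suc n))"
    if n: "n < T" and N: "N \<in> prob_measures (product_topology S {1..T})" for n N
  proof -
    have "(\<lambda>xs. xs (Suc n)) \<in> ?P T \<rightarrow>\<^sub>M borel_of (S (Suc n))"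
      using n by (intro continuous_map_borel_of continuous_map_product_projection) auto
    then show ?thesis using measurable_cong_sets[OF prob_measuresD(2)[OF N] refl] by blast
  qed
  have "distr M (?P n) (?r n) = distr M' (?P n) (?r n)" if "n \<le> T" for n
    using that
  proof (induction n)
    case 0
    have p: "prob_space (distr M (?P 0) (?r 0))" "prob_space (distr M' (?P 0) (?r 0))"
      using rm[OF _ M, of 0] rm[OF _ M', of 0] prob_measuresD(1)[OF M] prob_measuresD(1)[OF M']
      by (auto intro: prob_space.prob_space_distr)
    show ?case
    proof (rule measure_eqI)
      fix B assume "B \<in> sets (distr M (?P 0) (?r 0))"
      then have "B \<subseteq> space (?P 0)" using sets.sets_into_space[of B "?P 0"] by (simp only: sets_distr)
      \<comment> \<open>The empty product is one point, so any two probabilities on it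
        agree.\<close>
      moreover have "space (?P 0) = {\<lambda>_. undefined}" by simp
      ultimately have "B = {} \<or> B = space (?P 0)" by (metis subset_singletonD)
      then show "emeasure (distr M (?P 0) (?r 0)) B = emeasure (distr M' (?P 0) (?r 0)) B"
        using prob_space.emeasure_space_1[OF p(1)] prob_space.emeasure_space_1[OF p(2)] by auto
    qed simp
  next
    case (Suc n)
    let ?Q = "?P n \<Otimes>\<^sub>M borel_of (S (Suc n))"
    let ?j = "\<lambda>xs. (?r n xs, xs (Suc n))"
    have jm: "?j \<in> N \<rightarrow>\<^sub>M ?Q" if "N \<in> prob_measures (product_topology S {1..T})" for N
      using rm[OF _ that, of n] am[OF _ that, of n] Suc.prems by simp
    have rect: "emeasure (distr N ?Q ?j) (a \<times> b) =
        (\<integral>\<^sup>+xs. indicator a xs * emeasure (A n xs) b \<partial>distr N (?P n) (?r n))"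
      if N: "N \<in> prob_measures (product_topology S {1..T})" and kN: "successive_kernels T S N A"
        and a: "a \<in> sets (?P n)" and b: "b \<in> sets (borel_of (S (Suc n)))" for N a b
    proof -
      have kern: "A n \<in> ?P n \<rightarrow>\<^sub>M prob_algebra (borel_of (S (Suc n)))"
        and eq: "emeasure N {\<omega> \<in> space N. ?r n \<omega> \<in> a \<and> \<omega> (Suc n) \<in> b} =
          (\<integral>\<^sup>+\<omega>. indicator a (?r n \<omega>) * emeasure (A n (?r n \<omega>)) b \<partial>N)"
        using kN Suc.prems a b unfolding successive_kernels_def regular_cond_kernel_def by auto
      have "(\<lambda>xs. emeasure (A n xs) b) \<in> borel_measurable (?P n)"
        by (rule measurable_compose[OF measurable_prob_algebraD[OF kern] measurable_emeasure_subprob_algebra[OF b]])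
      then have m: "(\<lambda>xs. indicator a xs * emeasure (A n xs) b) \<in> borel_measurable (?P n)"
        using a by measurable
      have "emeasure (distr N ?Q ?j) (a \<times> b) = emeasure N (?j -` (a \<times> b) \<inter> space N)"
        using a b by (intro emeasure_distr jm[OF N] pair_measureI)
      also have "?j -` (a \<times> b) \<inter> space N = {\<omega> \<in> space N. ?r n \<omega> \<in> a \<and> \<omega> (Suc n) \<in> b}" by auto
      also note eq
      also have "(\<integral>\<^sup>+\<omega>. indicator a (?r n \<omega>) * emeasure (A n (?r n \<omega>)) b \<partial>N) =
          (\<integral>\<^sup>+xs. indicator a xs * emeasure (A n xs) b \<partial>distr N (?P n) (?r n))"
        using rm[OF _ N, of n] Suc.prems m by (subst nn_integral_distr) auto
      finally show ?thesis .
    qed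
    have IH: "distr M (?P n) (?r n) = distr M' (?P n) (?r n)" by (rule Suc.IH) (use Suc.prems in simp)
    let ?G = "{a \<times> b | a b. a \<in> sets (?P n) \<and> b \<in> sets (borel_of (S (Suc n)))}"
    let ?\<Omega> = "space (?P n) \<times> space (borel_of (S (Suc n)))"
    have J: "distr M ?Q ?j = distr M' ?Q ?j"
    proof (rule measure_eqI_generator_eq[where E = ?G and \<Omega> = ?\<Omega> and A = "\<lambda>_. ?\<Omega>"])
      show "Int_stable ?G" by (rule Int_stable_pair_measure_generator)
      show "?G \<subseteq> Pow ?\<Omega>" by (rule pair_measure_closed)
      show "emeasure (distr M ?Q ?j) B = emeasure (distr M' ?Q ?j) B" if BG: "B \<in> ?G" for B
      proof -
        obtain a b where ab: "a \<in> sets (?P n)" "b \<in> sets (borel_of (S (Suc n)))" and B: "B = a \<times> b"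
          using BG by blast
        show ?thesis unfolding B rect[OF M k(1) ab] rect[OF M' k(2) ab] IH ..
      qed
      show "sets (distr M ?Q ?j) = sigma_sets ?\<Omega> ?G" "sets (distr M' ?Q ?j) = sigma_sets ?\<Omega> ?G"
        by (simp_all only: sets_distr sets_pair_measure)
      have "?\<Omega> \<in> ?G"
        by (intro CollectI exI[of _ "space (?P n)"] exI[of _ "space (borel_of (S (Suc n)))"] conjI refl sets.top)
      then show "range (\<lambda>_. ?\<Omega>) \<subseteq> ?G" by (rule image_subsetI)
      have "prob_space (distr M ?Q ?j)"
        using prob_measuresD(1)[OF M] jm[OF M] by (rule prob_space.prob_space_distr)
      then show "emeasure (distr M ?Q ?j) ?\<Omega> \<noteq> \<infinity>" for i :: nat
        using prob_space.emeasure_le_1[of "distr M ?Q ?j" ?\<Omega>] by (auto simp: top_unique)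
    qed auto
    let ?c = "\<lambda>(xs, x). xs(Suc n := x)"
    have cm: "?c \<in> ?Q \<rightarrow>\<^sub>M ?P (Suc n)"
    proof (rule measurable_borel_of_product)
      fix i assume i: "i \<in> {1..Suc n}"
      show "(\<lambda>q. ?c q i) \<in> ?Q \<rightarrow>\<^sub>M borel_of (S i)"
      proof (cases "i = Suc n")
        case True
        then show ?thesis by (simp add: case_prod_unfold)
      next
        case False
        have "(\<lambda>xs. xs i) \<in> ?P n \<rightarrow>\<^sub>M borel_of (S i)"
          using i False by (intro continuous_map_borel_of continuous_map_product_projection) auto
        from measurable_compose[OF measurable_fst this] show ?thesis
          using False by (simp add: case_prod_unfold)
      qed
    qed (use Suc.prems sc in \<open>auto simp: space_pair_measure PiE_def extensional_def\<close>)
    have "distr N (?P (Suc n)) (?r (Suc n)) = distr (distr N ?Q ?j) (?P (Suc n)) ?c"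
      if N: "N \<in> prob_measures (product_topology S {1..T})" for N
    proof -
      have eq: "?c \<circ> ?j = ?r (Suc n)" by (auto simp: fun_eq_iff)
      show ?thesis unfolding distr_distr[OF cm jm[OF N]] eq ..
    qed
    then show ?case using J by (simp only: M M')
  qed
  from this[OF order_refl] have eq: "distr M (?P T) (?r T) = distr M' (?P T) (?r T)" .
  have "distr N (?P T) (?r T) = N" if N: "N \<in> prob_measures (product_topology S {1..T})" for N
  proof -
    \<comment> \<open>Paths over \<open>{1..T}\<close> are extensional, so restricting them to all
      their indices changes nothing.\<close>
    have "distr N (?P T) (?r T) = distr N N (\<lambda>x. x)"
      using prob_measuresD[OF N] by (intro distr_cong) (auto simp: PiE_restrict)
    then show ?thesis by simp
  qed
  with eq M M' show ?thesis by metis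
qed

section \<open>The extended dynamic programming equation\<close>

lemma prob_measures_integral:
  fixes f :: "'a \<Rightarrow> real"
  assumes M: "M \<in> prob_measures S" and f: "f \<in> borel_measurable (borel_of S)" "\<And>x. x \<in> topspace S \<Longrightarrow> \<bar>f x\<bar> \<le> B"
  shows "integrable M f" "\<bar>\<integral>x. f x \<partial>M\<bar> \<le> B"
proof -
  interpret prob_space M by (rule prob_measuresD[OF M])
  have m: "f \<in> borel_measurable M" using f(1) measurable_cong_sets[OF prob_measuresD(2)[OF M] refl] by blast
  show int: "integrable M f"
    using f(2) m prob_measuresD(3)[OF M] by (intro integrable_const_bound[of _ B] AE_I2) auto
  have "\<bar>\<integral>x. f x \<partial>M\<bar> \<le> (\<integral>x. \<bar>f x\<bar> \<partial>M)" by (rule integral_abs_bound)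
  also have "\<dots> \<le> (\<integral>x. B \<partial>M)"
    using int f(2) prob_measuresD(3)[OF M] by (intro integral_mono) auto
  finally show "\<bar>\<integral>x. f x \<partial>M\<bar> \<le> B" by (simp add: prob_space)
qed

lemma second_countable_euclidean: "second_countable (euclidean :: 'a :: second_countable_topology topology)"
proof -
  obtain \<B> :: "'a set set" where \<B>: "countable \<B>" "topological_basis \<B>" using ex_countable_basis by auto
  show ?thesis
    unfolding second_countable_def
  proof (intro exI[of _ \<B>] conjI ballI allI impI \<B>(1))
    show "openin euclidean V" if "V \<in> \<B>" for V using topological_basis_open[OF \<B>(2) that] by simp
    fix U :: "'a set" and x assume "openin euclidean U \<and> x \<in> U"
    then show "\<exists>V\<in>\<B>. x \<in> V \<and> V \<subseteq> U" using topological_basisE[OF \<B>(2), of U x] by (metis open_openin)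
  qed
qed

lemma continuous_map_prod_measurable:
  assumes "second_countable S" "second_countable S'" "continuous_map (prod_topology S S') euclideanreal f"
  shows "f \<in> borel_measurable (borel_of S \<Otimes>\<^sub>M borel_of S')"
  using continuous_map_borel_measurable[OF assms(3)] measurable_cong_sets[OF sets_borel_of_prod[OF assms(1,2)] refl]
  by blast

lemma singleton_topspace_discrete: "topspace S = {a} \<Longrightarrow> S = discrete_topology {a}"
  by (metis discrete_topology_unique openin_topspace singletonD)

text \<open>The hypothesis gives measurability as a function of the whole past. To read it in the
  current state, the earlier coordinates are frozen along some path \<open>a\<close>, which exists
  because \<open>\<mu>\<close> is a probability; at time \<open>0\<close> the state space is one
  point.\<close>

lemma markov_kernel_measurable:
  assumes S0: "topspace (S 0) = {x0}" and sc: "\<And>i. i \<in> {1..T} \<Longrightarrow> second_countable (S i)"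
    and \<mu>: "\<mu> \<in> prob_measures (product_topology S {1..T})" and M: "markov_kernels T S x0 \<mu> \<kappa>" and t: "t < T"
  shows "\<kappa> t \<in> borel_of (S t) \<rightarrow>\<^sub>M prob_algebra (borel_of (S (Suc t)))"
proof -
  have k: "(\<lambda>xs. \<kappa> t (state_at x0 t xs)) \<in> borel_of (product_topology S {1..t}) \<rightarrow>\<^sub>M prob_algebra (borel_of (S (Suc t)))"
    using M t by (simp add: markov_kernels_def successive_kernels_def regular_cond_kernel_def)
  show ?thesis
  proof (cases "t = 0")
    case True
    have "(\<lambda>_. undefined) \<in> space (borel_of (product_topology S {1..t}))" by (simp add: True)
    from measurable_space[OF k this] have "\<kappa> 0 x0 \<in> space (prob_algebra (borel_of (S (Suc 0))))"
      by (simp add: True state_at_def)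
    then have "(\<lambda>_. \<kappa> 0 x0) \<in> borel_of (S 0) \<rightarrow>\<^sub>M prob_algebra (borel_of (S (Suc 0)))" by simp
    then show ?thesis
      unfolding True by (rule measurable_cong[THEN iffD1, rotated]) (simp add: S0)
  next
    case False
    have "space \<mu> \<noteq> {}" using prob_space.not_empty[OF prob_measuresD(1)[OF \<mu>]] .
    then obtain a where a: "a \<in> topspace (product_topology S {1..T})" using prob_measuresD(3)[OF \<mu>] by auto
    define e where "e x = (\<lambda>i. if i \<in> {1..t} then if i = t then x else a i else undefined)" for x
    have "e \<in> borel_of (S t) \<rightarrow>\<^sub>M borel_of (product_topology S {1..t})"
    proof (rule measurable_borel_of_product)
      fix i assume i: "i \<in> {1..t}"
      then have "a i \<in> topspace (S i)" using a t by (auto simp: PiE_iff)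
      then show "(\<lambda>x. e x i) \<in> borel_of (S t) \<rightarrow>\<^sub>M borel_of (S i)"
        using i by (cases "i = t") (auto simp: e_def)
    qed (use sc t in \<open>auto simp: e_def extensional_def\<close>)
    from measurable_compose[OF this k] show ?thesis
      using False by (simp add: e_def state_at_def)
  qed
qed

text \<open>Written for a map \<open>pr\<close> so that it applies to both components of a path of
  pairs. By \<open>eq\<close>, given the past of that component alone, its next state has law
  \<open>\<kappa>\<close>; its law therefore has the successive kernels of \<open>\<mu>\<close> and
  is \<open>\<mu>\<close>.\<close>

lemma marginal_law_eq:
  assumes sc: "\<And>i. i \<in> {1..T} \<Longrightarrow> second_countable (S i)"
    and \<mu>: "\<mu> \<in> prob_measures (product_topology S {1..T})" and M: "markov_kernels T S x0 \<mu> \<kappa>"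
    and \<pi>: "prob_space \<pi>" and pr: "pr \<in> \<pi> \<rightarrow>\<^sub>M borel_of (product_topology S {1..T})"
    and eq: "\<And>t A B. t < T \<Longrightarrow> A \<in> sets (borel_of (product_topology S {1..t})) \<Longrightarrow> B \<in> sets (borel_of (S (Suc t))) \<Longrightarrow>
      emeasure \<pi> {p \<in> space \<pi>. restrict (pr p) {1..t} \<in> A \<and> pr p (Suc t) \<in> B} =
      (\<integral>\<^sup>+p. indicator A (restrict (pr p) {1..t}) * emeasure (\<kappa> t (state_at x0 t (pr p))) B \<partial>\<pi>)"
  shows "distr \<pi> (borel_of (product_topology S {1..T})) pr = \<mu>"
proof -
  let ?P = "borel_of (product_topology S {1..T})"
  have "successive_kernels T S (distr \<pi> ?P pr) (\<lambda>t xs. \<kappa> t (state_at x0 t xs))"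
    unfolding successive_kernels_def regular_cond_kernel_def
  proof (intro allI impI conjI ballI)
    fix t assume t: "t < T"
    show k: "(\<lambda>xs. \<kappa> t (state_at x0 t xs)) \<in> borel_of (product_topology S {1..t}) \<rightarrow>\<^sub>M prob_algebra (borel_of (S (Suc t)))"
      using M t by (simp add: markov_kernels_def successive_kernels_def regular_cond_kernel_def)
    fix A B assume A: "A \<in> sets (borel_of (product_topology S {1..t}))" and B: "B \<in> sets (borel_of (S (Suc t)))"
    have rm: "(\<lambda>xs. restrict xs {1..t}) \<in> ?P \<rightarrow>\<^sub>M borel_of (product_topology S {1..t})"
    proof (rule measurable_borel_of_product)
      fix i assume i: "i \<in> {1..t}"
      then have "(\<lambda>xs. xs i) \<in> ?P \<rightarrow>\<^sub>M borel_of (S i)"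
        using t by (intro continuous_map_borel_of continuous_map_product_projection) auto
      then show "(\<lambda>xs. restrict xs {1..t} i) \<in> ?P \<rightarrow>\<^sub>M borel_of (S i)" using i by simp
    qed (use t sc in auto)
    have cm: "(\<lambda>xs. xs (Suc t)) \<in> ?P \<rightarrow>\<^sub>M borel_of (S (Suc t))"
      using t by (intro continuous_map_borel_of continuous_map_product_projection) auto
    let ?E = "{xs \<in> space ?P. restrict xs {1..t} \<in> A \<and> xs (Suc t) \<in> B}"
    have "?E = ((\<lambda>xs. restrict xs {1..t}) -` A \<inter> space ?P) \<inter> ((\<lambda>xs. xs (Suc t)) -` B \<inter> space ?P)" by auto
    then have S: "?E \<in> sets ?P" using measurable_sets[OF rm A] measurable_sets[OF cm B] by simp
    have "emeasure (distr \<pi> ?P pr) {xs \<in> space (distr \<pi> ?P pr). restrict xs {1..t} \<in> A \<and> xs (Suc t) \<in> B}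
        = emeasure \<pi> (pr -` ?E \<inter> space \<pi>)"
      using emeasure_distr[OF pr S] by (simp only: space_distr)
    also have "pr -` ?E \<inter> space \<pi> = {p \<in> space \<pi>. restrict (pr p) {1..t} \<in> A \<and> pr p (Suc t) \<in> B}"
      using measurable_space[OF pr] by auto
    also note eq[OF t A B]
    also have "(\<integral>\<^sup>+p. indicator A (restrict (pr p) {1..t}) * emeasure (\<kappa> t (state_at x0 t (pr p))) B \<partial>\<pi>) =
        (\<integral>\<^sup>+p. indicator A (restrict (pr p) {1..t}) * emeasure (\<kappa> t (state_at x0 t (restrict (pr p) {1..t}))) B \<partial>\<pi>)"
    proof -
      have "state_at x0 t (restrict xs {1..t}) = state_at x0 t xs" for xs by (simp add: state_at_def)
      then show ?thesis by simp
    qed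
    also have "\<dots> = (\<integral>\<^sup>+xs. indicator A (restrict xs {1..t}) * emeasure (\<kappa> t (state_at x0 t (restrict xs {1..t}))) B \<partial>distr \<pi> ?P pr)"
    proof -
      have "(\<lambda>xs. emeasure (\<kappa> t (state_at x0 t xs)) B) \<in> borel_measurable (borel_of (product_topology S {1..t}))"
        by (rule measurable_compose[OF measurable_prob_algebraD[OF k] measurable_emeasure_subprob_algebra[OF B]])
      then have "(\<lambda>xs. indicator A xs * emeasure (\<kappa> t (state_at x0 t xs)) B) \<in> borel_measurable (borel_of (product_topology S {1..t}))"
        using A by measurable
      from measurable_compose[OF rm this] show ?thesis by (subst nn_integral_distr[OF pr]) auto
    qed
    finally show "emeasure (distr \<pi> ?P pr) {xs \<in> space (distr \<pi> ?P pr). restrict xs {1..t} \<in> A \<and> xs (Suc t) \<in> B} =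
      (\<integral>\<^sup>+xs. indicator A (restrict xs {1..t}) * emeasure (\<kappa> t (state_at x0 t (restrict xs {1..t}))) B \<partial>distr \<pi> ?P pr)" .
  qed
  moreover have "distr \<pi> ?P pr \<in> prob_measures (product_topology S {1..T})"
    using prob_space.prob_space_distr[OF \<pi> pr] by (simp add: prob_measures_def)
  ultimately show ?thesis
    using M \<mu> sc unfolding markov_kernels_def
    by (intro law_determined_by_successive_kernels[where T = T and S = S and A = "\<lambda>t xs. \<kappa> t (state_at x0 t xs)"])
qed

locale markov_transport =
  fixes T :: nat and TX :: "nat \<Rightarrow> 'a topology" and TY :: "nat \<Rightarrow> 'b topology" and x0 :: 'a and y0 :: 'b
    and \<mu> :: "(nat \<Rightarrow> 'a) measure" and \<nu> :: "(nat \<Rightarrow> 'b) measure"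
    and \<kappa>\<mu> :: "nat \<Rightarrow> 'a \<Rightarrow> 'a measure" and \<kappa>\<nu> :: "nat \<Rightarrow> 'b \<Rightarrow> 'b measure"
    and c :: "nat \<Rightarrow> nat \<Rightarrow> ('a \<times> 'b) \<times> ('a \<times> 'b) \<Rightarrow> real" and h :: "'a \<times> 'b \<Rightarrow> real"
    and G :: "nat \<Rightarrow> ('a \<times> 'b) \<times> real \<Rightarrow> real"
  assumes Y_polish: "\<And>t. t \<in> {1..T} \<Longrightarrow> polish_topology (TY t)"
    and initial: "topspace (TX 0) = {x0}" "topspace (TY 0) = {y0}"
    and \<mu>: "\<mu> \<in> prob_measures (product_topology TX {1..T})"
    and \<nu>: "\<nu> \<in> prob_measures (product_topology TY {1..T})"
    and M1: "markov_kernels T TX x0 \<mu> \<kappa>\<mu>" "markov_kernels T TY y0 \<nu> \<kappa>\<nu>"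
    and A1: "\<And>t. t \<in> {1..T} \<Longrightarrow> topspace (TX t) \<noteq> {} \<and> finite (topspace (TX t)) \<and>
        TX t = discrete_topology (topspace (TX t))"
    and A2: "\<And>k i. k \<in> {1..T} \<Longrightarrow> i \<in> {0..T} \<Longrightarrow>
        continuous_map (prod_topology (states TX TY i) (states TX TY k)) euclideanreal (c k i) \<and>
        bounded (c k i ` (topspace (states TX TY i) \<times> topspace (states TX TY k)))"
    and A3: "continuous_map (states TX TY T) euclideanreal h" "bounded (h ` topspace (states TX TY T))"
    and A4: "\<And>t. t \<in> {0..T} \<Longrightarrow>
        continuous_map (prod_topology (states TX TY t) euclideanreal) euclideanreal (G t) \<and>
        bounded (G t ` (topspace (states TX TY t) \<times> UNIV))"

sublocale markov_transport \<subseteq> polish_states T TX TY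
proof
  fix t assume t: "t \<le> T"
  show "polish_topology (TX t)"
  proof (cases "t = 0")
    case True
    show ?thesis
      using polish_discrete_topology[of "{x0}"] singleton_topspace_discrete[OF initial(1)] by (simp add: True)
  next
    case False
    then have d: "TX t = discrete_topology (topspace (TX t))" "finite (topspace (TX t))" using A1[of t] t by auto
    show ?thesis by (subst d(1)) (intro polish_discrete_topology countable_finite d)
  qed
  show "polish_topology (TY t)"
  proof (cases "t = 0")
    case True
    show ?thesis
      using polish_discrete_topology[of "{y0}"] singleton_topspace_discrete[OF initial(2)] by (simp add: True)
  qed (use Y_polish t in auto)
qed

context markov_transport
begin

abbreviation "adm \<equiv> admissible TX TY \<kappa>\<mu> \<kappa>\<nu>"
abbreviation "bracket \<equiv> dp_bracket T TX TY c h G"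
abbreviation "val \<equiv> dp_value T TX TY \<kappa>\<mu> \<kappa>\<nu> c h G"
abbreviation "opt \<equiv> borel_optimizer T TX TY \<kappa>\<mu> \<kappa>\<nu> c h G"
abbreviation "marg \<equiv> marginal_at T TX TY"
abbreviation "bf \<equiv> b_fun T TX TY c"
abbreviation "gf \<equiv> g_fun T TX TY h"
abbreviation "obj \<equiv> objective T c h G"

definition kernels_from :: "(nat \<Rightarrow> 'a \<times> 'b \<Rightarrow> ('a \<times> 'b) measure) \<Rightarrow> nat \<Rightarrow> bool" where
  "kernels_from K t \<longleftrightarrow> (\<forall>s. t \<le> s \<and> s < T \<longrightarrow> kernel K s)"

lemma kernels_from_mono: "kernels_from K t \<Longrightarrow> t \<le> s \<Longrightarrow> kernels_from K s"
  by (auto simp: kernels_from_def)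

lemma sc_St: "t \<le> T \<Longrightarrow> second_countable (St t)"
  using polish_St by (simp add: polish_iff_second_countable)

lemma kernel_iff_weak:
  "t < T \<Longrightarrow> kernel K t \<longleftrightarrow> K t \<in> borel_of (St t) \<rightarrow>\<^sub>M borel_of (weak_topology (St (Suc t)))"
  by (simp add: kernel_def measurable_weak_topology_iff[OF polish_St])

lemma opt_kernel: "t < T \<Longrightarrow> opt K t \<Longrightarrow> kernel K t"
  by (simp add: kernel_iff_weak borel_optimizer_def)

lemma admissible_prob: "\<gamma> \<in> adm t z \<Longrightarrow> \<gamma> \<in> prob_measures (St (Suc t))"
  by (simp add: admissible_def couplings_def states_def)

section \<open>Measurability and boundedness of the costs\<close>

lemma c_measurable:
  assumes "k \<in> {1..T}" "i \<le> T"
  shows "c k i \<in> borel_measurable (borel_of (St i) \<Otimes>\<^sub>M borel_of (St k))"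
  using A2[of k i] assms by (intro continuous_map_prod_measurable sc_St) auto

lemma c_measurable_section:
  assumes "k \<in> {1..T}" "i \<le> T" "z \<in> topspace (St i)"
  shows "(\<lambda>w. c k i (z, w)) \<in> borel_measurable (borel_of (St k))"
  using measurable_compose[OF measurable_Pair1'[of z "borel_of (St i)"] c_measurable[OF assms(1,2)]] assms(3) by simp

lemma c_bounded:
  assumes "k \<in> {1..T}" "i \<le> T"
  obtains B where "\<And>z w. z \<in> topspace (St i) \<Longrightarrow> w \<in> topspace (St k) \<Longrightarrow> \<bar>c k i (z, w)\<bar> \<le> B"
proof -
  have "bounded (c k i ` (topspace (St i) \<times> topspace (St k)))" using A2[of k i] assms by auto
  then obtain B where "\<And>x. x \<in> topspace (St i) \<times> topspace (St k) \<Longrightarrow> \<bar>c k i x\<bar> \<le> B"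
    by (auto simp: bounded_iff)
  then show thesis by (intro that[of B]) auto
qed

lemma h_measurable: "h \<in> borel_measurable (borel_of (St T))"
  by (rule continuous_map_borel_measurable[OF A3(1)])

lemma h_bounded: obtains B where "\<And>w. w \<in> topspace (St T) \<Longrightarrow> \<bar>h w\<bar> \<le> B"
  using A3(2) by (auto simp: bounded_iff)

lemma G_measurable:
  assumes "t \<le> T" shows "G t \<in> borel_measurable (borel_of (St t) \<Otimes>\<^sub>M borel)"
proof -
  have "G t \<in> borel_measurable (borel_of (St t) \<Otimes>\<^sub>M borel_of euclideanreal)"
    using A4[of t] assms by (intro continuous_map_prod_measurable sc_St second_countable_euclidean) auto
  moreover have "measurable (borel_of (St t) \<Otimes>\<^sub>M borel_of euclideanreal) borel = measurable (borel_of (St t) \<Otimes>\<^sub>M borel) (borel :: real measure)"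
    by (intro measurable_cong_sets sets_pair_measure_cong refl sets_borel_of_euclidean)
  ultimately show ?thesis by simp
qed

lemma G_continuous:
  assumes "t \<le> T" "z \<in> topspace (St t)" shows "continuous_on UNIV (\<lambda>r. G t (z, r))"
proof -
  have "continuous_map euclideanreal (prod_topology (St t) euclideanreal) (\<lambda>r. (z, r))"
    using assms(2) by (simp add: continuous_map_pairwise comp_def)
  moreover have "continuous_map (prod_topology (St t) euclideanreal) euclideanreal (G t)"
    using A4[of t] assms(1) by simp
  ultimately have "continuous_map euclideanreal euclideanreal (G t \<circ> (\<lambda>r. (z, r)))"
    by (rule continuous_map_compose)
  then show ?thesis by (simp add: comp_def)
qed

lemma G_bounded:
  assumes "t \<le> T" obtains B where "\<And>z r. z \<in> topspace (St t) \<Longrightarrow> \<bar>G t (z, r)\<bar> \<le> B"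
proof -
  have "bounded (G t ` (topspace (St t) \<times> UNIV))" using A4[of t] assms by auto
  then obtain B where "\<And>x. x \<in> topspace (St t) \<times> UNIV \<Longrightarrow> \<bar>G t x\<bar> \<le> B"
    by (auto simp: bounded_iff)
  then show thesis by (intro that[of B]) auto
qed

section \<open>Marginals of concatenated kernels\<close>

lemma marg_eq: "marg K k s z = distr (concat K (T - s) s z) (borel_of (St k)) (path_at k)"
  by (simp add: marginal_at_def path_at_def[abs_def] case_prod_unfold)

lemma marg_measurable:
  assumes K: "kernels_from K s" and k: "s < k" "k \<le> T"
  shows "marg K k s \<in> borel_of (St s) \<rightarrow>\<^sub>M prob_algebra (borel_of (St k))"
proof -
  have "concat K (T - s) s \<in> borel_of (St s) \<rightarrow>\<^sub>M prob_algebra (borel_of (Pt (Suc s) T))"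
    using measurable_concat[of s "T - s" K] K k by (simp add: kernels_from_def)
  from measurable_compose[OF this measurable_distr_prob_space[OF measurable_path_at[of k "Suc s" T]]] k
  show ?thesis by (simp add: marg_eq[abs_def])
qed

lemma marg_prob:
  assumes "kernels_from K s" "s < k" "k \<le> T" "z \<in> topspace (St s)"
  shows "marg K k s z \<in> prob_measures (St k)"
  using measurable_space[OF marg_measurable[OF assms(1-3)]] assms(4)
  by (simp add: prob_measures_eq_space_prob_algebra)

lemma marg_integral:
  fixes f :: "'a \<times> 'b \<Rightarrow> real"
  assumes K: "kernels_from K s" and k: "s < k" "k \<le> T" and z: "z \<in> topspace (St s)"
    and f: "f \<in> borel_measurable (borel_of (St k))"
  shows "(\<integral>w. f w \<partial>marg K k s z) = (\<integral>p. f (path_at k p) \<partial>concat K (T - s) s z)"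
proof -
  have "sets (concat K (T - s) s z) = sets (borel_of (Pt (Suc s) T))"
    using concat_prob(2)[of s "T - s" K z] K k z by (simp add: kernels_from_def)
  then have "path_at k \<in> concat K (T - s) s z \<rightarrow>\<^sub>M borel_of (St k)"
    using measurable_path_at[of k "Suc s" T] k by (simp cong: measurable_cong_sets)
  then show ?thesis unfolding marg_eq using f by (subst integral_distr) auto
qed

text \<open>The tower property at the first step. For \<open>k = Suc t\<close> the state is already
  reached and the remaining kernels integrate to one.\<close>

lemma marg_step:
  fixes f :: "'a \<times> 'b \<Rightarrow> real"
  assumes K: "kernels_from K t" and k: "t < k" "k \<le> T" and z: "z \<in> topspace (St t)"
    and f: "f \<in> borel_measurable (borel_of (St k))" "\<And>w. w \<in> topspace (St k) \<Longrightarrow> \<bar>f w\<bar> \<le> B"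
  shows "(\<integral>w. f w \<partial>marg K k t z) = (\<integral>z'. (if k = Suc t then f z' else \<integral>w. f w \<partial>marg K k (Suc t) z') \<partial>K t z)"
proof -
  obtain n where n: "T - t = Suc n" using k by (cases "T - t") auto
  then have Tn: "t + Suc n = T" "T - Suc t = n" using k by auto
  have Kt: "kernel K t" and K': "kernels_from K (Suc t)" and Ks: "\<And>s. t \<le> s \<Longrightarrow> s < t + Suc n \<Longrightarrow> kernel K s"
    using K k Tn by (auto simp: kernels_from_def)
  have m: "(\<lambda>p. f (path_at k p)) \<in> borel_measurable (borel_of (Pt (Suc t) (t + Suc n)))"
    using k Tn by (intro measurable_compose[OF measurable_path_at f(1)]) auto
  have "(\<integral>w. f w \<partial>marg K k t z) = (\<integral>p. f (path_at k p) \<partial>concat K (Suc n) t z)"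
    using marg_integral[OF K k z f(1)] by (simp only: n)
  also have "\<dots> = (\<integral>z'. \<integral>p. f (path_at k (path_cons t z' p)) \<partial>concat K n (Suc t) z' \<partial>K t z)"
  proof (rule integral_concat_Suc[where B = B])
    show "\<bar>f (path_at k p)\<bar> \<le> B" if "p \<in> topspace (Pt (Suc t) (t + Suc n))" for p
      using k Tn by (intro f(2) path_at_in_St[OF that]) auto
  qed (use Ks Tn z m in auto)
  also have "\<dots> = (\<integral>z'. (if k = Suc t then f z' else \<integral>w. f w \<partial>marg K k (Suc t) z') \<partial>K t z)"
  proof (rule Bochner_Integration.integral_cong[OF refl])
    fix z' assume "z' \<in> space (K t z)"
    then have z': "z' \<in> topspace (St (Suc t))" using kernel_prob(3)[OF Kt z] by simp
    have "prob_space (concat K n (Suc t) z')" using concat_prob(1)[of "Suc t" n K z'] Ks Tn z' by simp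
    then have 1: "k = Suc t \<Longrightarrow> (\<integral>p. f (path_at k (path_cons t z' p)) \<partial>concat K n (Suc t) z') = f z'"
      by (simp add: path_at_cons prob_space.prob_space)
    have "k \<noteq> Suc t \<Longrightarrow> (\<integral>w. f w \<partial>marg K k (Suc t) z') = (\<integral>p. f (path_at k p) \<partial>concat K n (Suc t) z')"
      using marg_integral[OF K' _ k(2) z' f(1)] k by (simp add: Tn)
    with 1 show "(\<integral>p. f (path_at k (path_cons t z' p)) \<partial>concat K n (Suc t) z') =
        (if k = Suc t then f z' else \<integral>w. f w \<partial>marg K k (Suc t) z')"
      by (simp add: path_at_cons)
  qed
  finally show ?thesis .
qed

section \<open>Dependence on the kernels of later dates only\<close>

lemma marg_cong: "(\<And>s. t \<le> s \<Longrightarrow> K s = K' s) \<Longrightarrow> marg K k t z = marg K' k t z"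
  unfolding marg_eq using concat_kernels_cong[of t "T - t" K K' TX TY z] by simp

lemma bf_cong: "(\<And>s. t \<le> s \<Longrightarrow> K s = K' s) \<Longrightarrow> bf K k i t = bf K' k i t"
  using marg_cong[of t K K'] by (simp add: b_fun_def fun_eq_iff)

lemma gf_cong: "(\<And>s. t \<le> s \<Longrightarrow> K s = K' s) \<Longrightarrow> gf K t = gf K' t"
  using marg_cong[of t K K'] by (simp add: g_fun_def fun_eq_iff)

lemma bracket_cong: "(\<And>s. t < s \<Longrightarrow> K s = K' s) \<Longrightarrow> bracket K t z v \<gamma> = bracket K' t z v \<gamma>"
  using bf_cong[of "Suc t" K K'] gf_cong[of "Suc t" K K'] by (simp add: dp_bracket_def)

lemma val_cong: "(\<And>s. t < s \<Longrightarrow> K s = K' s) \<Longrightarrow> val K t z = val K' t z"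
proof (induction "T - t" arbitrary: t z)
  case 0
  then show ?case by (simp add: dp_value.simps[of _ _ _ _ _ _ _ _ _ t])
next
  case (Suc n)
  have "val K (Suc t) = val K' (Suc t)" using Suc by (intro ext Suc.hyps(1)) auto
  then show ?case
    using bracket_cong[of t K K'] Suc.prems by (simp add: dp_value.simps[of _ _ _ _ _ _ _ _ _ t])
qed

text \<open>This permits the backward construction: kernels at earlier dates can be inserted without
  spoiling an optimizer already found.\<close>

lemma opt_cong:
  assumes "\<And>s. t \<le> s \<Longrightarrow> K s = K' s" shows "opt K t \<longleftrightarrow> opt K' t"
proof -
  have "val K t = val K' t" "val K (Suc t) = val K' (Suc t)" using assms by (auto intro!: val_cong)
  moreover have "K t = K' t" "\<And>z v \<gamma>. bracket K t z v \<gamma> = bracket K' t z v \<gamma>" using assms by (auto intro!: bracket_cong)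
  ultimately show ?thesis unfolding borel_optimizer_def by simp
qed

section \<open>Measurability and bounds of the continuation terms\<close>

lemma gf_measurable:
  assumes "kernels_from K t" "t \<le> T" shows "gf K t \<in> borel_measurable (borel_of (St t))"
proof (cases "t = T")
  case True
  then show ?thesis using h_measurable by (simp add: g_fun_def[abs_def])
next
  case False
  then have "(\<lambda>z. \<integral>w. h w \<partial>marg K T t z) \<in> borel_measurable (borel_of (St t))"
    using assms h_measurable by (intro integral_kernel_measurable[OF _ marg_measurable]) auto
  then show ?thesis using False by (simp add: g_fun_def[abs_def])
qed

lemma gf_bounded:
  assumes "kernels_from K t" "t \<le> T" obtains B where "\<And>z. z \<in> topspace (St t) \<Longrightarrow> \<bar>gf K t z\<bar> \<le> B"
proof -
  obtain B where B: "\<And>w. w \<in> topspace (St T) \<Longrightarrow> \<bar>h w\<bar> \<le> B" using h_bounded by blast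
  have "\<bar>gf K t z\<bar> \<le> B" if "z \<in> topspace (St t)" for z
  proof (cases "t = T")
    case False
    then show ?thesis
      using prob_measures_integral(2)[OF marg_prob[OF assms(1) _ order_refl that] h_measurable B] assms(2)
      by (simp add: g_fun_def)
  qed (use B that in \<open>simp add: g_fun_def\<close>)
  then show thesis by (rule that)
qed

lemma bf_measurable:
  assumes K: "kernels_from K s" and k: "s < k" "k \<le> T" and i: "i \<le> T"
  shows "(\<lambda>(w, z). bf K k i s w z) \<in> borel_measurable (borel_of (St i) \<Otimes>\<^sub>M borel_of (St s))"
proof -
  have k': "k \<in> {1..T}" using k by auto
  have "(\<lambda>p. marg K k s (snd p)) \<in> borel_of (St i) \<Otimes>\<^sub>M borel_of (St s) \<rightarrow>\<^sub>M prob_algebra (borel_of (St k))"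
    by (rule measurable_compose[OF measurable_snd marg_measurable[OF K k]])
  moreover have m: "(\<lambda>q. (fst (fst q), snd q)) \<in> (borel_of (St i) \<Otimes>\<^sub>M borel_of (St s)) \<Otimes>\<^sub>M borel_of (St k)
      \<rightarrow>\<^sub>M borel_of (St i) \<Otimes>\<^sub>M borel_of (St k)" by measurable
  have "(\<lambda>(p, w'). c k i (fst p, w')) \<in> borel_measurable ((borel_of (St i) \<Otimes>\<^sub>M borel_of (St s)) \<Otimes>\<^sub>M borel_of (St k))"
    using measurable_compose[OF m c_measurable[OF k' i]] by (simp add: case_prod_unfold)
  ultimately have "(\<lambda>p. \<integral>w'. c k i (fst p, w') \<partial>marg K k s (snd p)) \<in> borel_measurable (borel_of (St i) \<Otimes>\<^sub>M borel_of (St s))"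
    by (intro integral_kernel_measurable)
  then show ?thesis by (simp add: b_fun_def case_prod_unfold)
qed

lemma bf_bounded:
  assumes K: "kernels_from K s" and k: "s < k" "k \<le> T" and i: "i \<le> T"
  obtains B where "\<And>w z. w \<in> topspace (St i) \<Longrightarrow> z \<in> topspace (St s) \<Longrightarrow> \<bar>bf K k i s w z\<bar> \<le> B"
proof -
  have k': "k \<in> {1..T}" using k by auto
  obtain B where B: "\<And>z w. z \<in> topspace (St i) \<Longrightarrow> w \<in> topspace (St k) \<Longrightarrow> \<bar>c k i (z, w)\<bar> \<le> B"
    using c_bounded[OF k' i] by blast
  show thesis
  proof (rule that)
    fix w z assume w: "w \<in> topspace (St i)" and z: "z \<in> topspace (St s)"
    show "\<bar>bf K k i s w z\<bar> \<le> B"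
      unfolding b_fun_def
      by (rule prob_measures_integral(2)[OF marg_prob[OF K k z] c_measurable_section[OF k' i w] B[OF w]])
  qed
qed

section \<open>Time consistency and cancellation in the bracket\<close>

definition running :: "(nat \<Rightarrow> 'a \<times> 'b \<Rightarrow> ('a \<times> 'b) measure) \<Rightarrow> nat \<Rightarrow> 'a \<times> 'b \<Rightarrow> 'a \<times> 'b \<Rightarrow> real" where
  "running K t z z' = c (Suc t) t (z, z') + (\<Sum>k=t+2..T. bf K k t (Suc t) z z')"

text \<open>The bracket of the dynamic programming equation after the correction terms have cancelled
  against the continuation value; it equals the objective of \<open>\<gamma>\<close> followed by \<open>K\<close>.\<close>

definition reduced :: "(nat \<Rightarrow> 'a \<times> 'b \<Rightarrow> ('a \<times> 'b) measure) \<Rightarrow> nat \<Rightarrow> 'a \<times> 'b \<Rightarrow> ('a \<times> 'b) measure \<Rightarrow> real" where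
  "reduced K t z \<gamma> = (\<integral>z'. running K t z z' \<partial>\<gamma>) + G t (z, \<integral>z'. gf K (Suc t) z' \<partial>\<gamma>)"

text \<open>The objective of \<open>K\<close> from time \<open>t\<close> on. At \<open>t = T\<close>
  the sum is empty and the terminal value of the dynamic programming equation remains, which starts
  the backward induction.\<close>

definition plan_value :: "(nat \<Rightarrow> 'a \<times> 'b \<Rightarrow> ('a \<times> 'b) measure) \<Rightarrow> nat \<Rightarrow> 'a \<times> 'b \<Rightarrow> real" where
  "plan_value K t z = (\<Sum>k=Suc t..T. bf K k t t z z) + G t (z, gf K t z)"

lemma running_measurable:
  assumes K: "kernels_from K (Suc t)" and t: "t < T"
  shows "(\<lambda>(z, z'). running K t z z') \<in> borel_measurable (borel_of (St t) \<Otimes>\<^sub>M borel_of (St (Suc t)))"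
proof -
  have "c (Suc t) t \<in> borel_measurable (borel_of (St t) \<Otimes>\<^sub>M borel_of (St (Suc t)))"
    using t by (intro c_measurable) auto
  moreover have "(\<lambda>p. bf K k t (Suc t) (fst p) (snd p)) \<in> borel_measurable (borel_of (St t) \<Otimes>\<^sub>M borel_of (St (Suc t)))"
    if "k \<in> {t+2..T}" for k
    using bf_measurable[OF K, of k t] that t by (simp add: case_prod_unfold)
  ultimately have "(\<lambda>p. c (Suc t) t (fst p, snd p) + (\<Sum>k=t+2..T. bf K k t (Suc t) (fst p) (snd p)))
      \<in> borel_measurable (borel_of (St t) \<Otimes>\<^sub>M borel_of (St (Suc t)))"
    by (intro borel_measurable_add borel_measurable_sum) simp_all
  then show ?thesis by (simp add: running_def case_prod_unfold)
qed

lemma running_bounded: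
  assumes K: "kernels_from K (Suc t)" and t: "t < T"
  obtains B where "\<And>z z'. z \<in> topspace (St t) \<Longrightarrow> z' \<in> topspace (St (Suc t)) \<Longrightarrow> \<bar>running K t z z'\<bar> \<le> B"
proof -
  obtain B0 where B0: "\<And>z z'. z \<in> topspace (St t) \<Longrightarrow> z' \<in> topspace (St (Suc t)) \<Longrightarrow> \<bar>c (Suc t) t (z, z')\<bar> \<le> B0"
    using c_bounded[of "Suc t" t] t by auto
  have "\<exists>B. \<forall>z z'. z \<in> topspace (St t) \<longrightarrow> z' \<in> topspace (St (Suc t)) \<longrightarrow> \<bar>bf K k t (Suc t) z z'\<bar> \<le> B"
    if k: "k \<in> {t+2..T}" for k
  proof -
    have k': "Suc t < k" "k \<le> T" "t \<le> T" using k t by auto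
    show ?thesis by (rule bf_bounded[OF K k']) blast
  qed
  then obtain B where B: "\<And>k z z'. k \<in> {t+2..T} \<Longrightarrow> z \<in> topspace (St t) \<Longrightarrow> z' \<in> topspace (St (Suc t)) \<Longrightarrow>
      \<bar>bf K k t (Suc t) z z'\<bar> \<le> B k" by metis
  show thesis
  proof (rule that)
    fix z z' assume z: "z \<in> topspace (St t)" "z' \<in> topspace (St (Suc t))"
    have "\<bar>\<Sum>k=t+2..T. bf K k t (Suc t) z z'\<bar> \<le> (\<Sum>k=t+2..T. \<bar>bf K k t (Suc t) z z'\<bar>)" by (rule sum_abs)
    also have "\<dots> \<le> (\<Sum>k=t+2..T. B k)" using B[OF _ z] by (rule sum_mono)
    finally show "\<bar>running K t z z'\<bar> \<le> B0 + (\<Sum>k=t+2..T. B k)"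
      using B0[OF z] unfolding running_def by linarith
  qed
qed

lemma running_integral:
  assumes K: "kernels_from K (Suc t)" and t: "t < T" and z: "z \<in> topspace (St t)" and \<gamma>: "\<gamma> \<in> prob_measures (St (Suc t))"
  shows "integrable \<gamma> (running K t z)" "integrable \<gamma> (\<lambda>z'. c (Suc t) t (z, z'))"
    "\<And>k. k \<in> {t+2..T} \<Longrightarrow> integrable \<gamma> (\<lambda>z'. bf K k t (Suc t) z z')"
proof -
  have t': "Suc t \<in> {1..T}" "t \<le> T" using t by auto
  obtain B where B: "\<And>z z'. z \<in> topspace (St t) \<Longrightarrow> z' \<in> topspace (St (Suc t)) \<Longrightarrow> \<bar>c (Suc t) t (z, z')\<bar> \<le> B"
    using c_bounded[OF t'] by blast
  show c: "integrable \<gamma> (\<lambda>z'. c (Suc t) t (z, z'))"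
    by (rule prob_measures_integral(1)[OF \<gamma> c_measurable_section[OF t' z] B[OF z]])
  show b: "integrable \<gamma> (\<lambda>z'. bf K k t (Suc t) z z')" if k: "k \<in> {t+2..T}" for k
  proof -
    have k': "Suc t < k" "k \<le> T" "t \<le> T" using k t by auto
    obtain B where B: "\<And>w z. w \<in> topspace (St t) \<Longrightarrow> z \<in> topspace (St (Suc t)) \<Longrightarrow> \<bar>bf K k t (Suc t) w z\<bar> \<le> B"
      using bf_bounded[OF K k'] by blast
    have "(\<lambda>z'. bf K k t (Suc t) z z') \<in> borel_measurable (borel_of (St (Suc t)))"
      using measurable_compose[OF measurable_Pair1'[of z "borel_of (St t)"] bf_measurable[OF K k']] z by simp
    then show ?thesis by (rule prob_measures_integral(1)[OF \<gamma> _ B[OF z]])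
  qed
  show "integrable \<gamma> (running K t z)"
    unfolding running_def[abs_def] using b c by (intro Bochner_Integration.integrable_add Bochner_Integration.integrable_sum)
qed

lemma bf_step:
  assumes K: "kernels_from K t" and t: "t < T" and z: "z \<in> topspace (St t)"
  shows "(\<Sum>k=Suc t..T. bf K k t t z z) = (\<integral>z'. running K t z z' \<partial>K t z)" and "gf K t z = (\<integral>z'. gf K (Suc t) z' \<partial>K t z)"
proof -
  have K': "kernels_from K (Suc t)" using K by (rule kernels_from_mono) simp
  have Kp: "K t z \<in> prob_measures (St (Suc t))"
    using K t z kernel_prob[of K t z] by (simp add: kernels_from_def prob_measures_def)
  have step: "bf K k t t z z = (\<integral>z'. (if k = Suc t then c k t (z, z') else bf K k t (Suc t) z z') \<partial>K t z)"
    if k: "k \<in> {Suc t..T}" for k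
  proof -
    have k': "k \<in> {1..T}" "t \<le> T" "t < k" "k \<le> T" using k t by auto
    obtain B where B: "\<And>z w. z \<in> topspace (St t) \<Longrightarrow> w \<in> topspace (St k) \<Longrightarrow> \<bar>c k t (z, w)\<bar> \<le> B"
      using c_bounded[OF k'(1,2)] by blast
    show ?thesis
      unfolding b_fun_def by (rule marg_step[OF K k'(3,4) z c_measurable_section[OF k'(1,2) z] B[OF z]])
  qed
  \<comment> \<open>The cost at the next date is evaluated at \<open>z'\<close> itself, while the
    later ones are still averaged over the continuation.\<close>
  have split: "{Suc t..T} = insert (Suc t) {t+2..T}" using t by auto
  have "(\<Sum>k=Suc t..T. bf K k t t z z) = bf K (Suc t) t t z z + (\<Sum>k=t+2..T. bf K k t t z z)"
    unfolding split by (subst sum.insert) auto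
  also have "bf K (Suc t) t t z z = (\<integral>z'. c (Suc t) t (z, z') \<partial>K t z)"
    using step[of "Suc t"] t by simp
  also have "(\<Sum>k=t+2..T. bf K k t t z z) = (\<Sum>k=t+2..T. \<integral>z'. bf K k t (Suc t) z z' \<partial>K t z)"
    by (intro sum.cong refl) (subst step, auto)
  also have "(\<integral>z'. c (Suc t) t (z, z') \<partial>K t z) + (\<Sum>k=t+2..T. \<integral>z'. bf K k t (Suc t) z z' \<partial>K t z)
      = (\<integral>z'. running K t z z' \<partial>K t z)"
  proof -
    note ri = running_integral[OF K' t z Kp]
    have "(\<integral>z'. running K t z z' \<partial>K t z)
        = (\<integral>z'. c (Suc t) t (z, z') \<partial>K t z) + (\<integral>z'. (\<Sum>k=t+2..T. bf K k t (Suc t) z z') \<partial>K t z)"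
      unfolding running_def by (intro Bochner_Integration.integral_add ri(2) Bochner_Integration.integrable_sum ri(3))
    also have "(\<integral>z'. (\<Sum>k=t+2..T. bf K k t (Suc t) z z') \<partial>K t z) = (\<Sum>k=t+2..T. \<integral>z'. bf K k t (Suc t) z z' \<partial>K t z)"
      by (intro Bochner_Integration.integral_sum ri(3))
    finally show ?thesis ..
  qed
  finally show "(\<Sum>k=Suc t..T. bf K k t t z z) = (\<integral>z'. running K t z z' \<partial>K t z)" .
  obtain B where B: "\<And>w. w \<in> topspace (St T) \<Longrightarrow> \<bar>h w\<bar> \<le> B" using h_bounded by blast
  have "gf K t z = (\<integral>w. h w \<partial>marg K T t z)" using t by (simp add: g_fun_def)
  also have "\<dots> = (\<integral>z'. (if T = Suc t then h z' else \<integral>w. h w \<partial>marg K T (Suc t) z') \<partial>K t z)"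
    by (rule marg_step[OF K t order_refl z h_measurable B])
  also have "\<dots> = (\<integral>z'. gf K (Suc t) z' \<partial>K t z)"
    by (rule Bochner_Integration.integral_cong) (auto simp: g_fun_def)
  finally show "gf K t z = (\<integral>z'. gf K (Suc t) z' \<partial>K t z)" .
qed

lemma plan_value_eq_reduced:
  "kernels_from K t \<Longrightarrow> t < T \<Longrightarrow> z \<in> topspace (St t) \<Longrightarrow> plan_value K t z = reduced K t z (K t z)"
  by (simp add: plan_value_def reduced_def bf_step)

lemma objective_eq_plan_value:
  assumes K: "kernels_from K t" and t: "t < T" and z: "z \<in> topspace (St t)"
  shows "obj t z (concat K (T - t) t z) = plan_value K t z"
proof -
  let ?P = "concat K (T - t) t z"
  have P: "?P \<in> prob_measures (Pt (Suc t) T)"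
    using concat_prob[of t "T - t" K z] K t z by (simp add: kernels_from_def prob_measures_def)
  have i: "integrable ?P (\<lambda>p. c k t (z, path_at k p))" and e: "(\<integral>p. c k t (z, path_at k p) \<partial>?P) = bf K k t t z z"
    if k: "k \<in> {Suc t..T}" for k
  proof -
    have k': "k \<in> {1..T}" "t \<le> T" "t < k" "k \<le> T" using k t by auto
    obtain B where B: "\<And>z w. z \<in> topspace (St t) \<Longrightarrow> w \<in> topspace (St k) \<Longrightarrow> \<bar>c k t (z, w)\<bar> \<le> B"
      using c_bounded[OF k'(1,2)] by blast
    show "integrable ?P (\<lambda>p. c k t (z, path_at k p))"
    proof (rule prob_measures_integral(1)[OF P])
      show "(\<lambda>p. c k t (z, path_at k p)) \<in> borel_measurable (borel_of (Pt (Suc t) T))"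
        using k by (intro measurable_compose[OF measurable_path_at c_measurable_section[OF k'(1,2) z]]) auto
      show "\<bar>c k t (z, path_at k p)\<bar> \<le> B" if "p \<in> topspace (Pt (Suc t) T)" for p
        using B[OF z path_at_in_St[OF that k]] .
    qed
    show "(\<integral>p. c k t (z, path_at k p) \<partial>?P) = bf K k t t z z"
      unfolding b_fun_def using marg_integral[OF K k'(3,4) z c_measurable_section[OF k'(1,2) z]] by simp
  qed
  have "(\<integral>p. (\<Sum>k=Suc t..T. c k t (z, path_at k p)) \<partial>?P) = (\<Sum>k=Suc t..T. bf K k t t z z)"
    using i e by (subst Bochner_Integration.integral_sum) auto
  moreover have "(\<integral>p. h (path_at T p) \<partial>?P) = gf K t z"
    using marg_integral[OF K t order_refl z h_measurable] t by (simp add: g_fun_def)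
  ultimately show ?thesis
    by (simp add: objective_def plan_value_def path_at_def case_prod_unfold)
qed

lemma plan_value_measurable:
  assumes K: "kernels_from K t" and t: "t \<le> T"
  shows "plan_value K t \<in> borel_measurable (borel_of (St t))"
proof -
  have "(\<lambda>z. bf K k t t z z) \<in> borel_measurable (borel_of (St t))" if "k \<in> {Suc t..T}" for k
  proof -
    have d: "(\<lambda>z. (z, z)) \<in> borel_of (St t) \<rightarrow>\<^sub>M borel_of (St t) \<Otimes>\<^sub>M borel_of (St t)" by simp
    show ?thesis using measurable_compose[OF d bf_measurable[OF K, of k t]] that t by simp
  qed
  moreover have "(\<lambda>z. (z, gf K t z)) \<in> borel_of (St t) \<rightarrow>\<^sub>M borel_of (St t) \<Otimes>\<^sub>M borel"
    using gf_measurable[OF K t] by simp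
  from measurable_compose[OF this G_measurable[OF t]]
  have "(\<lambda>z. G t (z, gf K t z)) \<in> borel_measurable (borel_of (St t))" .
  ultimately show ?thesis unfolding plan_value_def[abs_def] by (intro borel_measurable_add borel_measurable_sum)
qed

text \<open>The plan value at time \<open>Suc t\<close> consists of the terms \<open>b_k\<close> at
  equal states and of \<open>G\<close> at the next state, exactly what the bracket subtracts;
  integrability allows the cancellation. Agreement of \<open>v\<close> on the state space is enough,
  because \<open>\<gamma>\<close> lives there.\<close>

lemma bracket_eq_reduced:
  assumes K: "kernels_from K (Suc t)" and t: "t < T" and z: "z \<in> topspace (St t)"
    and \<gamma>: "\<gamma> \<in> prob_measures (St (Suc t))"
    and v: "\<And>z'. z' \<in> topspace (St (Suc t)) \<Longrightarrow> v z' = plan_value K (Suc t) z'"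
  shows "bracket K t z v \<gamma> = reduced K t z \<gamma>"
proof -
  let ?b = "\<lambda>z'. \<Sum>k=t+2..T. bf K k (Suc t) (Suc t) z' z'"
  let ?g = "\<lambda>z'. G (Suc t) (z', gf K (Suc t) z')"
  have t': "Suc t \<le> T" "Suc t \<in> {1..T}" "t \<le> T" using t by auto
  have sp: "space \<gamma> = topspace (St (Suc t))" by (rule prob_measuresD[OF \<gamma>])
  note ri = running_integral[OF K t z \<gamma>]
  obtain Bg where Bg: "\<And>z r. z \<in> topspace (St (Suc t)) \<Longrightarrow> \<bar>G (Suc t) (z, r)\<bar> \<le> Bg" using G_bounded[OF t'(1)] by blast
  have "(\<lambda>z. (z, gf K (Suc t) z)) \<in> borel_of (St (Suc t)) \<rightarrow>\<^sub>M borel_of (St (Suc t)) \<Otimes>\<^sub>M borel"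
    using gf_measurable[OF K t'(1)] by simp
  from measurable_compose[OF this G_measurable[OF t'(1)]]
  have gm: "?g \<in> borel_measurable (borel_of (St (Suc t)))" .
  have gi: "integrable \<gamma> ?g" by (rule prob_measures_integral(1)[OF \<gamma> gm Bg])
  have "integrable \<gamma> (\<lambda>z'. bf K k (Suc t) (Suc t) z' z')" if k: "k \<in> {t+2..T}" for k
  proof -
    have k': "Suc t < k" "k \<le> T" "Suc t \<le> T" using k t by auto
    obtain B where B: "\<And>w z. w \<in> topspace (St (Suc t)) \<Longrightarrow> z \<in> topspace (St (Suc t)) \<Longrightarrow> \<bar>bf K k (Suc t) (Suc t) w z\<bar> \<le> B"
      using bf_bounded[OF K k'] by blast
    have d: "(\<lambda>z. (z, z)) \<in> borel_of (St (Suc t)) \<rightarrow>\<^sub>M borel_of (St (Suc t)) \<Otimes>\<^sub>M borel_of (St (Suc t))" by simp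
    have "(\<lambda>z'. bf K k (Suc t) (Suc t) z' z') \<in> borel_measurable (borel_of (St (Suc t)))"
      using measurable_compose[OF d bf_measurable[OF K k']] by simp
    then show ?thesis by (rule prob_measures_integral(1)[OF \<gamma>]) (rule B)
  qed
  then have bi: "integrable \<gamma> ?b" by (intro Bochner_Integration.integrable_sum)
  have "(\<integral>z'. c (Suc t) t (z, z') + v z' \<partial>\<gamma>) = (\<integral>z'. c (Suc t) t (z, z') + (?b z' + ?g z') \<partial>\<gamma>)"
    by (rule Bochner_Integration.integral_cong) (simp_all add: v sp plan_value_def)
  also have "\<dots> = (\<integral>z'. c (Suc t) t (z, z') \<partial>\<gamma>) + ((\<integral>z'. ?b z' \<partial>\<gamma>) + (\<integral>z'. ?g z' \<partial>\<gamma>))"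
    using ri(2) bi gi by (simp add: Bochner_Integration.integral_add del: Bochner_Integration.integral_sum)
  finally have 1: "(\<integral>z'. c (Suc t) t (z, z') + v z' \<partial>\<gamma>) =
      (\<integral>z'. c (Suc t) t (z, z') \<partial>\<gamma>) + ((\<integral>z'. ?b z' \<partial>\<gamma>) + (\<integral>z'. ?g z' \<partial>\<gamma>))" .
  have 2: "(\<integral>z'. running K t z z' \<partial>\<gamma>) =
      (\<integral>z'. c (Suc t) t (z, z') \<partial>\<gamma>) + (\<integral>z'. (\<Sum>k=t+2..T. bf K k t (Suc t) z z') \<partial>\<gamma>)"
    unfolding running_def using ri(2,3)
    by (intro Bochner_Integration.integral_add Bochner_Integration.integrable_sum) auto
  show ?thesis unfolding dp_bracket_def reduced_def 2 using 1 by simp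
qed

text \<open>Backward induction: the infimum in \<open>dp_value\<close> is attained at
  \<open>K t z\<close>, where the reduced bracket is the plan value by the tower property.\<close>

lemma val_eq_plan_value:
  assumes K: "\<And>s. t \<le> s \<Longrightarrow> s < T \<Longrightarrow> opt K s" and t: "t \<le> T" and z: "z \<in> topspace (St t)"
  shows "val K t z = plan_value K t z"
  using assms
proof (induction "T - t" arbitrary: t z)
  case 0
  then have t: "t = T" by simp
  show ?case unfolding t by (subst dp_value.simps) (simp add: plan_value_def g_fun_def)
next
  case (Suc n)
  then have t: "t < T" by simp
  have kf: "kernels_from K t" using Suc.prems(1) opt_kernel by (auto simp: kernels_from_def)
  then have kf': "kernels_from K (Suc t)" by (rule kernels_from_mono) simp
  have o: "opt K t" using Suc.prems(1) t by simp
  have Kz: "K t z \<in> adm t z" "bracket K t z (val K (Suc t)) (K t z) = val K t z"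
    using o Suc.prems(3) by (auto simp: borel_optimizer_def)
  have "val K (Suc t) z' = plan_value K (Suc t) z'" if "z' \<in> topspace (St (Suc t))" for z'
    using Suc.hyps(2) Suc.prems t that by (intro Suc.hyps(1)) auto
  then have "bracket K t z (val K (Suc t)) (K t z) = reduced K t z (K t z)"
    by (rule bracket_eq_reduced[OF kf' t Suc.prems(3) admissible_prob[OF Kz(1)]])
  then show ?case using Kz(2) plan_value_eq_reduced[OF kf t Suc.prems(3)] by simp
qed

lemma opt_kernels_from: "(\<And>s. t \<le> s \<Longrightarrow> s < T \<Longrightarrow> opt K s) \<Longrightarrow> kernels_from K t"
  using opt_kernel by (auto simp: kernels_from_def)

lemma bracket_val_eq_reduced:
  assumes K: "\<And>s. t < s \<Longrightarrow> s < T \<Longrightarrow> opt K s" and t: "t < T" and z: "z \<in> topspace (St t)" and \<gamma>: "\<gamma> \<in> adm t z"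
  shows "bracket K t z (val K (Suc t)) \<gamma> = reduced K t z \<gamma>"
  using K t
  by (intro bracket_eq_reduced z admissible_prob[OF \<gamma>] opt_kernels_from val_eq_plan_value) auto

section \<open>Existence of optimizers\<close>

lemma \<kappa>_measurable:
  assumes t: "t < T"
  shows "\<kappa>\<mu> t \<in> borel_of (TX t) \<rightarrow>\<^sub>M prob_algebra (borel_of (TX (Suc t)))"
    "\<kappa>\<nu> t \<in> borel_of (TY t) \<rightarrow>\<^sub>M prob_algebra (borel_of (TY (Suc t)))"
  using second_countable_X second_countable_Y
  by (auto intro!: markov_kernel_measurable[OF initial(1) _ \<mu> M1(1) t] markov_kernel_measurable[OF initial(2) _ \<nu> M1(2) t])

text \<open>The later kernels are arbitrary optimizers: their measurability makes
  \<open>running\<close> and \<open>gf\<close> Borel, and their optimality lets the bracket be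
  replaced by \<open>reduced\<close>, to which the optimal coupling kernel applies.\<close>

lemma optimizer_exists:
  assumes t: "t < T" and K: "\<And>s. t < s \<Longrightarrow> s < T \<Longrightarrow> opt K s"
  shows "\<exists>k. opt (K(t := k)) t"
proof -
  have kf: "kernels_from K (Suc t)" using K by (intro opt_kernels_from) auto
  have t': "Suc t \<le> T" "t \<le> T" using t by auto
  obtain B where B: "\<And>z z'. z \<in> topspace (St t) \<Longrightarrow> z' \<in> topspace (St (Suc t)) \<Longrightarrow> \<bar>running K t z z'\<bar> \<le> B"
    using running_bounded[OF kf t] by blast
  obtain B' where B': "\<And>z. z \<in> topspace (St (Suc t)) \<Longrightarrow> \<bar>gf K (Suc t) z\<bar> \<le> B'"
    using gf_bounded[OF kf t'(1)] by blast
  have X: "TX (Suc t) = discrete_topology (topspace (TX (Suc t)))" "finite (topspace (TX (Suc t)))" "topspace (TX (Suc t)) \<noteq> {}"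
    using A1[of "Suc t"] t by auto
  have \<alpha>: "(\<lambda>z. \<kappa>\<mu> t (fst z)) \<in> borel_of (St t) \<rightarrow>\<^sub>M prob_algebra (borel_of (TX (Suc t)))"
    and \<beta>: "(\<lambda>z. \<kappa>\<nu> t (snd z)) \<in> borel_of (St t) \<rightarrow>\<^sub>M prob_algebra (borel_of (TY (Suc t)))"
    unfolding states_def
    by (rule measurable_compose[OF measurable_fst_snd_borel_of(1) \<kappa>_measurable(1)[OF t]]
        measurable_compose[OF measurable_fst_snd_borel_of(2) \<kappa>_measurable(2)[OF t]])+
  have Gm: "(\<lambda>(z, r). G t (z, r)) \<in> borel_measurable (borel_of (St t) \<Otimes>\<^sub>M borel)"
    using G_measurable[OF t'(2)] by simp
  obtain \<kappa> where \<kappa>: "\<kappa> \<in> borel_of (St t) \<rightarrow>\<^sub>M prob_algebra (borel_of (St (Suc t)))"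
    and adm: "\<And>z. z \<in> topspace (St t) \<Longrightarrow> \<kappa> z \<in> adm t z"
    and le: "\<And>z \<gamma>. z \<in> topspace (St t) \<Longrightarrow> \<gamma> \<in> adm t z \<Longrightarrow> reduced K t z (\<kappa> z) \<le> reduced K t z \<gamma>"
    using optimal_coupling_kernel[where F = "running K t" and g = "gf K (Suc t)" and H = "\<lambda>z r. G t (z, r)"
        and N = "borel_of (St t)" and B = B and B' = B',
        OF X second_countable_Y[OF t'(1)] \<alpha> \<beta> _ _ _ _ Gm]
      running_measurable[OF kf t] B gf_measurable[OF kf t'(1)] B' G_continuous[OF t'(2)]
    unfolding states_def[of TX TY "Suc t", symmetric] space_borel_of admissible_def reduced_def by blast
  let ?K = "K(t := \<kappa>)"
  have K': "opt ?K s" if "t < s" "s < T" for s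
    using K[OF that] opt_cong[of s ?K K] that by simp
  \<comment> \<open>For a given \<open>\<gamma>\<close> the functional looks only at kernels after
    \<open>t\<close>, so inserting \<open>\<kappa>\<close> at time \<open>t\<close> does not disturb
    what it minimizes.\<close>
  have red: "reduced ?K t z \<gamma> = reduced K t z \<gamma>" for z \<gamma>
    using bf_cong[of "Suc t" ?K K] gf_cong[of "Suc t" ?K K] by (simp add: reduced_def running_def)
  have br: "bracket ?K t z (val ?K (Suc t)) \<gamma> = reduced K t z \<gamma>" if "z \<in> topspace (St t)" "\<gamma> \<in> adm t z" for z \<gamma>
    using bracket_val_eq_reduced[OF K' t that] red by simp
  have "bracket ?K t z (val ?K (Suc t)) (\<kappa> z) = val ?K t z" if z: "z \<in> topspace (St t)" for z
  proof -
    have "val ?K t z = (INF \<gamma>\<in>adm t z. bracket ?K t z (val ?K (Suc t)) \<gamma>)"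
      using t by (subst dp_value.simps) simp
    also have "\<dots> = (INF \<gamma>\<in>adm t z. reduced K t z \<gamma>)" using br[OF z] by (intro INF_cong) auto
    also have "\<dots> = reduced K t z (\<kappa> z)"
      by (rule cInf_eq_minimum) (use adm[OF z] le[OF z] in auto)
    finally show ?thesis using br[OF z adm[OF z]] by simp
  qed
  then have "opt ?K t"
    using \<kappa> adm measurable_weak_topology_iff[OF polish_St[OF t'(1)], of \<kappa> "borel_of (St t)"]
    by (simp add: borel_optimizer_def)
  then show ?thesis by blast
qed

lemma optimizers_exist: "\<exists>K. \<forall>t<T. opt K t"
proof -
  \<comment> \<open>The number \<open>n\<close> counts the dates already treated, from the last one
    backwards.\<close>
  have "\<exists>K. \<forall>s. T - n \<le> s \<and> s < T \<longrightarrow> opt K s" if "n \<le> T" for n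
    using that
  proof (induction n)
    case (Suc n)
    then obtain K where K: "\<And>s. T - n \<le> s \<Longrightarrow> s < T \<Longrightarrow> opt K s" by auto
    let ?t = "T - Suc n"
    have t: "?t < T" using Suc.prems by simp
    have "opt K s" if "?t < s" "s < T" for s using K[of s] that by simp
    then obtain k where k: "opt (K(?t := k)) ?t" using optimizer_exists[OF t] by blast
    have "opt (K(?t := k)) s" if s: "?t \<le> s" "s < T" for s
    proof (cases "s = ?t")
      case False
      then have "opt K s" using s K[of s] by simp
      then show ?thesis using opt_cong[of s "K(?t := k)" K] s False by simp
    qed (use k in simp)
    then show ?case by blast
  qed auto
  from this[of T] show ?thesis by auto
qed

text \<open>A deviation \<open>\<gamma>\<close> is a kernel that is constant at time
  \<open>t\<close>, so the results on plans apply to it without change.\<close>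

lemma objective_deviation:
  assumes K: "kernels_from K (Suc t)" and t: "t < T" and z: "z \<in> topspace (St t)" and \<gamma>: "\<gamma> \<in> adm t z"
  shows "obj t z (concat (K(t := \<lambda>_. \<gamma>)) (T - t) t z) = reduced K t z \<gamma>"
proof -
  let ?K = "K(t := \<lambda>_. \<gamma>)"
  have "(\<lambda>_. \<gamma>) \<in> borel_of (St t) \<rightarrow>\<^sub>M prob_algebra (borel_of (St (Suc t)))"
    using admissible_prob[OF \<gamma>] by (intro measurable_const) (simp add: prob_measures_eq_space_prob_algebra)
  then have kf: "kernels_from ?K t" using K by (auto simp: kernels_from_def kernel_def)
  have red: "reduced ?K t z \<gamma> = reduced K t z \<gamma>" for z \<gamma>
    using bf_cong[of "Suc t" ?K K] gf_cong[of "Suc t" ?K K] by (simp add: reduced_def running_def)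
  show ?thesis
    using objective_eq_plan_value[OF kf t z] plan_value_eq_reduced[OF kf t z] red by simp
qed

section \<open>Marginals and equilibrium property of the concatenated plan\<close>

lemma initial_state: "(x0, y0) \<in> topspace (St 0)"
  by (simp add: topspace_St initial)

lemma state_in_St:
  assumes "p \<in> topspace (Pt 1 T)" "t \<le> T"
  shows "(state_at x0 t (fst p), state_at y0 t (snd p)) \<in> topspace (St t)"
  using path_at_in_St[OF assms(1), of t] assms(2) initial_state by (auto simp: state_at_def path_at_def)

text \<open>Under an admissible kernel the first component of the next state has law
  \<open>\<kappa>\<mu> t (fst z)\<close>, which does not see the second component. Testing the
  successive kernels of the plan on cylinders over the first components hence gives the conditional
  laws of \<open>\<mu>\<close>; the case of \<open>\<nu>\<close> is symmetric.\<close>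

lemma marginals_of_concat:
  assumes K: "\<And>t. t < T \<Longrightarrow> kernel K t"
    and adm: "\<And>t z. t < T \<Longrightarrow> z \<in> topspace (St t) \<Longrightarrow> K t z \<in> adm t z"
  defines "\<pi> \<equiv> concat K T 0 (x0, y0)"
  shows "distr \<pi> (borel_of (product_topology TX {1..T})) fst = \<mu>"
    "distr \<pi> (borel_of (product_topology TY {1..T})) snd = \<nu>"
proof -
  let ?PX = "borel_of (product_topology TX {1..T})"
  let ?PY = "borel_of (product_topology TY {1..T})"
  note pp = concat_prob[of 0 T K, OF _ _ initial_state, simplified, OF K, folded \<pi>_def]
  have spk: "successive_pair_kernels T TX TY \<pi> (\<lambda>t (xs, ys). K t (state_at x0 t xs, state_at y0 t ys))"
    unfolding \<pi>_def by (rule successive_pair_kernels_concat[OF K initial_state])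
  have fm: "fst \<in> \<pi> \<rightarrow>\<^sub>M ?PX" and sm: "snd \<in> \<pi> \<rightarrow>\<^sub>M ?PY"
    using measurable_fst_snd_borel_of[of "product_topology TX {1..T}" "product_topology TY {1..T}"]
      measurable_cong_sets[OF pp(2) refl] by (auto simp: paths_def)
  interpret prob_space \<pi> by (rule pp(1))
  have space: "p \<in> topspace (Pt 1 T)" if "p \<in> space \<pi>" for p using that pp(3) by simp
  have reg: "emeasure \<pi> {p \<in> space \<pi>. path_restrict 1 t p \<in> A \<and> path_at (Suc t) p \<in> B} =
      (\<integral>\<^sup>+p. indicator A (path_restrict 1 t p) * emeasure (K t (state_at x0 t (fst p), state_at y0 t (snd p))) B \<partial>\<pi>)"
    if t: "t < T" and A: "A \<in> sets (borel_of (Pt 1 t))" and B: "B \<in> sets (borel_of (St (Suc t)))" for t A B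
  proof -
    have r: "regular_cond_kernel \<pi> (Pt 1 t) (\<lambda>(xs, ys). (restrict xs {1..t}, restrict ys {1..t}))
        (St (Suc t)) (\<lambda>(xs, ys). (xs (Suc t), ys (Suc t))) (\<lambda>(xs, ys). K t (state_at x0 t xs, state_at y0 t ys))"
      using spk t by (simp add: successive_pair_kernels_def)
    then have "emeasure \<pi> {p \<in> space \<pi>. (case p of (xs, ys) \<Rightarrow> (restrict xs {1..t}, restrict ys {1..t})) \<in> A \<and>
          (case p of (xs, ys) \<Rightarrow> (xs (Suc t), ys (Suc t))) \<in> B} =
        (\<integral>\<^sup>+p. indicator A (case p of (xs, ys) \<Rightarrow> (restrict xs {1..t}, restrict ys {1..t})) *
          emeasure (case case p of (xs, ys) \<Rightarrow> (restrict xs {1..t}, restrict ys {1..t}) of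
            (xs, ys) \<Rightarrow> K t (state_at x0 t xs, state_at y0 t ys)) B \<partial>\<pi>)"
      using A B unfolding regular_cond_kernel_def by blast
    then show ?thesis
      by (cases "t = 0") (simp_all add: case_prod_unfold path_restrict_def path_at_def state_at_def)
  qed
  have Kc: "emeasure (K t z) (B \<times> topspace (TY (Suc t))) = emeasure (\<kappa>\<mu> t (fst z)) B"
    and Kc': "emeasure (K t z) (topspace (TX (Suc t)) \<times> B') = emeasure (\<kappa>\<nu> t (snd z)) B'"
    if t: "t < T" and z: "z \<in> topspace (St t)" and B: "B \<in> sets (borel_of (TX (Suc t)))"
      and B': "B' \<in> sets (borel_of (TY (Suc t)))" for t z B B'
  proof -
    note cp = couplingsD[OF adm[OF t z, unfolded admissible_def]]
    have m: "fst \<in> K t z \<rightarrow>\<^sub>M borel_of (TX (Suc t))" "snd \<in> K t z \<rightarrow>\<^sub>M borel_of (TY (Suc t))"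
      using measurable_fst_snd_borel_of[of "TX (Suc t)" "TY (Suc t)"] measurable_cong_sets[OF cp(2) refl] by auto
    have "fst -` B \<inter> space (K t z) = B \<times> topspace (TY (Suc t))" "snd -` B' \<inter> space (K t z) = topspace (TX (Suc t)) \<times> B'"
      using sets.sets_into_space[OF B] sets.sets_into_space[OF B'] cp(3) by auto
    then show "emeasure (K t z) (B \<times> topspace (TY (Suc t))) = emeasure (\<kappa>\<mu> t (fst z)) B"
      "emeasure (K t z) (topspace (TX (Suc t)) \<times> B') = emeasure (\<kappa>\<nu> t (snd z)) B'"
      using emeasure_distr[OF m(1) B] emeasure_distr[OF m(2) B'] cp(4,5) by auto
  qed
  have mX: "second_countable (product_topology TX {1..t})" and mY: "second_countable (product_topology TY {1..t})"
    if "t < T" for t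
    using that second_countable_X second_countable_Y by (auto intro!: second_countable_product_topology)
  have rect_paths: "A \<times> A' \<in> sets (borel_of (Pt 1 t))"
    if "t < T" "A \<in> sets (borel_of (product_topology TX {1..t}))" "A' \<in> sets (borel_of (product_topology TY {1..t}))" for t A A'
    unfolding paths_def sets_borel_of_prod[OF mX[OF that(1)] mY[OF that(1)]] using that by (intro pair_measureI)
  have rect_states: "B \<times> B' \<in> sets (borel_of (St (Suc t)))"
    if "t < T" "B \<in> sets (borel_of (TX (Suc t)))" "B' \<in> sets (borel_of (TY (Suc t)))" for t B B'
    using that unfolding states_def
    by (subst sets_borel_of_prod) (auto intro: second_countable_X second_countable_Y pair_measureI)
  have st: "(state_at x0 t (fst p), state_at y0 t (snd p)) \<in> topspace (St t)" if "t < T" "p \<in> space \<pi>" for t p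
    using state_in_St[OF space[OF that(2)]] that(1) by simp
  have PtX: "restrict (fst p) {1..t} \<in> topspace (product_topology TX {1..t})" "fst p (Suc t) \<in> topspace (TX (Suc t))"
    and PtY: "restrict (snd p) {1..t} \<in> topspace (product_topology TY {1..t})" "snd p (Suc t) \<in> topspace (TY (Suc t))"
    if "t < T" "p \<in> space \<pi>" for t p
    using space[OF that(2)] that(1) by (auto simp: topspace_Pt PiE_iff)
  show "distr \<pi> ?PX fst = \<mu>"
  proof (rule marginal_law_eq[OF _ \<mu> M1(1) pp(1) fm])
    fix t A B assume t: "t < T" and A: "A \<in> sets (borel_of (product_topology TX {1..t}))" and B: "B \<in> sets (borel_of (TX (Suc t)))"
    let ?A = "A \<times> topspace (product_topology TY {1..t})"
    let ?B = "B \<times> topspace (TY (Suc t))"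
    have mem: "path_restrict 1 t p \<in> ?A \<longleftrightarrow> restrict (fst p) {1..t} \<in> A" "path_at (Suc t) p \<in> ?B \<longleftrightarrow> fst p (Suc t) \<in> B"
      if "p \<in> space \<pi>" for p
      using PtY[OF t that] by (simp_all add: path_restrict_def path_at_def)
    have "{p \<in> space \<pi>. restrict (fst p) {1..t} \<in> A \<and> fst p (Suc t) \<in> B} =
        {p \<in> space \<pi>. path_restrict 1 t p \<in> ?A \<and> path_at (Suc t) p \<in> ?B}"
      using mem by (intro Collect_cong conj_cong refl) simp_all
    also have "emeasure \<pi> \<dots> = (\<integral>\<^sup>+p. indicator ?A (path_restrict 1 t p) *
        emeasure (K t (state_at x0 t (fst p), state_at y0 t (snd p))) ?B \<partial>\<pi>)"
      by (rule reg[of t ?A ?B, OF t rect_paths[OF t A openin_borel_of[OF openin_topspace]]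
            rect_states[OF t B openin_borel_of[OF openin_topspace]]])
    also have "\<dots> = (\<integral>\<^sup>+p. indicator A (restrict (fst p) {1..t}) * emeasure (\<kappa>\<mu> t (state_at x0 t (fst p))) B \<partial>\<pi>)"
    proof (rule nn_integral_cong)
      fix p assume p: "p \<in> space \<pi>"
      have i: "indicator ?A (path_restrict 1 t p) = (indicator A (restrict (fst p) {1..t}) :: ennreal)"
        using mem(1)[OF p] by (simp only: indicator_def)
      show "indicator ?A (path_restrict 1 t p) * emeasure (K t (state_at x0 t (fst p), state_at y0 t (snd p))) ?B =
          indicator A (restrict (fst p) {1..t}) * emeasure (\<kappa>\<mu> t (state_at x0 t (fst p))) B"
        unfolding i Kc[OF t st[OF t p] B sets.empty_sets] fst_conv ..
    qed
    finally show "emeasure \<pi> {p \<in> space \<pi>. restrict (fst p) {1..t} \<in> A \<and> fst p (Suc t) \<in> B} =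
      (\<integral>\<^sup>+p. indicator A (restrict (fst p) {1..t}) * emeasure (\<kappa>\<mu> t (state_at x0 t (fst p))) B \<partial>\<pi>)" .
  qed (use second_countable_X in auto)
  show "distr \<pi> ?PY snd = \<nu>"
  proof (rule marginal_law_eq[OF _ \<nu> M1(2) pp(1) sm])
    fix t A B assume t: "t < T" and A: "A \<in> sets (borel_of (product_topology TY {1..t}))" and B: "B \<in> sets (borel_of (TY (Suc t)))"
    let ?A = "topspace (product_topology TX {1..t}) \<times> A"
    let ?B = "topspace (TX (Suc t)) \<times> B"
    have mem: "path_restrict 1 t p \<in> ?A \<longleftrightarrow> restrict (snd p) {1..t} \<in> A" "path_at (Suc t) p \<in> ?B \<longleftrightarrow> snd p (Suc t) \<in> B"
      if "p \<in> space \<pi>" for p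
      using PtX[OF t that] by (simp_all add: path_restrict_def path_at_def)
    have "{p \<in> space \<pi>. restrict (snd p) {1..t} \<in> A \<and> snd p (Suc t) \<in> B} =
        {p \<in> space \<pi>. path_restrict 1 t p \<in> ?A \<and> path_at (Suc t) p \<in> ?B}"
      using mem by (intro Collect_cong conj_cong refl) simp_all
    also have "emeasure \<pi> \<dots> = (\<integral>\<^sup>+p. indicator ?A (path_restrict 1 t p) *
        emeasure (K t (state_at x0 t (fst p), state_at y0 t (snd p))) ?B \<partial>\<pi>)"
      by (rule reg[of t ?A ?B, OF t rect_paths[OF t openin_borel_of[OF openin_topspace] A]
            rect_states[OF t openin_borel_of[OF openin_topspace] B]])
    also have "\<dots> = (\<integral>\<^sup>+p. indicator A (restrict (snd p) {1..t}) * emeasure (\<kappa>\<nu> t (state_at y0 t (snd p))) B \<partial>\<pi>)"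
    proof (rule nn_integral_cong)
      fix p assume p: "p \<in> space \<pi>"
      have i: "indicator ?A (path_restrict 1 t p) = (indicator A (restrict (snd p) {1..t}) :: ennreal)"
        using mem(1)[OF p] by (simp only: indicator_def)
      show "indicator ?A (path_restrict 1 t p) * emeasure (K t (state_at x0 t (fst p), state_at y0 t (snd p))) ?B =
          indicator A (restrict (snd p) {1..t}) * emeasure (\<kappa>\<nu> t (state_at y0 t (snd p))) B"
        unfolding i Kc'[OF t st[OF t p] sets.empty_sets B] snd_conv ..
    qed
    finally show "emeasure \<pi> {p \<in> space \<pi>. restrict (snd p) {1..t} \<in> A \<and> snd p (Suc t) \<in> B} =
      (\<integral>\<^sup>+p. indicator A (restrict (snd p) {1..t}) * emeasure (\<kappa>\<nu> t (state_at y0 t (snd p))) B \<partial>\<pi>)" .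
  qed (use second_countable_Y in auto)
qed

text \<open>The objective of a deviation is \<open>reduced\<close>, which is the bracket at the
  value function; so the infimum over deviations is \<open>val\<close>, and \<open>K\<close> attains
  it. Admissibility and this equality hold at every state, from which the almost sure statements
  follow.\<close>

lemma concat_equilibrium:
  assumes K: "\<And>t. t < T \<Longrightarrow> opt K t"
  shows "equilibrium_transport T TX TY x0 y0 \<mu> \<nu> \<kappa>\<mu> \<kappa>\<nu> c h G (concat K T 0 (x0, y0)) K"
proof -
  let ?\<pi> = "concat K T 0 (x0, y0)"
  let ?L = "\<lambda>t (xs, ys). K t (state_at x0 t xs, state_at y0 t ys)"
  have Kk: "kernel K t" if "t < T" for t using K opt_kernel that by blast
  have adm: "K t z \<in> adm t z" and val: "bracket K t z (val K (Suc t)) (K t z) = val K t z"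
    if "t < T" "z \<in> topspace (St t)" for t z
    using K[OF that(1)] that(2) by (auto simp: borel_optimizer_def)
  note pp = concat_prob[of 0 T K, OF _ _ initial_state, simplified, OF Kk]
  have spk: "successive_pair_kernels T TX TY ?\<pi> ?L"
    by (rule successive_pair_kernels_concat[OF Kk initial_state])
  have st: "(state_at x0 t (fst p), state_at y0 t (snd p)) \<in> topspace (St t)" if "t < T" "p \<in> space ?\<pi>" for t p
    using state_in_St[of p t] that pp(3) by simp
  have "?\<pi> \<in> couplings (product_topology TX {1..T}) (product_topology TY {1..T}) \<mu> \<nu>"
    using pp marginals_of_concat[OF Kk adm] by (simp add: couplings_def prob_measures_def paths_def)
  moreover have "AE (xs, ys) in ?\<pi>. ?L t (restrict xs {1..t}, restrict ys {1..t})
        \<in> couplings (TX (Suc t)) (TY (Suc t)) (\<kappa>\<mu> t (state_at x0 t (restrict xs {1..t}))) (\<kappa>\<nu> t (state_at y0 t (restrict ys {1..t})))"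
    if t: "t < T" for t
  proof (rule AE_I2)
    fix p assume p: "p \<in> space ?\<pi>"
    have "state_at a t (restrict f {1..t}) = state_at a t f" for a :: 'a and f by (simp add: state_at_def)
    moreover have "state_at a t (restrict f {1..t}) = state_at a t f" for a :: 'b and f by (simp add: state_at_def)
    ultimately show "case p of (xs, ys) \<Rightarrow> ?L t (restrict xs {1..t}, restrict ys {1..t})
        \<in> couplings (TX (Suc t)) (TY (Suc t)) (\<kappa>\<mu> t (state_at x0 t (restrict xs {1..t}))) (\<kappa>\<nu> t (state_at y0 t (restrict ys {1..t})))"
      using adm[OF t st[OF t p]] by (simp add: case_prod_unfold admissible_def)
  qed
  ultimately have bic: "bicausal T TX TY \<mu> \<nu> (\<lambda>t xs. \<kappa>\<mu> t (state_at x0 t xs)) (\<lambda>t ys. \<kappa>\<nu> t (state_at y0 t ys)) ?\<pi>"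
    unfolding bicausal_def using spk by blast
  have eq: "(INF \<gamma>\<in>adm t z. obj t z (concat (K(t := \<lambda>_. \<gamma>)) (T - t) t z)) = obj t z (concat K (T - t) t z)"
    if t: "t < T" and z: "z \<in> topspace (St t)" for t z
  proof -
    have kf: "kernels_from K t" "kernels_from K (Suc t)" using Kk by (auto simp: kernels_from_def)
    have Kt: "opt K s" if "t < s" "s < T" for s using K that by blast
    have "(INF \<gamma>\<in>adm t z. obj t z (concat (K(t := \<lambda>_. \<gamma>)) (T - t) t z)) = (INF \<gamma>\<in>adm t z. bracket K t z (val K (Suc t)) \<gamma>)"
      using objective_deviation[OF kf(2) t z] bracket_val_eq_reduced[OF Kt t z] by (intro INF_cong refl) simp
    also have "\<dots> = val K t z" using t by (subst dp_value.simps) simp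
    also have "\<dots> = reduced K t z (K t z)"
      using val[OF t z] bracket_val_eq_reduced[OF Kt t z adm[OF t z]] by simp
    also have "\<dots> = obj t z (concat K (T - t) t z)"
      using objective_eq_plan_value[OF kf(1) t z] plan_value_eq_reduced[OF kf(1) t z] by simp
    finally show ?thesis .
  qed
  have "AE (xs, ys) in ?\<pi>. let z = (state_at x0 t xs, state_at y0 t ys) in
        (INF \<gamma>\<in>adm t z. obj t z (concat (K(t := \<lambda>_. \<gamma>)) (T - t) t z)) = obj t z (concat K (T - t) t z)"
    if t: "t < T" for t
    using eq[OF t st[OF t]] by (intro AE_I2) (simp add: case_prod_unfold Let_def)
  then show ?thesis
    unfolding equilibrium_transport_def using bic spk by blast
qed

text \<open>An infimum over a possibly uncountable set of couplings is not visibly measurable; the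
  identification with \<open>plan_value\<close> replaces it by integrals against kernels.\<close>

lemma val_measurable:
  assumes K: "\<And>t. t < T \<Longrightarrow> opt K t" and t: "t \<le> T"
  shows "val K t \<in> borel_measurable (borel_of (St t))"
proof -
  have "plan_value K t \<in> borel_measurable (borel_of (St t))"
    using K by (intro plan_value_measurable opt_kernels_from t)
  moreover have "val K t z = plan_value K t z" if "z \<in> space (borel_of (St t))" for z
    using K t that by (intro val_eq_plan_value) auto
  ultimately show ?thesis
    using measurable_cong[of "borel_of (St t)" "val K t" "plan_value K t" borel] by simp
qed

text \<open>Two successive refinements, one for each map. The second keeps the first map continuous,
  since refining the topology of the domain preserves continuity.\<close>

lemma continuous_in_finer_topology:
  assumes K: "\<And>t. t < T \<Longrightarrow> opt K t" and t: "t < T"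
  obtains Z where "finer_polish (St t) Z" "continuous_map Z (weak_topology (St (Suc t))) (K t)"
    "continuous_map Z euclideanreal (val K t)"
proof -
  have "K t \<in> borel_of (St t) \<rightarrow>\<^sub>M borel_of (weak_topology (St (Suc t)))"
    using K[OF t] by (simp add: borel_optimizer_def)
  then obtain Z where Z: "finer_polish (St t) Z" "continuous_map Z (weak_topology (St (Suc t))) (K t)"
    using finer_polish_continuous_map[OF polish_St second_countable_weak_topology[OF polish_St]] t by (metis Suc_leI less_imp_le)
  have pZ: "polish_topology Z" and top: "topspace Z = topspace (St t)" and op: "\<And>U. openin (St t) U \<Longrightarrow> openin Z U"
    using Z(1) by (auto simp: finer_polish_def)
  \<comment> \<open>Refinement loses no Borel sets, so the value function stays measurable for
    \<open>Z\<close> and the next refinement can start there.\<close>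
  have "(\<lambda>z. z) \<in> borel_of Z \<rightarrow>\<^sub>M borel_of (St t)"
    using openin_subset op by (intro continuous_map_borel_of) (auto simp: continuous_map_def top Int_absorb1 Collect_conj_eq)
  from measurable_compose[OF this val_measurable[OF K]] t
  have "val K t \<in> borel_measurable (borel_of Z)" by simp
  then have "val K t \<in> borel_of Z \<rightarrow>\<^sub>M borel_of euclideanreal"
    using measurable_cong_sets[OF refl sets_borel_of_euclidean] by blast
  then obtain Z' where Z': "finer_polish Z Z'" "continuous_map Z' euclideanreal (val K t)"
    using finer_polish_continuous_map[OF pZ second_countable_euclidean] by blast
  have "continuous_map Z' (weak_topology (St (Suc t))) (K t)"
    using Z(2) Z'(1) by (simp add: continuous_map_def finer_polish_def)
  then show thesis using that[OF finer_polish_trans[OF Z(1) Z'(1)]] Z'(2) by blast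
qed

end

theorem lemma3p3:
  fixes T :: nat
    and TX TY :: "nat \<Rightarrow> (real ^ 'd::finite) topology"
    and x0 y0 :: "real ^ 'd"
    and \<mu> \<nu> :: "(nat \<Rightarrow> real ^ 'd) measure"
    and \<kappa>\<mu> \<kappa>\<nu> :: "nat \<Rightarrow> real ^ 'd \<Rightarrow> (real ^ 'd) measure"
    and c :: "nat \<Rightarrow> nat \<Rightarrow> ((real ^ 'd) \<times> (real ^ 'd)) \<times> ((real ^ 'd) \<times> (real ^ 'd)) \<Rightarrow> real"
    and h :: "(real ^ 'd) \<times> (real ^ 'd) \<Rightarrow> real"
    and G :: "nat \<Rightarrow> ((real ^ 'd) \<times> (real ^ 'd)) \<times> real \<Rightarrow> real"
  assumes T: "1 \<le> T"
    and X_space: "\<And>t. t \<in> {1..T} \<Longrightarrow> closed (topspace (TX t)) \<and> polish_topology (TX t)"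
    and Y_space: "\<And>t. t \<in> {1..T} \<Longrightarrow> closed (topspace (TY t)) \<and> polish_topology (TY t)"
    and initial: "topspace (TX 0) = {x0}" "topspace (TY 0) = {y0}"
    and \<mu>: "\<mu> \<in> prob_measures (product_topology TX {1..T})"
    and \<nu>: "\<nu> \<in> prob_measures (product_topology TY {1..T})"
    and M1: "markov_kernels T TX x0 \<mu> \<kappa>\<mu>" "markov_kernels T TY y0 \<nu> \<kappa>\<nu>"
    and M2: "\<And>t. t \<in> {1..<T} \<Longrightarrow>
        \<kappa>\<nu> t \<in> borel_of (TY t) \<rightarrow>\<^sub>M borel_of (weak_topology (TY (Suc t)))"
    and A1: "\<And>t. t \<in> {1..T} \<Longrightarrow> topspace (TX t) \<noteq> {} \<and> finite (topspace (TX t)) \<and>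
        TX t = discrete_topology (topspace (TX t))"
    and A2: "\<And>k i. k \<in> {1..T} \<Longrightarrow> i \<in> {0..T} \<Longrightarrow>
        continuous_map (prod_topology (states TX TY i) (states TX TY k)) euclideanreal (c k i) \<and>
        bounded (c k i ` (topspace (states TX TY i) \<times> topspace (states TX TY k)))"
    and A3: "continuous_map (states TX TY T) euclideanreal h"
        "bounded (h ` topspace (states TX TY T))"
    and A4: "\<And>t. t \<in> {0..T} \<Longrightarrow>
        continuous_map (prod_topology (states TX TY t) euclideanreal) euclideanreal (G t) \<and>
        bounded (G t ` (topspace (states TX TY t) \<times> UNIV))"
  shows "(\<forall>t<T. \<forall>K. (\<forall>s. t < s \<and> s < T \<longrightarrow> borel_optimizer T TX TY \<kappa>\<mu> \<kappa>\<nu> c h G K s) \<longrightarrow>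
            (\<exists>k. borel_optimizer T TX TY \<kappa>\<mu> \<kappa>\<nu> c h G (K(t := k)) t))
       \<and> (\<exists>K. \<forall>t<T. borel_optimizer T TX TY \<kappa>\<mu> \<kappa>\<nu> c h G K t)
       \<and> (\<forall>K. (\<forall>t<T. borel_optimizer T TX TY \<kappa>\<mu> \<kappa>\<nu> c h G K t) \<longrightarrow>
            equilibrium_transport T TX TY x0 y0 \<mu> \<nu> \<kappa>\<mu> \<kappa>\<nu> c h G
              (concat_kernels TX TY K T 0 (x0, y0)) K
          \<and> (\<forall>t\<le>T. dp_value T TX TY \<kappa>\<mu> \<kappa>\<nu> c h G K t \<in> borel_measurable (borel_of (states TX TY t)))
          \<and> (\<forall>t<T. \<exists>Z. polish_topology Z \<and> topspace Z = topspace (states TX TY t) \<and>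
                (\<forall>U. openin (states TX TY t) U \<longrightarrow> openin Z U) \<and>
                continuous_map Z (weak_topology (states TX TY (Suc t))) (K t) \<and>
                continuous_map Z euclideanreal (dp_value T TX TY \<kappa>\<mu> \<kappa>\<nu> c h G K t)))"
proof -
  interpret markov_transport T TX TY x0 y0 \<mu> \<nu> \<kappa>\<mu> \<kappa>\<nu> c h G
    by (rule markov_transport.intro)
       (rule conjunct2[OF Y_space] initial \<mu> \<nu> M1 A1 A2 A3 A4 | assumption)+
  show ?thesis
  proof (intro conjI allI impI)
    fix t K assume "t < T" "\<forall>s. t < s \<and> s < T \<longrightarrow> opt K s"
    then show "\<exists>k. opt (K(t := k)) t" by (intro optimizer_exists) auto
  next
    show "\<exists>K. \<forall>t<T. opt K t" by (rule optimizers_exist)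
  next
    fix K assume K: "\<forall>t<T. opt K t"
    show "equilibrium_transport T TX TY x0 y0 \<mu> \<nu> \<kappa>\<mu> \<kappa>\<nu> c h G (concat K T 0 (x0, y0)) K"
      using K by (intro concat_equilibrium) auto
    show "val K t \<in> borel_measurable (borel_of (St t))" if "t \<le> T" for t
      using K that by (intro val_measurable) auto
    fix t assume t: "t < T"
    obtain Z where "finer_polish (St t) Z" "continuous_map Z (weak_topology (St (Suc t))) (K t)"
      "continuous_map Z euclideanreal (val K t)"
      using continuous_in_finer_topology[of K t] K t by blast
    then show "\<exists>Z. polish_topology Z \<and> topspace Z = topspace (St t) \<and> (\<forall>U. openin (St t) U \<longrightarrow> openin Z U) \<and>
        continuous_map Z (weak_topology (St (Suc t))) (K t) \<and> continuous_map Z euclideanreal (val K t)"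
      unfolding finer_polish_def by blast
  qed
qed

end
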